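(* Let $0<\delta\le 0.1$ be an arbitrary absolute constant, and let $d,n,k\in\mathbb{N}$ with $d\ge k$ be such that $n=o(\min(d,k^{2-\delta}))$ (asymptotics as $n\to\infty$, with $d=d(n)$ and $k=k(n)$). Suppose there is an improper learner for the sparse linear regression model with Gaussian design (dimension $d$, sparsity $k$, $n$ samples, noise variance $\sigma^2=1$) that runs in time $d^{k^{o(1)}}$ and achieves prediction error better than $0.01$ with probability at least $1-o(1)$. Then the Hardness Assumption (stated in the context) is false.
   Context: All asymptotic notation is for $n\to\infty$. **Sparse linear regression model with Gaussian design.** $d,k,n\in\mathbb{N}$ and $\sigma\ge 0$ are known. $\Sigma$ is an unknown positive semidefinite $d\times d$ matrix and $x^*\in\mathbb{R}^d$ is an unknown $k$-sparse vector (at most $k$ non-zero entries). One observes $n$ i.i.d. samples $(a_i,y_i)\in\mathbb{R}^d\times\mathbb{R}$ with $y_i=\langle a_i,x^*\rangle+w_i$, where $a_i\sim N(0,\Sigma)$ and $w_i\sim N(0,\sigma^2)$ are independent. Let $A\in\mathbb{R}^{n\times d}$ have rows $a_i$. An algorithm achieves prediction error $\rho$ if it outputs $\hat x\in\mathbb{R}^d$ with $\frac1n\|Ax^*-A\hat x\|^2\le\rho$. It is called an improper learner because $\hat x$ may be dense. The success guarantee is required for every $\Sigma$ and every $k$-sparse $x^*$, with probability over the samples and the algorithm's internal randomness. **The problem $\mathrm{NegSPCA}_\theta$** (parameters $d\ge k$, $n$, $\theta\in(0,1)$). Given $n$ i.i.d. samples in $\mathbb{R}^{d+1}$ from either $\mathcal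 P$ or $\mathcal Q$, decide which. - Planted $\mathcal P$: sample once a unit vector $x\in\mathbb{R}^{d+1}$ with first coordinate $x_1=-\frac1{\sqrt{k+1}}$ and remaining coordinates $x_{\setminus 1}$ uniform over the vectors in $\{\pm\frac1{\sqrt{k+1}},0\}^d$ with exactly $k$ non-zero entries; with this $x$ fixed, all samples are drawn i.i.d. from $N(0,\mathrm{Id}_{d+1}-\theta xx^\top)$. - Null $\mathcal Q$: samples are i.i.d. from $N(0,\mathrm{Id}_{d+1})$. An algorithm solves the problem with probability $p$ if under each of the two hypotheses it answers correctly with probability at least $p$. **Hardness Assumption.** Let $d,n,k\in\mathbb{N}$ with $d\ge k$ and let $0<\delta\le 0.1$ be an arbitrary absolute constant. Suppose $n=o(\min(d,k^{2-\delta}))$. Then for any $\theta\in(0,1)$ (possibly depending on $d,k,n$), any algorithm that solves $\mathrm{NegSPCA}_\theta$ with parameters $d,k$ using $n$ samples with success probability at least $1-o(1)$ requires running time $d^{k^{\Omega(1)}}$. *)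

theory Defs
  imports "HOL-Probability.Probability" "HOL-Library.Landau_Symbols"
begin

section \<open>Randomized real RAM programs\<close>

text \<open>
  Algorithms on real-valued samples are uniform programs of a randomized real RAM, presented as a
  structured while language.  Variables are counters in \<^typ>\<open>nat\<close> and two-dimensional arrays of
  exact reals, both addressed by name.  Array subscripts are counter expressions (indirect
  addressing).  There is no rounding from reals to counters and no unit-cost multiplication of
  counters, so large integers give no bit-level parallelism, and the only constants are natural
  numbers, so no advice is hidden in a program.

  Internal randomness is an infinite tape of independent standard normals, read sequentially.
  This also provides fair coins (signs) and uniform variables: for independent standard normals
  \<open>X, Y, Z, W\<close> the ratio \<open>(X\<^sup>2 + Y\<^sup>2) / (X\<^sup>2 + Y\<^sup>2 + Z\<^sup>2 + W\<^sup>2)\<close> is uniform on \<open>[0,1]\<close>.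
\<close>

datatype nexp = NConst nat | NVar nat | NAdd nexp nexp | NSub nexp nexp

datatype rexp =
    RNat nexp
  | RCell nat nexp nexp
  | RAdd rexp rexp
  | RSub rexp rexp
  | RMul rexp rexp
  | RDiv rexp rexp

datatype bexp = NLess nexp nexp | RLess rexp rexp

datatype com =
    Skip
  | NAssign nat nexp
  | RAssign nat nexp nexp rexp
  | Gauss nat nexp nexp
  | Seq com com
  | If bexp com com
  | While bexp com

record ram_state =
  counter :: "nat \<Rightarrow> nat"
  arr :: "nat \<Rightarrow> nat \<Rightarrow> nat \<Rightarrow> real"
  tape_pos :: nat

primrec nval :: "nexp \<Rightarrow> ram_state \<Rightarrow> nat" where
  "nval (NConst c) s = c"
| "nval (NVar v) s = counter s v"
| "nval (NAdd e f) s = nval e s + nval f s"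
| "nval (NSub e f) s = nval e s - nval f s"

primrec rval :: "rexp \<Rightarrow> ram_state \<Rightarrow> real" where
  "rval (RNat e) s = real (nval e s)"
| "rval (RCell a e f) s = arr s a (nval e s) (nval f s)"
| "rval (RAdd p q) s = rval p s + rval q s"
| "rval (RSub p q) s = rval p s - rval q s"
| "rval (RMul p q) s = rval p s * rval q s"
| "rval (RDiv p q) s = rval p s / rval q s"

primrec bval :: "bexp \<Rightarrow> ram_state \<Rightarrow> bool" where
  "bval (NLess e f) s \<longleftrightarrow> nval e s < nval f s"
| "bval (RLess p q) s \<longleftrightarrow> rval p s < rval q s"

definition set_cell :: "nat \<Rightarrow> nat \<Rightarrow> nat \<Rightarrow> real \<Rightarrow> ram_state \<Rightarrow> ram_state" where
  "set_cell a i j r s = s\<lparr>arr := (arr s)(a := (arr s a)(i := (arr s a i)(j := r)))\<rparr>"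

text \<open>
  \<open>exec \<omega> c s t s'\<close>: with random tape \<open>\<omega>\<close>, program \<open>c\<close> started in \<open>s\<close> halts in \<open>s'\<close> after \<open>t\<close>
  steps.  Every elementary command and every test costs one step; the size of the expressions
  is a constant of the program.
\<close>

inductive exec :: "(nat \<Rightarrow> real) \<Rightarrow> com \<Rightarrow> ram_state \<Rightarrow> nat \<Rightarrow> ram_state \<Rightarrow> bool"
  for \<omega> :: "nat \<Rightarrow> real" where
  Skip: "exec \<omega> Skip s 1 s"
| NAssign: "exec \<omega> (NAssign v e) s 1 (s\<lparr>counter := (counter s)(v := nval e s)\<rparr>)"
| RAssign: "exec \<omega> (RAssign a e f p) s 1 (set_cell a (nval e s) (nval f s) (rval p s) s)"
| Gauss: "exec \<omega> (Gauss a e f) s 1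
    (set_cell a (nval e s) (nval f s) (\<omega> (tape_pos s)) (s\<lparr>tape_pos := Suc (tape_pos s)\<rparr>))"
| Seq: "exec \<omega> c1 s1 t1 s2 \<Longrightarrow> exec \<omega> c2 s2 t2 s3 \<Longrightarrow> exec \<omega> (Seq c1 c2) s1 (t1 + t2) s3"
| IfTrue: "bval b s \<Longrightarrow> exec \<omega> c1 s t s' \<Longrightarrow> exec \<omega> (If b c1 c2) s (Suc t) s'"
| IfFalse: "\<not> bval b s \<Longrightarrow> exec \<omega> c2 s t s' \<Longrightarrow> exec \<omega> (If b c1 c2) s (Suc t) s'"
| WhileFalse: "\<not> bval b s \<Longrightarrow> exec \<omega> (While b c) s 1 s"
| WhileTrue: "bval b s1 \<Longrightarrow> exec \<omega> c s1 t1 s2 \<Longrightarrow> exec \<omega> (While b c) s2 t2 s3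
    \<Longrightarrow> exec \<omega> (While b c) s1 (Suc (t1 + t2)) s3"

inductive_cases SkipE: "exec \<omega> Skip s t s'"
inductive_cases NAssignE: "exec \<omega> (NAssign v e) s t s'"
inductive_cases RAssignE: "exec \<omega> (RAssign a e f p) s t s'"
inductive_cases GaussE: "exec \<omega> (Gauss a e f) s t s'"
inductive_cases SeqE: "exec \<omega> (Seq c1 c2) s t s'"
inductive_cases IfE: "exec \<omega> (If b c1 c2) s t s'"
inductive_cases WhileE: "exec \<omega> (While b c) s t s'"

lemma exec_deterministic:
  "exec \<omega> c s t s' \<Longrightarrow> exec \<omega> c s u s'' \<Longrightarrow> u = t \<and> s'' = s'"
proof (induction arbitrary: u s'' rule: exec.induct)
  case (Skip s)
  then show ?case by (rule SkipE) simp
next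
  case (NAssign v e s)
  then show ?case by (rule NAssignE) simp
next
  case (RAssign a e f p s)
  then show ?case by (rule RAssignE) simp
next
  case (Gauss a e f s)
  then show ?case by (rule GaussE) simp
next
  case (Seq c1 s1 t1 s2 c2 t2 s3)
  from Seq.prems show ?case by (rule SeqE) (use Seq.IH in blast)+
next
  case (IfTrue b s c1 t s' c2)
  from IfTrue.prems show ?case
    by (rule IfE) (use IfTrue.IH IfTrue.hyps in blast)+
next
  case (IfFalse b s c2 t s' c1)
  from IfFalse.prems show ?case
    by (rule IfE) (use IfFalse.IH IfFalse.hyps in blast)+
next
  case (WhileFalse b s c)
  from WhileFalse.prems show ?case
    by (rule WhileE) (use WhileFalse.hyps in simp_all)
next
  case (WhileTrue b s1 c t1 s2 t2 s3)
  from WhileTrue.prems show ?case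
    by (rule WhileE) (use WhileTrue.IH WhileTrue.hyps in blast)+
qed


section \<open>Gaussian laws\<close>

text \<open>
  Vectors in dimension \<open>d\<close> are functions on \<open>{..<d}\<close>, since \<open>d\<close> varies with the number of
  samples; only the entries with indices below \<open>d\<close> of a vector or matrix are used.
\<close>

text \<open>The centred normal law with standard deviation \<open>\<tau> \<ge> 0\<close>; the case \<open>\<tau> = 0\<close> is allowed.\<close>

definition normal_law :: "real \<Rightarrow> real measure" where
  "normal_law \<tau> = (if \<tau> = 0 then return borel 0 else density lborel (normal_density 0 \<tau>))"

definition quad_form :: "nat \<Rightarrow> (nat \<Rightarrow> nat \<Rightarrow> real) \<Rightarrow> (nat \<Rightarrow> real) \<Rightarrow> real" where
  "quad_form d \<Sigma> u = (\<Sum>i<d. \<Sum>j<d. u i * \<Sigma> i j * u j)"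

definition psd :: "nat \<Rightarrow> (nat \<Rightarrow> nat \<Rightarrow> real) \<Rightarrow> bool" where
  "psd d \<Sigma> \<longleftrightarrow> (\<forall>i<d. \<forall>j<d. \<Sigma> i j = \<Sigma> j i) \<and> (\<forall>u. 0 \<le> quad_form d \<Sigma> u)"

definition inner_prod :: "nat \<Rightarrow> (nat \<Rightarrow> real) \<Rightarrow> (nat \<Rightarrow> real) \<Rightarrow> real" where
  "inner_prod d u v = (\<Sum>i<d. u i * v i)"

text \<open>
  For \<open>\<Sigma>\<close> positive semidefinite, possibly singular, \<open>N(0, \<Sigma>)\<close> is the law on \<open>\<real>\<^sup>d\<close> under which
  every linear functional \<open>\<langle>u, \<cdot>\<rangle>\<close> is normal with mean zero and variance \<open>u\<^sup>T \<Sigma> u\<close>.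
\<close>

definition mv_normal :: "nat \<Rightarrow> (nat \<Rightarrow> nat \<Rightarrow> real) \<Rightarrow> (nat \<Rightarrow> real) measure" where
  "mv_normal d \<Sigma> = (THE \<mu>. sets \<mu> = sets (Pi\<^sub>M {..<d} (\<lambda>_. borel :: real measure)) \<and>
      (\<forall>u. distr \<mu> borel (inner_prod d u) = normal_law (sqrt (quad_form d \<Sigma> u))))"

definition random_tape :: "(nat \<Rightarrow> real) measure" where
  "random_tape = Pi\<^sub>M UNIV (\<lambda>_. normal_law 1)"


section \<open>Sparse linear regression with Gaussian design\<close>

definition sparse :: "nat \<Rightarrow> nat \<Rightarrow> (nat \<Rightarrow> real) \<Rightarrow> bool" where
  "sparse d k x \<longleftrightarrow> card {i. i < d \<and> x i \<noteq> 0} \<le> k"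

definition prediction_error ::
    "nat \<Rightarrow> nat \<Rightarrow> (nat \<Rightarrow> nat \<Rightarrow> real) \<Rightarrow> (nat \<Rightarrow> real) \<Rightarrow> (nat \<Rightarrow> real) \<Rightarrow> real" where
  "prediction_error n d A x x' = (\<Sum>i<n. (inner_prod d (A i) x - inner_prod d (A i) x')\<^sup>2) / real n"

text \<open>
  Calling convention of learners: \<open>n, d, k\<close> are in counters 0, 1, 2, the matrix \<open>A\<close> is in
  array 0, the responses \<open>y\<close> are in column 0 of array 1, and \<open>\<sigma>\<close> is in cell \<open>(0,0)\<close> of array 2.
  Everything else is zero.  The estimate is returned in column 0 of array 3.
\<close>

definition counter_input :: "nat \<Rightarrow> nat \<Rightarrow> nat \<Rightarrow> nat \<Rightarrow> nat" where
  "counter_input n d k = (\<lambda>_. 0)(0 := n, 1 := d, 2 := k)"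

definition slr_input ::
    "nat \<Rightarrow> nat \<Rightarrow> nat \<Rightarrow> real \<Rightarrow> (nat \<Rightarrow> nat \<Rightarrow> real) \<Rightarrow> (nat \<Rightarrow> real) \<Rightarrow> ram_state" where
  "slr_input n d k \<sigma> A y = \<lparr>
     counter = counter_input n d k,
     arr = (\<lambda>a i j. if a = 0 \<and> i < n \<and> j < d then A i j
                    else if a = 1 \<and> i < n \<and> j = 0 then y i
                    else if a = 2 \<and> i = 0 \<and> j = 0 then \<sigma>
                    else 0),
     tape_pos = 0\<rparr>"

definition slr_output :: "ram_state \<Rightarrow> nat \<Rightarrow> real" where
  "slr_output s = (\<lambda>j. arr s 3 j 0)"

text \<open>A sample point consists of the \<open>n\<close> independent pairs \<open>(a\<^sub>i, w\<^sub>i)\<close> and the random tape.\<close>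

definition slr_space ::
    "nat \<Rightarrow> nat \<Rightarrow> real \<Rightarrow> (nat \<Rightarrow> nat \<Rightarrow> real) \<Rightarrow>
      ((nat \<Rightarrow> (nat \<Rightarrow> real) \<times> real) \<times> (nat \<Rightarrow> real)) measure" where
  "slr_space n d \<sigma> \<Sigma> =
     Pi\<^sub>M {..<n} (\<lambda>_. mv_normal d \<Sigma> \<Otimes>\<^sub>M normal_law \<sigma>) \<Otimes>\<^sub>M random_tape"

text \<open>The probability that the learner \<open>L\<close> halts with prediction error better than \<open>\<rho>\<close>.\<close>

definition slr_success_prob ::
    "com \<Rightarrow> nat \<Rightarrow> nat \<Rightarrow> nat \<Rightarrow> real \<Rightarrow> real \<Rightarrow> (nat \<Rightarrow> nat \<Rightarrow> real) \<Rightarrow> (nat \<Rightarrow> real) \<Rightarrow> real" where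
  "slr_success_prob L n d k \<sigma> \<rho> \<Sigma> x =
     measure (slr_space n d \<sigma> \<Sigma>)
       {(S, \<omega>) \<in> space (slr_space n d \<sigma> \<Sigma>).
          let A = (\<lambda>i. fst (S i)); y = (\<lambda>i. inner_prod d (A i) x + snd (S i))
          in \<exists>t s'. exec \<omega> L (slr_input n d k \<sigma> A y) t s' \<and>
                    prediction_error n d A x (slr_output s') < \<rho>}"

text \<open>
  Parameters are sequences indexed by the number \<open>n\<close> of samples, and \<open>o(1)\<close> in the success
  probability is uniform over \<open>\<Sigma>\<close> and \<open>x\<close>.
\<close>

definition slr_learner_whp ::
    "com \<Rightarrow> (nat \<Rightarrow> nat) \<Rightarrow> (nat \<Rightarrow> nat) \<Rightarrow> real \<Rightarrow> real \<Rightarrow> bool" where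
  "slr_learner_whp L d k \<sigma> \<rho> \<longleftrightarrow>
     (\<exists>\<epsilon> :: nat \<Rightarrow> real. \<epsilon> \<in> o(\<lambda>_. 1) \<and>
       (\<forall>n \<Sigma> x. psd (d n) \<Sigma> \<longrightarrow> sparse (d n) (k n) x \<longrightarrow>
          slr_success_prob L n (d n) (k n) \<sigma> \<rho> \<Sigma> x \<ge> 1 - \<epsilon> n))"

text \<open>Running time is worst case, over all real inputs of the given format and all random tapes.\<close>

definition slr_runs_in_time ::
    "com \<Rightarrow> (nat \<Rightarrow> nat) \<Rightarrow> (nat \<Rightarrow> nat) \<Rightarrow> real \<Rightarrow> (nat \<Rightarrow> real) \<Rightarrow> bool" where
  "slr_runs_in_time L d k \<sigma> T \<longleftrightarrow>
     (\<forall>\<^sub>F n in sequentially. \<forall>A y \<omega>. \<exists>t s'.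
        exec \<omega> L (slr_input n (d n) (k n) \<sigma> A y) t s' \<and> real t \<le> T n)"


section \<open>Negative sparse PCA\<close>

text \<open>
  The support of the planted direction.  Coordinates of \<open>\<real>\<^bsup>d+1\<^esup>\<close> are \<open>0, \<dots>, d\<close>, and \<open>0\<close> is the
  distinguished one.  Values beyond \<open>d\<close> are irrelevant; they are fixed to make the set finite.
\<close>

definition spikes :: "nat \<Rightarrow> nat \<Rightarrow> (nat \<Rightarrow> real) set" where
  "spikes d k = {x. x 0 = - 1 / sqrt (real k + 1) \<and>
      (\<forall>j\<in>{1..d}. x j \<in> {1 / sqrt (real k + 1), - 1 / sqrt (real k + 1), 0}) \<and>
      card {j\<in>{1..d}. x j \<noteq> 0} = k \<and>
      (\<forall>j>d. x j = 0)}"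

definition spiked_cov :: "real \<Rightarrow> (nat \<Rightarrow> real) \<Rightarrow> nat \<Rightarrow> nat \<Rightarrow> real" where
  "spiked_cov \<theta> x i j = (if i = j then 1 else 0) - \<theta> * x i * x j"

definition id_cov :: "nat \<Rightarrow> nat \<Rightarrow> real" where
  "id_cov i j = (if i = j then 1 else 0)"

text \<open>
  Calling convention of distinguishers: \<open>n, d, k\<close> are in counters 0, 1, 2, sample \<open>i\<close> is row \<open>i\<close>
  of array 0, and \<open>\<theta>\<close> is in cell \<open>(0,0)\<close> of array 1.  Everything else is zero.  On halting, the
  answer is ``planted'' if counter 3 holds 1 and ``null'' otherwise.
\<close>

definition negspca_input ::
    "nat \<Rightarrow> nat \<Rightarrow> nat \<Rightarrow> real \<Rightarrow> (nat \<Rightarrow> nat \<Rightarrow> real) \<Rightarrow> ram_state" where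
  "negspca_input n d k \<theta> Z = \<lparr>
     counter = counter_input n d k,
     arr = (\<lambda>a i j. if a = 0 \<and> i < n \<and> j \<le> d then Z i j
                    else if a = 1 \<and> i = 0 \<and> j = 0 then \<theta>
                    else 0),
     tape_pos = 0\<rparr>"

definition says_planted :: "ram_state \<Rightarrow> bool" where
  "says_planted s \<longleftrightarrow> counter s 3 = 1"

definition negspca_space ::
    "nat \<Rightarrow> (nat \<Rightarrow> real) measure \<Rightarrow> ((nat \<Rightarrow> nat \<Rightarrow> real) \<times> (nat \<Rightarrow> real)) measure" where
  "negspca_space n \<mu> = Pi\<^sub>M {..<n} (\<lambda>_. \<mu>) \<Otimes>\<^sub>M random_tape"

text \<open>
  The probability that \<open>B\<close> halts with answer \<open>planted\<close> (true or false) on \<open>n\<close> independent samples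
  from \<open>\<mu>\<close>.
\<close>

definition answer_prob ::
    "com \<Rightarrow> nat \<Rightarrow> nat \<Rightarrow> nat \<Rightarrow> real \<Rightarrow> (nat \<Rightarrow> real) measure \<Rightarrow> bool \<Rightarrow> real" where
  "answer_prob B n d k \<theta> \<mu> planted =
     measure (negspca_space n \<mu>)
       {(Z, \<omega>) \<in> space (negspca_space n \<mu>).
          \<exists>t s'. exec \<omega> B (negspca_input n d k \<theta> Z) t s' \<and> says_planted s' = planted}"

definition planted_success_prob :: "com \<Rightarrow> nat \<Rightarrow> nat \<Rightarrow> nat \<Rightarrow> real \<Rightarrow> real" where
  "planted_success_prob B n d k \<theta> =
     measure_pmf.expectation (pmf_of_set (spikes d k))
       (\<lambda>x. answer_prob B n d k \<theta> (mv_normal (d + 1) (spiked_cov \<theta> x)) True)"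

definition null_success_prob :: "com \<Rightarrow> nat \<Rightarrow> nat \<Rightarrow> nat \<Rightarrow> real \<Rightarrow> real" where
  "null_success_prob B n d k \<theta> = answer_prob B n d k \<theta> (mv_normal (d + 1) id_cov) False"

definition solves_negspca :: "com \<Rightarrow> nat \<Rightarrow> nat \<Rightarrow> nat \<Rightarrow> real \<Rightarrow> real \<Rightarrow> bool" where
  "solves_negspca B n d k \<theta> p \<longleftrightarrow>
     planted_success_prob B n d k \<theta> \<ge> p \<and> null_success_prob B n d k \<theta> \<ge> p"

definition solves_negspca_whp ::
    "com \<Rightarrow> (nat \<Rightarrow> nat) \<Rightarrow> (nat \<Rightarrow> nat) \<Rightarrow> (nat \<Rightarrow> real) \<Rightarrow> bool" where
  "solves_negspca_whp B d k \<theta> \<longleftrightarrow>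
     (\<exists>\<epsilon> :: nat \<Rightarrow> real. \<epsilon> \<in> o(\<lambda>_. 1) \<and>
        (\<forall>n. solves_negspca B n (d n) (k n) (\<theta> n) (1 - \<epsilon> n)))"

definition negspca_runs_in_time ::
    "com \<Rightarrow> (nat \<Rightarrow> nat) \<Rightarrow> (nat \<Rightarrow> nat) \<Rightarrow> (nat \<Rightarrow> real) \<Rightarrow> (nat \<Rightarrow> real) \<Rightarrow> bool" where
  "negspca_runs_in_time B d k \<theta> T \<longleftrightarrow>
     (\<forall>\<^sub>F n in sequentially. \<forall>Z \<omega>. \<exists>t s'.
        exec \<omega> B (negspca_input n (d n) (k n) (\<theta> n) Z) t s' \<and> real t \<le> T n)"


section \<open>Time bounds and the hardness assumption\<close>

text \<open>\<open>T = d\<close> to the power \<open>k\<^bsup>o(1)\<^esup>\<close>, as an upper bound.\<close>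

definition time_d_k_o1 ::
    "(nat \<Rightarrow> nat) \<Rightarrow> (nat \<Rightarrow> nat) \<Rightarrow> (nat \<Rightarrow> real) \<Rightarrow> bool" where
  "time_d_k_o1 d k T \<longleftrightarrow>
     (\<exists>f :: nat \<Rightarrow> real. f \<in> o(\<lambda>_. 1) \<and>
        (\<forall>\<^sub>F n in sequentially. T n \<le> real (d n) powr (real (k n) powr f n)))"

text \<open>\<open>T = d\<close> to the power \<open>k\<^bsup>\<Omega>(1)\<^esup>\<close>, as a lower bound.\<close>

definition time_d_k_Omega1 ::
    "(nat \<Rightarrow> nat) \<Rightarrow> (nat \<Rightarrow> nat) \<Rightarrow> (nat \<Rightarrow> real) \<Rightarrow> bool" where
  "time_d_k_Omega1 d k T \<longleftrightarrow>
     (\<exists>c>0. \<forall>\<^sub>F n in sequentially. T n \<ge> real (d n) powr (real (k n) powr c))"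

definition sample_regime :: "real \<Rightarrow> (nat \<Rightarrow> nat) \<Rightarrow> (nat \<Rightarrow> nat) \<Rightarrow> bool" where
  "sample_regime \<delta> d k \<longleftrightarrow>
     (\<forall>n. k n \<le> d n) \<and>
     (\<lambda>n. real n) \<in> o(\<lambda>n. min (real (d n)) (real (k n) powr (2 - \<delta>)))"

definition hardness_assumption :: bool where
  "hardness_assumption \<longleftrightarrow>
     (\<forall>\<delta> d k. 0 < \<delta> \<longrightarrow> \<delta> \<le> 1 / 10 \<longrightarrow> sample_regime \<delta> d k \<longrightarrow>
       (\<forall>\<theta> :: nat \<Rightarrow> real. (\<forall>n. 0 < \<theta> n \<and> \<theta> n < 1) \<longrightarrow>
         (\<forall>B T. solves_negspca_whp B d k \<theta> \<longrightarrow> negspca_runs_in_time B d k \<theta> T \<longrightarrow>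
           time_d_k_Omega1 d k T)))"

end

theory Submission
  imports Defs "HOL-Real_Asymp.Real_Asymp"
begin

text \<open>
  Let \<open>r = (n + 1) / (n + 2)\<close> and choose \<open>\<theta>\<close> such that, under the planted law, regressing the first
  coordinate of a sample on the others leaves a residual \<open>s \<xi>\<close> with \<open>\<xi>\<close> standard normal and
  \<open>s\<^sup>2 = 1 - r\<^sup>2\<close>; the regression coefficient \<open>x*\<close> is a multiple of the spike, hence sparse.  The
  distinguisher adds fresh noise \<open>r w\<close> to the first coordinate \<open>z\<close>, so that the learner faces
  exactly unit noise \<open>s \<xi> + r w\<close>, and tests whether the prediction is close to \<open>z\<close>.  In the
  planted case it is, since \<open>z = \<langle>a, x*\<rangle> + s \<xi>\<close> and \<open>s \<longlonglongrightarrow> 0\<close>.  In the null case the learner sees \<open>z\<close> only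
  through \<open>z + r w\<close>, and \<open>r z - w\<close> is independent of all its inputs, so no estimate of \<open>z\<close>, however
  dense, succeeds with more than exponentially small probability.
\<close>

section \<open>Uniqueness of joint characteristic functions\<close>

text \<open>The noise factor \<open>r\<close> has to meet three demands: \<open>r < 1\<close> keeps
  \<theta> below 1, \<open>r\<close> tending to 1 makes the residual vanish, and \<open>r\<close>
  must be computable from \<open>n\<close> by the four arithmetic operations, since the machine has
  no square roots. The strength \<theta>, in contrast, enters the analysis only; the program never
  reads it. Two obstacles shape the proof. First, \<open>mv_normal\<close> is a definite description
  in terms of one-dimensional projections, so every change of a Gaussian representation has to be
  justified through characteristic functions, and their uniqueness comes first. Second, the success
  event of the learner comes without measurability, and its estimate is merely the outcome of some
  program. Under the planted law a positive success probability itself forces that event to be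
  measurable. Under the null law the estimate is treated as an arbitrary function, and only the
  final answer of the distinguisher is shown to be a measurable event.\<close>

lemma weighted_cf_unique:
  fixes M :: "'a measure" and N :: "'b measure" and w :: "'a \<Rightarrow> real" and v :: "'b \<Rightarrow> real"
  assumes "prob_space M" "prob_space N"
    and [measurable]: "X \<in> borel_measurable M" "Y \<in> borel_measurable N"
      "w \<in> borel_measurable M" "v \<in> borel_measurable N" "A \<in> sets borel"
    and w: "\<And>x. 0 \<le> w x" "\<And>x. w x \<le> C" and v: "\<And>y. 0 \<le> v y" "\<And>y. v y \<le> C"
    and eq: "\<And>t. (CLINT x|M. w x * iexp (t * X x)) = (CLINT y|N. v y * iexp (t * Y y))"
  shows "(LINT x|M. w x * indicator A (X x)) = (LINT y|N. v y * indicator A (Y y))"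
proof -
  interpret M: prob_space M by fact
  interpret N: prob_space N by fact
  have iw: "integrable M w"
    by (rule M.integrable_const_bound[where B=C]) (use w in auto)
  have iv: "integrable N v"
    by (rule N.integrable_const_bound[where B=C]) (use v in auto)
  have iwA: "integrable M (\<lambda>x. w x * indicator A (X x))"
    by (rule Bochner_Integration.integrable_bound[OF iw]) (use w in \<open>auto simp: indicator_def\<close>)
  have ivA: "integrable N (\<lambda>x. v x * indicator A (Y x))"
    by (rule Bochner_Integration.integrable_bound[OF iv]) (use v in \<open>auto simp: indicator_def\<close>)
  \<comment> \<open>Both weights have the same mass \<open>c\<close>, by the transform at
    \<open>t = 0\<close>. Dividing by it gives probability laws, to which Levy's theorem applies;
    mass 0 is the trivial case.\<close>
  define c where "c = integral\<^sup>L M w"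
  have c: "c = integral\<^sup>L N v"
    using eq[of 0] by (simp add: c_def)
  have c0: "c \<ge> 0" unfolding c_def using w by simp
  have real_distr: "real_distribution (distr (density K (\<lambda>x. ennreal (g x / c))) borel Z)
      \<and> char (distr (density K (\<lambda>x. ennreal (g x / c))) borel Z) t = (CLINT x|K. g x * iexp (t * Z x)) / c
      \<and> measure (distr (density K (\<lambda>x. ennreal (g x / c))) borel Z) A = (LINT x|K. g x * indicator A (Z x)) / c"
    if [measurable]: "Z \<in> borel_measurable K" "g \<in> borel_measurable K" and g: "\<And>x. 0 \<le> g x"
      and ig: "integrable K g" and igA: "integrable K (\<lambda>x. g x * indicator A (Z x))"
      and gc: "integral\<^sup>L K g = c" "c > 0" for K :: "'c measure" and Z g t
  proof -
    have "emeasure (density K (\<lambda>x. ennreal (g x / c))) (space (density K (\<lambda>x. ennreal (g x / c)))) = 1"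
      using g gc ig by (simp add: emeasure_density nn_integral_eq_integral cong: nn_integral_cong)
    then have p: "prob_space (density K (\<lambda>x. ennreal (g x / c)))" by (rule prob_spaceI)
    have r: "real_distribution (distr (density K (\<lambda>x. ennreal (g x / c))) borel Z)"
      unfolding real_distribution_def real_distribution_axioms_def
      using prob_space.prob_space_distr[OF p, of Z borel] by simp
    have "char (distr (density K (\<lambda>x. ennreal (g x / c))) borel Z) t
       = (CLINT x|K. (g x / c) *\<^sub>R iexp (t * Z x))"
      unfolding char_def using g gc
      by (subst integral_distr) (auto intro!: integral_density)
    also have "\<dots> = (CLINT x|K. g x * iexp (t * Z x)) / c"
      by (simp add: scaleR_conv_of_real)
    finally have ch: "char (distr (density K (\<lambda>x. ennreal (g x / c))) borel Z) t = \<dots>" .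
    have "emeasure (distr (density K (\<lambda>x. ennreal (g x / c))) borel Z) A
      = (\<integral>\<^sup>+x. ennreal (g x / c) * indicator A (Z x) \<partial>K)"
      by (subst emeasure_distr) (auto simp: emeasure_density indicator_def vimage_def intro!: nn_integral_cong)
    also have "\<dots> = (\<integral>\<^sup>+x. ennreal (g x * indicator A (Z x) / c) \<partial>K)"
      by (intro nn_integral_cong) (auto simp: indicator_def)
    also have "\<dots> = ennreal (LINT x|K. g x * indicator A (Z x) / c)"
      using igA g gc by (intro nn_integral_eq_integral) auto
    finally have "measure (distr (density K (\<lambda>x. ennreal (g x / c))) borel Z) A
       = (LINT x|K. g x * indicator A (Z x)) / c"
      using g gc by (simp add: measure_def)
    with r ch show ?thesis by simp
  qed
  show ?thesis
  proof (cases "c = 0")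
    case True
    have "(LINT x|M. w x * indicator A (X x)) \<le> c" unfolding c_def
      by (intro integral_mono iwA iw) (use w in \<open>auto simp: indicator_def\<close>)
    moreover have "(LINT x|N. v x * indicator A (Y x)) \<le> c" unfolding c
      by (intro integral_mono ivA iv) (use v in \<open>auto simp: indicator_def\<close>)
    moreover have "(LINT x|M. w x * indicator A (X x)) \<ge> 0" using w by simp
    moreover have "(LINT x|N. v x * indicator A (Y x)) \<ge> 0" using v by simp
    ultimately show ?thesis using True by simp
  next
    case False
    then have cp: "c > 0" using c0 by simp
    note P = real_distr[OF _ _ w(1) iw iwA c_def[symmetric] cp]
    note Q = real_distr[OF _ _ v(1) iv ivA c[symmetric] cp]
    have "distr (density M (\<lambda>x. ennreal (w x / c))) borel X = distr (density N (\<lambda>x. ennreal (v x / c))) borel Y"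
      by (rule Levy_uniqueness) (use P Q eq in \<open>auto simp: fun_eq_iff\<close>)
    then show ?thesis using P Q cp
      by (metis assms(3-6) divide_cancel_right less_irrefl)
  qed
qed

lemma integral_lincomb3:
  fixes f g h :: "'a \<Rightarrow> complex"
  assumes "integrable K f" "integrable K g" "integrable K h"
  shows "(LINT x|K. f x + b * g x + c * h x) = integral\<^sup>L K f + b * integral\<^sup>L K g + c * integral\<^sup>L K h"
  using assms by simp

text \<open>
  The exponentials are replaced by indicators one coordinate at a time: with the other factors as
  weights, made nonnegative by using \<open>1 + cos\<close> and \<open>1 + sin\<close>, this is Levy's uniqueness theorem.
\<close>

lemma joint_cf_unique:
  fixes M :: "'a measure" and N :: "'b measure" and X :: "'i \<Rightarrow> 'a \<Rightarrow> real" and Y :: "'i \<Rightarrow> 'b \<Rightarrow> real"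
  assumes M: "prob_space M" and N: "prob_space N" and I: "finite I"
    and X: "\<And>i. i \<in> I \<Longrightarrow> X i \<in> borel_measurable M"
    and Y: "\<And>i. i \<in> I \<Longrightarrow> Y i \<in> borel_measurable N"
    and A: "\<And>i. i \<in> I \<Longrightarrow> A i \<in> sets borel"
    and eq: "\<And>u. (CLINT x|M. iexp (\<Sum>i\<in>I. u i * X i x)) = (CLINT y|N. iexp (\<Sum>i\<in>I. u i * Y i y))"
  shows "measure M {x\<in>space M. \<forall>i\<in>I. X i x \<in> A i} = measure N {y\<in>space N. \<forall>i\<in>I. Y i y \<in> A i}"
proof -
  interpret M: prob_space M by fact
  interpret N: prob_space N by fact
  let ?W = "\<lambda>J x. (\<Prod>i\<in>J. indicator (A i) (X i x)) :: real"
  let ?V = "\<lambda>J y. (\<Prod>i\<in>J. indicator (A i) (Y i y)) :: real"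
  have W: "0 \<le> ?W J x \<and> ?W J x \<le> 1" and V: "0 \<le> ?V J y \<and> ?V J y \<le> 1" for J x y
    by (auto intro!: prod_nonneg prod_le_1 simp: indicator_def)
  have mW: "?W J \<in> borel_measurable M" and mV: "?V J \<in> borel_measurable N" if "J \<subseteq> I" for J
    using that X Y A by (auto intro!: borel_measurable_prod borel_measurable_indicator'
       simp: subset_eq measurable_sets_borel)
  have bound: "integrable K (\<lambda>x. complex_of_real (g x) * h x)"
    if "prob_space K" "g \<in> borel_measurable K" "h \<in> borel_measurable K"
      "\<And>x. 0 \<le> g x \<and> g x \<le> 1" "\<And>x. cmod (h x) \<le> 1" for K :: "'c measure" and g h
  proof -
    interpret K: prob_space K by fact
    note that(2,3)[measurable]
    show ?thesis
      by (rule K.integrable_const_bound[where B=1])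
        (use that in \<open>auto simp: norm_mult intro!: mult_le_one\<close>)
  qed
  \<comment> \<open>Invariant of the exchange: coordinates in \<open>J\<close> carry indicators, the
    others still carry exponentials. \<open>J = {}\<close> is the hypothesis, \<open>J = I\<close>
    the claim.\<close>
  have "\<forall>u. (CLINT x|M. ?W J x * iexp (\<Sum>i\<in>I-J. u i * X i x)) = (CLINT y|N. ?V J y * iexp (\<Sum>i\<in>I-J. u i * Y i y))"
    if "finite J" "J \<subseteq> I" for J
    using that
  proof (induction J rule: finite_induct)
    case empty
    then show ?case using eq by simp
  next
    case (insert j J)
    then have jI: "j \<in> I" "J \<subseteq> I" "j \<notin> J" by auto
    have WJ: "0 \<le> ?W J x \<and> ?W J x \<le> 1" and VJ: "0 \<le> ?V J y \<and> ?V J y \<le> 1" for x y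
      by (rule W, rule V)
    note IH = insert.IH[OF jI(2), rule_format]
    have sum_split: "(\<Sum>i\<in>I-J. f i) = f j + (\<Sum>i\<in>I - insert j J. f i)" for f :: "'i \<Rightarrow> real"
    proof -
      have "I - J - {j} = I - insert j J" by auto
      moreover have "(\<Sum>i\<in>I-J. f i) = f j + (\<Sum>i\<in>I-J-{j}. f i)"
        by (rule sum.remove) (use I jI in auto)
      ultimately show ?thesis by simp
    qed
    note [measurable] = mW[OF jI(2)] mV[OF jI(2)] X[OF jI(1)] Y[OF jI(1)] A[OF jI(1)]
    show ?case
    proof
      fix u :: "'i \<Rightarrow> real"
      define R where "R x = (\<Sum>i\<in>I - insert j J. u i * X i x)" for x
      define S where "S y = (\<Sum>i\<in>I - insert j J. u i * Y i y)" for y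
      have [measurable]: "R \<in> borel_measurable M" "S \<in> borel_measurable N"
        unfolding R_def S_def by (auto intro!: borel_measurable_sum borel_measurable_times X Y)
      \<comment> \<open>The free exponents allow an arbitrary \<open>t\<close> at coordinate
        \<open>j\<close> and a multiple of the old exponents elsewhere. Only the multiples 0, 1 and
        -1 are used: they give the constant and the two exponentials that span cosine and
        sine.\<close>
      have sc: "(CLINT x|M. ?W J x * iexp (t * X j x + s * R x)) = (CLINT y|N. ?V J y * iexp (t * Y j y + s * S y))" for t s
      proof -
        have "(\<Sum>i\<in>I-J. ((\<lambda>i. s * u i)(j := t)) i * X i x) = t * X j x + s * R x" for x
          unfolding sum_split R_def by (auto simp: sum_distrib_left intro!: sum.cong)
        moreover have "(\<Sum>i\<in>I-J. ((\<lambda>i. s * u i)(j := t)) i * Y i x) = t * Y j x + s * S x" for x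
          unfolding sum_split S_def by (auto simp: sum_distrib_left intro!: sum.cong)
        ultimately show ?thesis using IH[of "(\<lambda>i. s * u i)(j := t)"] by simp
      qed
      let ?A = "\<lambda>x. indicator (A j) (X j x) :: real" and ?B = "\<lambda>y. indicator (A j) (Y j y) :: real"
      have e0: "(LINT x|M. ?W J x * ?A x) = (LINT y|N. ?V J y * ?B y)"
        by (rule weighted_cf_unique[OF M N, where C=1]) (use W V sc[of _ 0] in auto)
      have comb: "(CLINT x|K. complex_of_real (g x * (1 + \<alpha> (T x))) * iexp (t * Z x))
          = (CLINT x|K. g x * iexp (t * Z x)) + ba * (CLINT x|K. g x * iexp (t * Z x + T x))
           + bb * (CLINT x|K. g x * iexp (t * Z x - T x))"
        if [measurable]: "g \<in> borel_measurable K" "Z \<in> borel_measurable K" "T \<in> borel_measurable K"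
        and K: "prob_space K" and g: "\<And>x. 0 \<le> g x \<and> g x \<le> 1"
        and al: "\<And>r. complex_of_real (\<alpha> r) = ba * iexp r + bb * iexp (-r)"
        for K :: "'c measure" and g Z T t \<alpha> ba bb
      proof -
        have i1: "integrable K (\<lambda>x. g x * iexp (t * Z x))"
          "integrable K (\<lambda>x. g x * iexp (t * Z x + T x))" "integrable K (\<lambda>x. g x * iexp (t * Z x - T x))"
          by (auto intro!: bound K g)
        have "(CLINT x|K. complex_of_real (g x * (1 + \<alpha> (T x))) * iexp (t * Z x))
          = (CLINT x|K. g x * iexp (t * Z x) + ba * (g x * iexp (t * Z x + T x))
           + bb * (g x * iexp (t * Z x - T x)))"
        proof (rule Bochner_Integration.integral_cong[OF refl])
          fix x
          have "iexp (t * Z x + T x) = iexp (t * Z x) * iexp (T x)"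
            "iexp (t * Z x - T x) = iexp (t * Z x) * iexp (- T x)"
            by (simp_all add: distrib_left right_diff_distrib exp_add exp_diff exp_minus field_simps)
          then show "complex_of_real (g x * (1 + \<alpha> (T x))) * iexp (t * Z x)
            = g x * iexp (t * Z x) + ba * (g x * iexp (t * Z x + T x)) + bb * (g x * iexp (t * Z x - T x))"
            by (simp add: al[of "T x"] algebra_simps)
        qed
        also have "\<dots> = (CLINT x|K. g x * iexp (t * Z x)) + ba * (CLINT x|K. g x * iexp (t * Z x + T x))
           + bb * (CLINT x|K. g x * iexp (t * Z x - T x))"
          using i1 by (rule integral_lincomb3)
        finally show ?thesis .
      qed
      have trig: "(LINT x|M. ?W J x * (1 + \<alpha> (R x)) * ?A x) = (LINT y|N. ?V J y * (1 + \<alpha> (S y)) * ?B y)"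
        if al: "\<And>r. complex_of_real (\<alpha> r) = ba * iexp r + bb * iexp (-r)"
        and [measurable]: "\<alpha> \<in> borel_measurable borel" and b: "\<And>r. \<bar>\<alpha> r\<bar> \<le> 1" for \<alpha> ba bb
      proof (rule weighted_cf_unique[OF M N, where C=2])
        have "0 \<le> 1 + \<alpha> r \<and> 1 + \<alpha> r \<le> 2" for r using b[of r] by linarith
        then show "0 \<le> ?W J x * (1 + \<alpha> (R x))" "?W J x * (1 + \<alpha> (R x)) \<le> 2"
          "0 \<le> ?V J y * (1 + \<alpha> (S y))" "?V J y * (1 + \<alpha> (S y)) \<le> 2" for x y
          using WJ[of x] VJ[of y] mult_mono[of "?W J x" 1 "1 + \<alpha> (R x)" 2]
            mult_mono[of "?V J y" 1 "1 + \<alpha> (S y)" 2] by auto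
        show "(CLINT x|M. complex_of_real (?W J x * (1 + \<alpha> (R x))) * iexp (t * X j x)) =
           (CLINT y|N. complex_of_real (?V J y * (1 + \<alpha> (S y))) * iexp (t * Y j y))" for t
          using sc[of t 0] sc[of t 1] sc[of t "-1"]
          by (subst (1 2) comb[OF _ _ _ _ _ al]) (use W V M N in auto)
      qed measurable
      have iM: "integrable M (\<lambda>x. ?W J x * ?A x * h x)" if [measurable]: "h \<in> borel_measurable M" and "\<And>x. \<bar>h x\<bar> \<le> 1" for h
      proof (rule M.integrable_const_bound[where B=1])
        have "\<bar>?W J x * ?A x * h x\<bar> \<le> 1" for x
          using WJ[of x] that(2)[of x] by (auto simp: abs_mult indicator_def intro!: mult_le_one)
        then show "AE x in M. norm (?W J x * ?A x * h x) \<le> 1" by simp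
      qed measurable
      have iN: "integrable N (\<lambda>x. ?V J x * ?B x * h x)" if [measurable]: "h \<in> borel_measurable N" and "\<And>x. \<bar>h x\<bar> \<le> 1" for h
      proof (rule N.integrable_const_bound[where B=1])
        have "\<bar>?V J x * ?B x * h x\<bar> \<le> 1" for x
          using VJ[of x] that(2)[of x] by (auto simp: abs_mult indicator_def intro!: mult_le_one)
        then show "AE x in N. norm (?V J x * ?B x * h x) \<le> 1" by simp
      qed measurable
      \<comment> \<open>Subtracting the case of weight 1, which is \<open>e0\<close>, removes the
        constant that had been added for positivity.\<close>
      have trig': "(LINT x|M. ?W J x * ?A x * \<alpha> (R x)) = (LINT y|N. ?V J y * ?B y * \<alpha> (S y))"
        if al: "\<And>r. complex_of_real (\<alpha> r) = ba * iexp r + bb * iexp (-r)"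
        and [measurable]: "\<alpha> \<in> borel_measurable borel" and b: "\<And>r. \<bar>\<alpha> r\<bar> \<le> 1" for \<alpha> ba bb
      proof -
        have "(LINT x|M. ?W J x * (1 + \<alpha> (R x)) * ?A x) = (LINT x|M. ?W J x * ?A x * 1 + ?W J x * ?A x * \<alpha> (R x))"
          by (simp add: algebra_simps)
        also have "\<dots> = (LINT x|M. ?W J x * ?A x * 1) + (LINT x|M. ?W J x * ?A x * \<alpha> (R x))"
          by (intro Bochner_Integration.integral_add iM) (use b in auto)
        finally have 1: "(LINT x|M. ?W J x * (1 + \<alpha> (R x)) * ?A x) = \<dots>" .
        have "(LINT x|N. ?V J x * (1 + \<alpha> (S x)) * ?B x) = (LINT x|N. ?V J x * ?B x * 1 + ?V J x * ?B x * \<alpha> (S x))"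
          by (simp add: algebra_simps)
        also have "\<dots> = (LINT x|N. ?V J x * ?B x * 1) + (LINT x|N. ?V J x * ?B x * \<alpha> (S x))"
          by (intro Bochner_Integration.integral_add iN) (use b in auto)
        finally show ?thesis using 1 trig[OF al that(2) b] e0 by simp
      qed
      have alc: "complex_of_real (cos r) = 1/2 * iexp r + 1/2 * iexp (-r)"
        and als: "complex_of_real (sin r) = -\<i>/2 * iexp r + \<i>/2 * iexp (-r)" for r
        by (simp_all add: complex_eq_iff Re_exp Im_exp)
      have C: "(LINT x|M. ?W J x * ?A x * cos (R x)) = (LINT y|N. ?V J y * ?B y * cos (S y))"
        by (rule trig'[OF alc]) auto
      have S: "(LINT x|M. ?W J x * ?A x * sin (R x)) = (LINT y|N. ?V J y * ?B y * sin (S y))"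
        by (rule trig'[OF als]) auto
      have cplx: "(CLINT x|K. complex_of_real (g x) * iexp (T x)) = complex_of_real (LINT x|K. g x * cos (T x)) + \<i> * complex_of_real (LINT x|K. g x * sin (T x))"
        if [measurable]: "g \<in> borel_measurable K" "T \<in> borel_measurable K"
        and K: "prob_space K" and g: "\<And>x. 0 \<le> g x \<and> g x \<le> 1"
        for K :: "'c measure" and g T
      proof -
        have "integrable K (\<lambda>x. complex_of_real (g x) * iexp (T x))"
          by (auto intro!: bound K g)
        from integral_Re[OF this] integral_Im[OF this] show ?thesis
          by (simp add: complex_eq_iff Re_exp Im_exp)
      qed
      have "?W (insert j J) x = ?W J x * ?A x" "?V (insert j J) y = ?V J y * ?B y" for x y
        using insert by simp_all
      moreover have "(CLINT x|M. complex_of_real (?W J x * ?A x) * iexp (R x))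
          = (CLINT y|N. complex_of_real (?V J y * ?B y) * iexp (S y))"
        using C S W V by (subst (1 2) cplx) (auto intro!: M N mult_le_one)
      ultimately show "(CLINT x|M. ?W (insert j J) x * iexp (\<Sum>i\<in>I - insert j J. u i * X i x)) =
         (CLINT y|N. ?V (insert j J) y * iexp (\<Sum>i\<in>I - insert j J. u i * Y i y))"
        unfolding R_def[symmetric] S_def[symmetric] by presburger
    qed
  qed
  from this[OF I order_refl] have "(CLINT x|M. ?W I x) = (CLINT y|N. ?V I y)"
    by simp
  then have e: "integral\<^sup>L M (?W I) = integral\<^sup>L N (?V I)"
    by (simp only: integral_complex_of_real of_real_eq_iff)
  have pr: "?W I x = indicator {x\<in>space M. \<forall>i\<in>I. X i x \<in> A i} x" if "x \<in> space M" for x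
    using I that by (auto simp: indicator_def prod_zero_iff)
  have pv: "?V I x = indicator {x\<in>space N. \<forall>i\<in>I. Y i x \<in> A i} x" if "x \<in> space N" for x
    using I that by (auto simp: indicator_def prod_zero_iff)
  have [measurable]: "{x\<in>space M. \<forall>i\<in>I. X i x \<in> A i} \<in> sets M" "{x\<in>space N. \<forall>i\<in>I. Y i x \<in> A i} \<in> sets N"
    using I X Y A by (auto intro!: sets.sets_Collect_finite_All measurable_sets_Collect)
  have "integral\<^sup>L M (?W I) = measure M {x\<in>space M. \<forall>i\<in>I. X i x \<in> A i}"
    by (subst Bochner_Integration.integral_cong[OF refl pr]) (auto)
  moreover have "integral\<^sup>L N (?V I) = measure N {x\<in>space N. \<forall>i\<in>I. Y i x \<in> A i}"
    by (subst Bochner_Integration.integral_cong[OF refl pv]) (auto)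
  ultimately show ?thesis using e by simp
qed

section \<open>Spiked normal laws\<close>

lemma prob_space_normal_law: "\<tau> \<ge> 0 \<Longrightarrow> prob_space (normal_law \<tau>)"
  by (auto simp: normal_law_def prob_space_return prob_space_normal_density)

lemma sets_normal_law [measurable_cong, simp]: "sets (normal_law \<tau>) = sets borel"
  by (simp add: normal_law_def)

lemma space_normal_law [simp]: "space (normal_law \<tau>) = UNIV"
  by (simp add: normal_law_def)

text \<open>Treats the point mass and the densities alike, so that the characteristic function needs
  no case distinction at \<open>\<tau> = 0\<close>.\<close>

lemma normal_law_eq_scaled:
  assumes "\<tau> \<ge> 0"
  shows "normal_law \<tau> = distr (normal_law 1) borel (\<lambda>x. \<tau> * x)"
proof (cases "\<tau> = 0")
  case True
  interpret prob_space "normal_law 1" by (simp add: prob_space_normal_law)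
  have "distr (normal_law 1) borel (\<lambda>x. \<tau> * x) = distr (normal_law 1) borel (\<lambda>x. 0)"
    using True by simp
  also have "\<dots> = return borel 0"
  proof (rule measure_eqI)
    fix A :: "real set" assume "A \<in> sets (distr (normal_law 1) borel (\<lambda>x. 0))"
    then show "emeasure (distr (normal_law 1) borel (\<lambda>x. 0)) A = emeasure (return borel 0) A"
      using emeasure_space_1 by (cases "0 \<in> A") (auto simp: emeasure_distr)
  qed simp
  finally show ?thesis using True by (simp add: normal_law_def)
next
  case False
  then have t: "\<tau> > 0" using assms by simp
  interpret prob_space "normal_law 1" by (simp add: prob_space_normal_law)
  have "distributed (normal_law 1) lborel (\<lambda>x. x) (normal_density 0 1)"
    by (auto simp: distributed_def normal_law_def distr_id2)
  from normal_density_affine[OF this, of \<tau> 0] t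
  have "distributed (normal_law 1) lborel (\<lambda>x. \<tau> * x) (normal_density 0 \<tau>)" by simp
  then have "distr (normal_law 1) lborel (\<lambda>x. \<tau> * x) = density lborel (normal_density 0 \<tau>)"
    by (simp add: distributed_def)
  moreover have "distr (normal_law 1) lborel (\<lambda>x. \<tau> * x) = distr (normal_law 1) borel (\<lambda>x. \<tau> * x)"
    by (rule distr_cong) auto
  ultimately show ?thesis using False by (simp add: normal_law_def)
qed

lemma cf_std_normal: "(CLINT x|normal_law 1. iexp (t * x)) = exp (- t\<^sup>2 / 2)"
  using char_std_normal_distribution
  by (simp add: char_def normal_law_def fun_eq_iff)

lemma char_normal_law:
  assumes "\<tau> \<ge> 0"
  shows "char (normal_law \<tau>) t = exp (- (\<tau> * t)\<^sup>2 / 2)"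
proof -
  have "char (normal_law \<tau>) t = (CLINT x|normal_law 1. iexp ((\<tau> * t) * x))"
    unfolding char_def normal_law_eq_scaled[OF assms]
    by (subst integral_distr) (auto simp: mult_ac)
  then show ?thesis by (simp only: cf_std_normal)
qed

lemma real_distribution_distr:
  assumes "prob_space M" "f \<in> borel_measurable M"
  shows "real_distribution (distr M borel f)"
  unfolding real_distribution_def real_distribution_axioms_def
  using prob_space.prob_space_distr[OF assms] by simp

lemma measurable_inner_prod [measurable (raw)]:
  assumes "\<And>i. i < d \<Longrightarrow> (\<lambda>x. f x i) \<in> borel_measurable M" "\<And>i. i < d \<Longrightarrow> (\<lambda>x. g x i) \<in> borel_measurable M"
  shows "(\<lambda>x. inner_prod d (f x) (g x)) \<in> borel_measurable M"
  unfolding inner_prod_def using assms by measurable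

lemma PiM_prob_eqI:
  assumes I: "finite I" and P: "prob_space P" "sets P = sets (PiM I M)" and Q: "prob_space Q" "sets Q = sets (PiM I M)"
    and eq: "\<And>A. (\<And>i. i \<in> I \<Longrightarrow> A i \<in> sets (M i)) \<Longrightarrow> measure P (Pi\<^sub>E I A) = measure Q (Pi\<^sub>E I A)"
  shows "P = Q"
proof (rule measure_eqI_PiM_finite[OF I P(2) Q(2), where A="\<lambda>_. space (PiM I M)"])
  interpret P: prob_space P by fact
  interpret Q: prob_space Q by fact
  show "emeasure P (Pi\<^sub>E I A) = emeasure Q (Pi\<^sub>E I A)" if "\<And>i. i \<in> I \<Longrightarrow> A i \<in> sets (M i)" for A
    using eq[OF that] by (simp add: P.emeasure_eq_measure Q.emeasure_eq_measure)
  show "range (\<lambda>_. space (Pi\<^sub>M I M)) \<subseteq> prod_algebra I M"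
    using prod_algebraI_finite[OF I, of "\<lambda>i. space (M i)" M] by (auto simp: space_PiM)
  show "emeasure P (space (PiM I M)) \<noteq> \<infinity>"
    using prob_space.finite_measure[OF P(1)] by (simp add: finite_measure.emeasure_finite)
qed (rule UN_constant[THEN trans], simp)

lemma measurable_inner_prod_PiM [measurable]: "inner_prod d u \<in> borel_measurable (PiM {..<d} (\<lambda>_. borel))"
  unfolding inner_prod_def[abs_def] by measurable

text \<open>Cramer-Wold. The characteristic function at \<open>u\<close> is that of the projection
  onto \<open>u\<close>, taken at 1. Hence Levy's theorem yields the prescribed projections of
  \<open>\<mu>\<close>, and conversely the projections determine the joint characteristic function
  and so, by \<open>joint_cf_unique\<close>, the law. The definite description is left with
  \<open>\<mu>\<close> as its only candidate.\<close>

lemma mv_normal_eqI: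
  assumes \<mu>: "prob_space \<mu>" "sets \<mu> = sets (Pi\<^sub>M {..<d} (\<lambda>_. borel :: real measure))"
    and cf: "\<And>u. (CLINT x|\<mu>. iexp (inner_prod d u x)) = exp (- quad_form d \<Sigma> u / 2)"
    and q: "\<And>u. 0 \<le> quad_form d \<Sigma> u"
  shows "mv_normal d \<Sigma> = \<mu>"
  unfolding mv_normal_def
proof (rule the_equality)
  have m: "inner_prod d u \<in> borel_measurable \<mu>'" if "sets \<mu>' = sets (Pi\<^sub>M {..<d} (\<lambda>_. borel :: real measure))" for u \<mu>'
    using measurable_inner_prod_PiM measurable_cong_sets[OF that refl] by blast
  show "sets \<mu> = sets (Pi\<^sub>M {..<d} (\<lambda>_. borel)) \<and>
    (\<forall>u. distr \<mu> borel (inner_prod d u) = normal_law (sqrt (quad_form d \<Sigma> u)))"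
  proof (intro conjI allI \<mu>(2))
    fix u
    show "distr \<mu> borel (inner_prod d u) = normal_law (sqrt (quad_form d \<Sigma> u))"
    proof (rule Levy_uniqueness)
      show "real_distribution (distr \<mu> borel (inner_prod d u))"
        by (rule real_distribution_distr[OF \<mu>(1) m[OF \<mu>(2)]])
      show "real_distribution (normal_law (sqrt (quad_form d \<Sigma> u)))"
        unfolding real_distribution_def real_distribution_axioms_def
        using q by (auto intro!: prob_space_normal_law)
      have s: "t * inner_prod d u x = inner_prod d (\<lambda>i. t * u i) x" for t x
        by (simp add: inner_prod_def sum_distrib_left mult_ac)
      have qs: "quad_form d \<Sigma> (\<lambda>i. t * u i) = t\<^sup>2 * quad_form d \<Sigma> u" for t
        by (simp add: quad_form_def sum_distrib_left power2_eq_square mult_ac)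
      have "char (distr \<mu> borel (inner_prod d u)) t = (CLINT x|\<mu>. iexp (t * inner_prod d u x))" for t
        unfolding char_def using m[OF \<mu>(2), of u] by (subst integral_distr) auto
      then show "char (distr \<mu> borel (inner_prod d u)) = char (normal_law (sqrt (quad_form d \<Sigma> u)))"
        using q[of u] by (simp only: fun_eq_iff s cf qs)
          (simp add: char_normal_law power_mult_distrib mult.commute)
    qed
  qed
  fix \<nu> assume "sets \<nu> = sets (Pi\<^sub>M {..<d} (\<lambda>_. borel :: real measure)) \<and>
    (\<forall>u. distr \<nu> borel (inner_prod d u) = normal_law (sqrt (quad_form d \<Sigma> u)))"
  then have \<nu>: "sets \<nu> = sets (Pi\<^sub>M {..<d} (\<lambda>_. borel :: real measure))"
    and \<nu>d: "\<And>u. distr \<nu> borel (inner_prod d u) = normal_law (sqrt (quad_form d \<Sigma> u))" by auto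
  \<comment> \<open>The description does not mention total mass 1; it follows because a projection
    is a probability law.\<close>
  have pn: "prob_space \<nu>"
    by (rule prob_space_distrD[OF m[OF \<nu>, of "\<lambda>_. 0"]]) (simp add: \<nu>d prob_space_normal_law q)
  show "\<nu> = \<mu>"
  proof (rule PiM_prob_eqI[OF _ pn \<nu> \<mu>])
    fix A assume A: "\<And>i. i \<in> {..<d} \<Longrightarrow> A i \<in> sets (borel :: real measure)"
    have sp: "space \<nu> = space (Pi\<^sub>M {..<d} (\<lambda>_. borel :: real measure))"
      "space \<mu> = space (Pi\<^sub>M {..<d} (\<lambda>_. borel :: real measure))"
      using \<nu> \<mu>(2) by (auto dest: sets_eq_imp_space_eq)
    have e: "Pi\<^sub>E {..<d} A = {x\<in>space \<nu>. \<forall>i\<in>{..<d}. x i \<in> A i}" "Pi\<^sub>E {..<d} A = {x\<in>space \<mu>. \<forall>i\<in>{..<d}. x i \<in> A i}"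
      by (intro set_eqI; simp add: sp space_PiM PiE_iff; blast)+
    have c: "(\<lambda>x. x i) \<in> borel_measurable \<nu>" "(\<lambda>x. x i) \<in> borel_measurable \<mu>" if "i \<in> {..<d}" for i
      unfolding measurable_cong_sets[OF \<nu> refl] measurable_cong_sets[OF \<mu>(2) refl]
      using that by (auto intro: measurable_component_singleton)
    have "measure \<nu> {x\<in>space \<nu>. \<forall>i\<in>{..<d}. x i \<in> A i} = measure \<mu> {x\<in>space \<mu>. \<forall>i\<in>{..<d}. x i \<in> A i}"
    proof (rule joint_cf_unique[OF pn \<mu>(1)])
      fix u :: "nat \<Rightarrow> real"
      have "(CLINT x|\<nu>. iexp (inner_prod d u x)) = char (distr \<nu> borel (inner_prod d u)) 1"
        unfolding char_def using m[OF \<nu>, of u] by (subst integral_distr) auto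
      also have "\<dots> = (CLINT x|\<mu>. iexp (inner_prod d u x))"
        using q[of u] unfolding \<nu>d cf by (simp add: char_normal_law)
      finally show "(CLINT x|\<nu>. iexp (\<Sum>i<d. u i * x i)) = (CLINT x|\<mu>. iexp (\<Sum>i<d. u i * x i))"
        by (simp only: inner_prod_def)
    qed (use c A in auto)
    then show "measure \<nu> (Pi\<^sub>E {..<d} A) = measure \<mu> (Pi\<^sub>E {..<d} A)"
      using e by simp
  qed simp
qed

lemma quad_form_spiked_cov:
  "quad_form d (spiked_cov \<theta> u) v = (\<Sum>i<d. (v i)\<^sup>2) - \<theta> * (inner_prod d u v)\<^sup>2"
proof -
  have "quad_form d (spiked_cov \<theta> u) v = (\<Sum>i<d. \<Sum>j<d. (if i = j then v i * v j else 0) - \<theta> * ((u i * v i) * (u j * v j)))"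
    unfolding quad_form_def spiked_cov_def
    by (intro sum.cong refl) (auto simp: algebra_simps)
  also have "\<dots> = (\<Sum>i<d. \<Sum>j<d. (if i = j then v i * v j else 0)) - \<theta> * ((\<Sum>i<d. u i * v i) * (\<Sum>j<d. u j * v j))"
    unfolding sum_product by (simp add: sum_subtractf sum_distrib_left)
  also have "(\<Sum>i<d. \<Sum>j<d. (if i = j then v i * v j else 0)) = (\<Sum>i<d. (v i)\<^sup>2)"
    by (intro sum.cong refl) (simp add: power2_eq_square)
  finally show ?thesis by (simp add: inner_prod_def power2_eq_square)
qed

lemma quad_form_spiked_cov_nonneg:
  assumes "0 \<le> \<theta>" "\<theta> * (\<Sum>i<d. (u i)\<^sup>2) \<le> 1"
  shows "0 \<le> quad_form d (spiked_cov \<theta> u) v"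
proof -
  have "(inner_prod d u v)\<^sup>2 \<le> (\<Sum>i<d. (u i)\<^sup>2) * (\<Sum>i<d. (v i)\<^sup>2)"
    unfolding inner_prod_def by (rule Cauchy_Schwarz_ineq_sum)
  then have "\<theta> * (inner_prod d u v)\<^sup>2 \<le> \<theta> * ((\<Sum>i<d. (u i)\<^sup>2) * (\<Sum>i<d. (v i)\<^sup>2))"
    using assms by (intro mult_left_mono) auto
  also have "\<dots> \<le> 1 * (\<Sum>i<d. (v i)\<^sup>2)"
    unfolding mult.assoc[symmetric] using assms by (intro mult_right_mono sum_nonneg) auto
  finally show ?thesis by (simp add: quad_form_spiked_cov)
qed

lemma psd_spiked_cov:
  assumes "0 \<le> \<theta>" "\<theta> * (\<Sum>i<d. (u i)\<^sup>2) \<le> 1"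
  shows "psd d (spiked_cov \<theta> u)"
  using quad_form_spiked_cov_nonneg[OF assms] by (auto simp: psd_def spiked_cov_def)

lemma cf_iid_normal:
  "(CLINT x|PiM {..<d} (\<lambda>_. normal_law 1). iexp (inner_prod d u x)) = exp (- (\<Sum>i<d. (u i)\<^sup>2) / 2)"
proof -
  interpret N: prob_space "normal_law 1" by (simp add: prob_space_normal_law)
  interpret P: product_prob_space "\<lambda>_. normal_law 1" "{..<d}" by (rule product_prob_spaceI) unfold_locales
  have "(CLINT x|PiM {..<d} (\<lambda>_. normal_law 1). iexp (inner_prod d u x))
     = (CLINT x|PiM {..<d} (\<lambda>_. normal_law 1). \<Prod>i<d. iexp (u i * x i))"
    by (simp add: inner_prod_def sum_distrib_left exp_sum)
  also have "\<dots> = (\<Prod>i<d. CLINT x|normal_law 1. iexp (u i * x))"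
    by (rule P.product_integral_prod) (auto intro!: N.integrable_const_bound[where B=1])
  also have "\<dots> = (\<Prod>i<d. exp (complex_of_real (- (u i)\<^sup>2 / 2)))"
    by (simp only: cf_std_normal exp_of_real)
  also have "\<dots> = exp (- (\<Sum>i<d. (u i)\<^sup>2) / 2)"
    by (simp add: exp_sum[symmetric] exp_of_real[symmetric] sum_negf sum_divide_distrib)
  finally show ?thesis .
qed

lemma prob_space_PiM_normal: "prob_space (PiM I (\<lambda>_. normal_law 1))"
  by (rule prob_space_PiM) (simp add: prob_space_normal_law)

text \<open>The symmetric square root of \<open>Id - \<theta> u u\<^sup>T\<close> is \<open>Id - c u u\<^sup>T\<close> with \<open>2 c - c\<^sup>2 \<parallel>u\<parallel>\<^sup>2 = \<theta>\<close>.\<close>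

lemma ex_square_root_coeff:
  fixes \<theta> U :: real
  assumes "\<theta> * U \<le> 1"
  obtains c where "2 * c - c\<^sup>2 * U = \<theta>"
proof (cases "U = 0")
  case True
  then show ?thesis using that[of "\<theta>/2"] by simp
next
  case False
  have "(sqrt (1 - \<theta> * U))\<^sup>2 = 1 - \<theta> * U" using assms by simp
  then have "2 * ((1 - sqrt (1 - \<theta> * U)) / U) - ((1 - sqrt (1 - \<theta> * U)) / U)\<^sup>2 * U = \<theta>"
    using False by (simp add: field_simps power2_eq_square)
  then show ?thesis by (rule that)
qed

text \<open>Existence of the law: it is the image of a standard normal vector under the square root
  \<open>T\<close>, and \<open>\<theta> * (\<Sum>i<d. (u i)\<^sup>2) \<le> 1\<close> is what makes a
  real coefficient \<open>c\<close> available. The instance \<open>\<theta> = 0\<close> serves the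
  null hypothesis.\<close>

lemma mv_normal_spiked:
  assumes "0 \<le> \<theta>" "\<theta> * (\<Sum>i<d. (u i)\<^sup>2) \<le> 1"
  shows prob_space_mv_normal_spiked: "prob_space (mv_normal d (spiked_cov \<theta> u))"
    and sets_mv_normal_spiked: "sets (mv_normal d (spiked_cov \<theta> u)) = sets (PiM {..<d} (\<lambda>_. borel))"
    and cf_mv_normal_spiked: "(CLINT x|mv_normal d (spiked_cov \<theta> u). iexp (inner_prod d v x))
       = exp (- quad_form d (spiked_cov \<theta> u) v / 2)"
proof -
  define U where "U = (\<Sum>i<d. (u i)\<^sup>2)"
  obtain c where c: "2 * c - c\<^sup>2 * U = \<theta>" using ex_square_root_coeff assms(2) U_def by metis
  define T where "T g = (\<lambda>i\<in>{..<d}. g i - c * inner_prod d u g * u i)" for g :: "nat \<Rightarrow> real"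
  let ?N = "PiM {..<d} (\<lambda>_. normal_law 1)"
  let ?B = "PiM {..<d} (\<lambda>_. borel :: real measure)"
  have T[measurable]: "T \<in> ?N \<rightarrow>\<^sub>M ?B"
    unfolding T_def by measurable
  have p: "prob_space (distr ?N ?B T)"
    by (intro prob_space.prob_space_distr prob_space_PiM_normal T)
  have cf: "(CLINT x|distr ?N ?B T. iexp (inner_prod d v x)) = exp (- quad_form d (spiked_cov \<theta> u) v / 2)" for v
  proof -
    have "inner_prod d v (T g) = inner_prod d (\<lambda>i. v i - c * inner_prod d u v * u i) g" for g
    proof -
      have "inner_prod d v (T g) = (\<Sum>i<d. v i * g i - c * inner_prod d u g * (u i * v i))"
        by (simp add: inner_prod_def[of d v] T_def algebra_simps)
      also have "\<dots> = inner_prod d v g - c * inner_prod d u g * inner_prod d u v"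
        by (simp only: sum_subtractf sum_distrib_left[symmetric] inner_prod_def)
      also have "\<dots> = (\<Sum>i<d. v i * g i - c * inner_prod d u v * (u i * g i))"
        by (simp only: sum_subtractf sum_distrib_left[symmetric] inner_prod_def) simp
      also have "\<dots> = inner_prod d (\<lambda>i. v i - c * inner_prod d u v * u i) g"
        by (simp add: inner_prod_def[of d _ g] algebra_simps)
      finally show ?thesis .
    qed
    then have "(CLINT x|distr ?N ?B T. iexp (inner_prod d v x))
        = (CLINT g|?N. iexp (inner_prod d (\<lambda>i. v i - c * inner_prod d u v * u i) g))"
      by (subst integral_distr[OF T]) (auto intro!: measurable_compose[OF measurable_inner_prod_PiM])
    also have "\<dots> = exp (- (\<Sum>i<d. (v i - c * inner_prod d u v * u i)\<^sup>2) / 2)"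
      by (rule cf_iid_normal)
    also have "(\<Sum>i<d. (v i - c * inner_prod d u v * u i)\<^sup>2)
        = (\<Sum>i<d. (v i)\<^sup>2 - 2 * c * inner_prod d u v * (u i * v i) + (c * inner_prod d u v)\<^sup>2 * (u i)\<^sup>2)"
      by (intro sum.cong refl) (simp add: power2_eq_square algebra_simps)
    also have "\<dots> = (\<Sum>i<d. (v i)\<^sup>2) - 2 * c * inner_prod d u v * inner_prod d u v + (c * inner_prod d u v)\<^sup>2 * U"
      by (simp only: sum.distrib sum_subtractf sum_distrib_left[symmetric] U_def inner_prod_def)
    also have "\<dots> = (\<Sum>i<d. (v i)\<^sup>2) - (2 * c - c\<^sup>2 * U) * (inner_prod d u v)\<^sup>2"
      by (simp add: power2_eq_square algebra_simps)
    finally show ?thesis by (simp add: c quad_form_spiked_cov)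
  qed
  have "mv_normal d (spiked_cov \<theta> u) = distr ?N ?B T"
    by (rule mv_normal_eqI[OF p _ cf quad_form_spiked_cov_nonneg[OF assms]]) simp
  then show "prob_space (mv_normal d (spiked_cov \<theta> u))"
    "sets (mv_normal d (spiked_cov \<theta> u)) = sets (PiM {..<d} (\<lambda>_. borel))"
    "(CLINT x|mv_normal d (spiked_cov \<theta> u). iexp (inner_prod d v x))
       = exp (- quad_form d (spiked_cov \<theta> u) v / 2)"
    using p cf by simp_all
qed

text \<open>Regression read backwards: coordinate 0 is generated from the other coordinates and an
  independent residual, instead of being conditioned on them.\<close>

definition prepend_response :: "nat \<Rightarrow> (nat \<Rightarrow> real) \<Rightarrow> real \<Rightarrow> (nat \<Rightarrow> real) \<times> real \<Rightarrow> nat \<Rightarrow> real" where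
  "prepend_response d b s = (\<lambda>(a, \<xi>). \<lambda>j\<in>{..<d + 1}. if j = 0 then inner_prod d a b + s * \<xi> else a (j - 1))"

text \<open>The vector \<open>u\<close> is an eigenvector of the design covariance, with eigenvalue
  \<open>1 - \<theta> * U\<close>, and the covariance of the design with coordinate 0 is
  \<open>- \<theta> * x 0\<close> times \<open>u\<close>. Hence the normal equations reduce to the
  scalar equation for \<open>\<beta>\<close>, and the equation for \<open>s\<close> states that
  \<open>s\<^sup>2\<close> is what remains of the variance of coordinate 0.\<close>

lemma mv_normal_regression:
  fixes d :: nat and x :: "nat \<Rightarrow> real" and \<beta> \<theta> s :: real
  defines "u \<equiv> \<lambda>i. x (Suc i)"
  defines "U \<equiv> \<Sum>i<d. (u i)\<^sup>2"
  assumes \<theta>: "0 \<le> \<theta>" "\<theta> * (\<Sum>i<d+1. (x i)\<^sup>2) \<le> 1"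
    and \<beta>: "\<beta> * (1 - \<theta> * U) = - \<theta> * x 0"
    and s: "s\<^sup>2 = 1 - \<theta> * (x 0)\<^sup>2 - \<beta>\<^sup>2 * U * (1 - \<theta> * U)"
  shows "mv_normal (d + 1) (spiked_cov \<theta> x) =
    distr (mv_normal d (spiked_cov \<theta> u) \<Otimes>\<^sub>M normal_law 1) (PiM {..<d + 1} (\<lambda>_. borel))
      (prepend_response d (\<lambda>i. \<beta> * u i) s)"
proof -
  have "\<theta> * U \<le> \<theta> * (\<Sum>i<d+1. (x i)\<^sup>2)"
    using \<theta>(1) unfolding U_def u_def by (intro mult_left_mono) (simp_all add: sum.lessThan_Suc_shift del: sum.lessThan_Suc)
  then have \<theta>U: "\<theta> * (\<Sum>i<d. (u i)\<^sup>2) \<le> 1" using \<theta> U_def by simp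
  note \<nu> = mv_normal_spiked[OF \<theta>(1) \<theta>U]
  let ?\<nu> = "mv_normal d (spiked_cov \<theta> u)" and ?B = "PiM {..<d + 1} (\<lambda>_. borel :: real measure)"
  note [measurable_cong] = \<nu>(2)
  interpret \<nu>: prob_space ?\<nu> by (rule \<nu>(1))
  interpret N: prob_space "normal_law 1" by (simp add: prob_space_normal_law)
  interpret P: pair_prob_space ?\<nu> "normal_law 1" ..
  define F where "F = prepend_response d (\<lambda>i. \<beta> * u i) s"
  have [measurable]: "(\<lambda>x. fst x i) \<in> borel_measurable (?\<nu> \<Otimes>\<^sub>M normal_law 1)" if "i < d" for i
    using that by (intro measurable_compose[OF measurable_fst]) measurable
  have F[measurable]: "F \<in> ?\<nu> \<Otimes>\<^sub>M normal_law 1 \<rightarrow>\<^sub>M ?B"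
    unfolding F_def prepend_response_def split_beta
  proof (rule measurable_restrict)
    fix j assume "j \<in> {..<d + 1}"
    then show "(\<lambda>x. if j = 0 then inner_prod d (fst x) (\<lambda>i. \<beta> * u i) + s * snd x else fst x (j - 1))
        \<in> borel_measurable (?\<nu> \<Otimes>\<^sub>M normal_law 1)"
      by (cases "j = 0") auto
  qed
  have p: "prob_space (distr (?\<nu> \<Otimes>\<^sub>M normal_law 1) ?B F)"
    by (intro P.prob_space_distr F)
  have cf: "(CLINT z|distr (?\<nu> \<Otimes>\<^sub>M normal_law 1) ?B F. iexp (inner_prod (d + 1) v z))
     = exp (- quad_form (d + 1) (spiked_cov \<theta> x) v / 2)" for v
  proof -
    define v' where "v' i = v (Suc i)" for i
    let ?w = "\<lambda>i. v' i + v 0 * (\<beta> * u i)"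
    have i1: "inner_prod (d + 1) v (F (a, \<xi>)) = inner_prod d ?w a + (v 0 * s) * \<xi>" for a \<xi>
      by (simp add: inner_prod_def F_def prepend_response_def v'_def sum.lessThan_Suc_shift algebra_simps
           sum.distrib sum_distrib_left sum_distrib_right del: sum.lessThan_Suc)
    have "(CLINT z|distr (?\<nu> \<Otimes>\<^sub>M normal_law 1) ?B F. iexp (inner_prod (d + 1) v z))
       = (CLINT y|?\<nu> \<Otimes>\<^sub>M normal_law 1. iexp (inner_prod (d + 1) v (F y)))"
      by (subst integral_distr[OF F]) (auto intro!: measurable_compose[OF measurable_inner_prod_PiM])
    also have "\<dots> = (CLINT y|?\<nu> \<Otimes>\<^sub>M normal_law 1. iexp (inner_prod d ?w (fst y)) * iexp ((v 0 * s) * snd y))"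
      by (intro Bochner_Integration.integral_cong refl)
        (clarsimp simp only: i1 exp_add[symmetric] distrib_left of_real_add fst_conv snd_conv)
    also have "\<dots> = (CLINT a|?\<nu>. CLINT \<xi>|normal_law 1. iexp (inner_prod d ?w a) * iexp ((v 0 * s) * \<xi>))"
      by (subst P.integral_fst'[symmetric])
        (auto intro!: P.integrable_const_bound[where B=1] simp: norm_mult)
    also have "\<dots> = (CLINT a|?\<nu>. iexp (inner_prod d ?w a)) * (CLINT \<xi>|normal_law 1. iexp ((v 0 * s) * \<xi>))"
      by (simp only: integral_mult_right_zero integral_mult_left_zero)
    also have "\<dots> = exp (- (quad_form d (spiked_cov \<theta> u) ?w + (v 0 * s)\<^sup>2) / 2)"
      unfolding \<nu>(3) cf_std_normal by (simp add: exp_add[symmetric] add_divide_distrib diff_divide_distrib exp_of_real[symmetric])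
    also have "quad_form d (spiked_cov \<theta> u) ?w + (v 0 * s)\<^sup>2 = quad_form (d + 1) (spiked_cov \<theta> x) v"
    proof -
      define Q where "Q = (\<Sum>i<d. (v' i)\<^sup>2)"
      define R where "R = inner_prod d u v'"
      have a: "inner_prod d u ?w = R + v 0 * \<beta> * U"
        by (simp add: R_def U_def inner_prod_def sum.distrib sum_distrib_left power2_eq_square algebra_simps)
      have b: "(\<Sum>i<d. (?w i)\<^sup>2) = Q + 2 * v 0 * \<beta> * R + (v 0 * \<beta>)\<^sup>2 * U"
        by (simp add: R_def U_def Q_def inner_prod_def sum.distrib sum_distrib_left power2_eq_square algebra_simps)
      have c: "quad_form (d + 1) (spiked_cov \<theta> x) v = (v 0)\<^sup>2 + Q - \<theta> * (x 0 * v 0 + R)\<^sup>2"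
        unfolding quad_form_spiked_cov
        by (simp add: Q_def R_def inner_prod_def v'_def u_def sum.lessThan_Suc_shift del: sum.lessThan_Suc)
      \<comment> \<open>The cross term in \<open>v 0 * R\<close> is settled by the equation for
        \<open>\<beta>\<close>, the term in \<open>(v 0)\<^sup>2\<close> by the one for
        \<open>s\<close>.\<close>
      have "Q + 2 * v 0 * \<beta> * R + (v 0 * \<beta>)\<^sup>2 * U - \<theta> * (R + v 0 * \<beta> * U)\<^sup>2
         = Q + 2 * v 0 * R * (\<beta> * (1 - \<theta> * U)) + (v 0)\<^sup>2 * (\<beta>\<^sup>2 * U * (1 - \<theta> * U)) - \<theta> * R\<^sup>2"
        by (simp add: power2_eq_square algebra_simps)
      also have "\<dots> + (v 0 * s)\<^sup>2 = (v 0)\<^sup>2 + Q - \<theta> * (x 0 * v 0 + R)\<^sup>2"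
        unfolding \<beta> power_mult_distrib s by (simp add: power2_eq_square algebra_simps)
      finally show ?thesis unfolding quad_form_spiked_cov a b c[unfolded quad_form_spiked_cov] .
    qed
    finally show ?thesis .
  qed
  show ?thesis
    unfolding F_def[symmetric]
    by (rule mv_normal_eqI[OF p _ cf quad_form_spiked_cov_nonneg[OF \<theta>]]) simp
qed

section \<open>Product laws\<close>

abbreviation std_normal :: "real measure" where "std_normal \<equiv> normal_law 1"

lemma emeasure_distr_nn_integral:
  assumes "\<phi> \<in> M \<rightarrow>\<^sub>M N" "A \<in> sets N"
  shows "emeasure (distr M N \<phi>) A = (\<integral>\<^sup>+x. indicator A (\<phi> x) \<partial>M)"
  using nn_integral_distr[OF assms(1), of "indicator A"] assms(2) by simp

text \<open>A tuple of independent pairs is a pair of independent tuples; on boxes the indicator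
  factors over the indices. This moves noise between tape and samples, and in
  \<open>null_bound\<close> it allows integrating over all hidden coordinates together.\<close>

lemma nn_integral_PiM_pair:
  fixes M :: "'a measure" and N :: "'b measure" and I :: "'i set"
  assumes "prob_space M" "prob_space N" "finite I"
    and f[measurable]: "f \<in> borel_measurable (PiM I (\<lambda>_. M \<Otimes>\<^sub>M N))"
  shows "(\<integral>\<^sup>+S. f S \<partial>PiM I (\<lambda>_. M \<Otimes>\<^sub>M N)) =
    (\<integral>\<^sup>+x. \<integral>\<^sup>+y. f (\<lambda>i\<in>I. (x i, y i)) \<partial>PiM I (\<lambda>_. N) \<partial>PiM I (\<lambda>_. M))"
proof -
  interpret M: prob_space M by fact
  interpret N: prob_space N by fact
  interpret P: pair_prob_space M N ..
  interpret PM: product_prob_space "\<lambda>_. M" I by (rule product_prob_spaceI) unfold_locales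
  interpret PN: product_prob_space "\<lambda>_. N" I by (rule product_prob_spaceI) unfold_locales
  interpret PP: product_prob_space "\<lambda>_. M \<Otimes>\<^sub>M N" I by (rule product_prob_spaceI) unfold_locales
  let ?z = "\<lambda>(x, y). \<lambda>i\<in>I. (x i, y i)"
  have z[measurable]: "?z \<in> PiM I (\<lambda>_. M) \<Otimes>\<^sub>M PiM I (\<lambda>_. N) \<rightarrow>\<^sub>M PiM I (\<lambda>_. M \<Otimes>\<^sub>M N)"
    unfolding split_beta
  proof (rule measurable_restrict)
    fix i assume "i \<in> I"
    then have "(\<lambda>x. fst x i) \<in> PiM I (\<lambda>_. M) \<Otimes>\<^sub>M PiM I (\<lambda>_. N) \<rightarrow>\<^sub>M M"
      "(\<lambda>x. snd x i) \<in> PiM I (\<lambda>_. M) \<Otimes>\<^sub>M PiM I (\<lambda>_. N) \<rightarrow>\<^sub>M N"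
      by (auto intro: measurable_compose[OF measurable_fst] measurable_compose[OF measurable_snd] measurable_component_singleton)
    then show "(\<lambda>x. (fst x i, snd x i)) \<in> PiM I (\<lambda>_. M) \<Otimes>\<^sub>M PiM I (\<lambda>_. N) \<rightarrow>\<^sub>M M \<Otimes>\<^sub>M N" by simp
  qed
  have "distr (PiM I (\<lambda>_. M) \<Otimes>\<^sub>M PiM I (\<lambda>_. N)) (PiM I (\<lambda>_. M \<Otimes>\<^sub>M N)) ?z = PiM I (\<lambda>_. M \<Otimes>\<^sub>M N)"
  proof (rule PP.PiM_eqI[OF \<open>finite I\<close>])
    fix A assume A: "\<And>i. i \<in> I \<Longrightarrow> A i \<in> sets (M \<Otimes>\<^sub>M N)"
    have [measurable]: "Pi\<^sub>E I A \<in> sets (PiM I (\<lambda>_. M \<Otimes>\<^sub>M N))"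
      using A by (intro sets_PiM_I_finite \<open>finite I\<close>) auto
    have ind: "indicator (Pi\<^sub>E I A) (\<lambda>i\<in>I. (x i, y i)) = (\<Prod>i\<in>I. indicator (A i) (x i, y i) :: ennreal)" for x y
      using \<open>finite I\<close> by (auto simp: indicator_def PiE_iff prod_zero_iff)
    have "emeasure (distr (PiM I (\<lambda>_. M) \<Otimes>\<^sub>M PiM I (\<lambda>_. N)) (PiM I (\<lambda>_. M \<Otimes>\<^sub>M N)) ?z) (Pi\<^sub>E I A)
      = (\<integral>\<^sup>+w. indicator (Pi\<^sub>E I A) (?z w) \<partial>(PiM I (\<lambda>_. M) \<Otimes>\<^sub>M PiM I (\<lambda>_. N)))"
      by (rule emeasure_distr_nn_integral) simp_all
    also have "\<dots> = (\<integral>\<^sup>+x. \<integral>\<^sup>+y. indicator (Pi\<^sub>E I A) (?z (x, y)) \<partial>PiM I (\<lambda>_. N) \<partial>PiM I (\<lambda>_. M))"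
      by (subst PN.P.nn_integral_fst[symmetric]) auto
    also have "\<dots> = (\<integral>\<^sup>+x. \<integral>\<^sup>+y. (\<Prod>i\<in>I. indicator (A i) (x i, y i)) \<partial>PiM I (\<lambda>_. N) \<partial>PiM I (\<lambda>_. M))"
      by (simp add: ind)
    also have "\<dots> = (\<integral>\<^sup>+x. (\<Prod>i\<in>I. \<integral>\<^sup>+y. indicator (A i) (x i, y) \<partial>N) \<partial>PiM I (\<lambda>_. M))"
    proof (rule nn_integral_cong)
      fix x assume x: "x \<in> space (PiM I (\<lambda>_. M))"
      show "(\<integral>\<^sup>+y. (\<Prod>i\<in>I. indicator (A i) (x i, y i)) \<partial>PiM I (\<lambda>_. N)) = (\<Prod>i\<in>I. \<integral>\<^sup>+y. indicator (A i) (x i, y) \<partial>N)"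
        using x A by (intro PN.product_nn_integral_prod \<open>finite I\<close>)
          (auto simp: space_PiM PiE_iff intro!: borel_measurable_indicator' measurable_Pair1')
    qed
    also have "\<dots> = (\<Prod>i\<in>I. \<integral>\<^sup>+x. \<integral>\<^sup>+y. indicator (A i) (x, y) \<partial>N \<partial>M)"
      using A by (intro PM.product_nn_integral_prod \<open>finite I\<close>) auto
    also have "\<dots> = (\<Prod>i\<in>I. emeasure (M \<Otimes>\<^sub>M N) (A i))"
      using A by (intro prod.cong refl) (subst N.emeasure_pair_measure, auto)
    finally show "emeasure (distr (PiM I (\<lambda>_. M) \<Otimes>\<^sub>M PiM I (\<lambda>_. N)) (PiM I (\<lambda>_. M \<Otimes>\<^sub>M N)) ?z) (Pi\<^sub>E I A)
      = (\<Prod>i\<in>I. emeasure (M \<Otimes>\<^sub>M N) (A i))" .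
  qed simp
  then have "(\<integral>\<^sup>+S. f S \<partial>PiM I (\<lambda>_. M \<Otimes>\<^sub>M N))
     = (\<integral>\<^sup>+w. f (?z w) \<partial>(PiM I (\<lambda>_. M) \<Otimes>\<^sub>M PiM I (\<lambda>_. N)))"
    by (subst nn_integral_distr[OF z, symmetric]) simp_all
  also have "\<dots> = (\<integral>\<^sup>+x. \<integral>\<^sup>+y. f (?z (x, y)) \<partial>PiM I (\<lambda>_. N) \<partial>PiM I (\<lambda>_. M))"
    by (subst PN.P.nn_integral_fst[symmetric]) auto
  finally show ?thesis by simp
qed

lemma nn_integral_PiM_distr:
  fixes M :: "'a measure" and M' :: "'b measure" and I :: "'i set"
  assumes "prob_space M" "finite I" and \<phi>[measurable]: "\<phi> \<in> M \<rightarrow>\<^sub>M M'"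
    and D: "D = distr M M' \<phi>"
    and f: "f \<in> borel_measurable (PiM I (\<lambda>_. D))"
  shows "(\<integral>\<^sup>+S. f S \<partial>PiM I (\<lambda>_. D)) = (\<integral>\<^sup>+S. f (\<lambda>i\<in>I. \<phi> (S i)) \<partial>PiM I (\<lambda>_. M))"
proof -
  have p: "prob_space D" unfolding D by (rule prob_space.prob_space_distr) fact+
  have "\<phi> \<in> M \<rightarrow>\<^sub>M D" by (simp add: D)
  moreover have "distr M D \<phi> = D" unfolding D by (rule distr_cong) auto
  ultimately have "distr (PiM I (\<lambda>_. M)) (PiM I (\<lambda>_. D)) (compose I \<phi>) = PiM I (\<lambda>_. D)"
    using distr_PiM_finite_prob_space'[OF assms(2), of "\<lambda>_. M" "\<lambda>_. D" \<phi>] p assms(1) by simp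
  moreover have "compose I \<phi> \<in> PiM I (\<lambda>_. M) \<rightarrow>\<^sub>M PiM I (\<lambda>_. D)"
    unfolding compose_def using \<open>\<phi> \<in> M \<rightarrow>\<^sub>M D\<close>
    by (intro measurable_restrict) (auto intro: measurable_compose[OF measurable_component_singleton])
  ultimately have "(\<integral>\<^sup>+S. f S \<partial>PiM I (\<lambda>_. D)) = (\<integral>\<^sup>+S. f (compose I \<phi> S) \<partial>PiM I (\<lambda>_. M))"
    using nn_integral_distr[of "compose I \<phi>" "PiM I (\<lambda>_. M)" "PiM I (\<lambda>_. D)" f] f by simp
  then show ?thesis by (simp add: compose_def)
qed

lemma prob_space_random_tape: "prob_space random_tape"
  unfolding random_tape_def by (rule prob_space_PiM_normal)

lemma sets_random_tape [measurable_cong]: "sets random_tape = sets (PiM UNIV (\<lambda>_. borel))"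
  unfolding random_tape_def by (intro sets_PiM_cong) auto

lemma measurable_splice:
  assumes "\<And>i. i < n \<Longrightarrow> (\<lambda>x. w x i) \<in> borel_measurable M" "g \<in> M \<rightarrow>\<^sub>M random_tape"
  shows "(\<lambda>x. comb_seq n (w x) (g x)) \<in> M \<rightarrow>\<^sub>M random_tape"
proof -
  have g: "(\<lambda>x. g x i) \<in> borel_measurable M" for i
    using measurable_compose[OF assms(2), of "\<lambda>\<omega>. \<omega> i" borel]
    by (simp add: measurable_cong_sets[OF sets_random_tape refl] measurable_component_singleton)
  have "(\<lambda>x. comb_seq n (w x) (g x)) \<in> M \<rightarrow>\<^sub>M PiM UNIV (\<lambda>_. borel)"
  proof (rule measurable_PiM_single')
    show "(\<lambda>x. comb_seq n (w x) (g x) i) \<in> borel_measurable M" for i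
      by (cases "i < n") (simp_all add: comb_seq_def assms g)
  qed (simp add: PiE_iff)
  then show ?thesis by (simp add: measurable_cong_sets[OF refl sets_random_tape])
qed

text \<open>The distinguisher spends the first \<open>n\<close> tape entries on its own noise; what
  is left for the learner is again a tape of standard normals, independent of that noise.\<close>

lemma nn_integral_random_tape:
  assumes f[measurable]: "f \<in> borel_measurable random_tape"
  shows "(\<integral>\<^sup>+\<omega>. f \<omega> \<partial>random_tape) =
    (\<integral>\<^sup>+w. \<integral>\<^sup>+\<omega>. f (comb_seq n w \<omega>) \<partial>random_tape \<partial>PiM {..<n} (\<lambda>_. std_normal))"
proof -
  interpret N: prob_space std_normal by (simp add: prob_space_normal_law)
  interpret S: sequence_space std_normal by unfold_locales
  interpret T: prob_space random_tape by (rule prob_space_random_tape)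
  interpret TT: pair_prob_space random_tape random_tape ..
  have c[measurable]: "(\<lambda>(\<omega>, \<omega>'). comb_seq n \<omega> \<omega>') \<in> random_tape \<Otimes>\<^sub>M random_tape \<rightarrow>\<^sub>M random_tape"
    unfolding random_tape_def by (rule measurable_comb_seq)
  have R[measurable]: "(\<lambda>\<omega>. restrict \<omega> {..<n}) \<in> random_tape \<rightarrow>\<^sub>M PiM {..<n} (\<lambda>_. std_normal)"
    unfolding random_tape_def by (rule measurable_restrict_subset) simp
  have dR: "distr random_tape (PiM {..<n} (\<lambda>_. std_normal)) (\<lambda>\<omega>. restrict \<omega> {..<n}) = PiM {..<n} (\<lambda>_. std_normal)"
    unfolding random_tape_def by (rule S.distr_PiM_restrict_finite) auto
  have [measurable]: "(\<lambda>x. comb_seq n (fst x) (snd x)) \<in> PiM {..<n} (\<lambda>_. std_normal) \<Otimes>\<^sub>M random_tape \<rightarrow>\<^sub>M random_tape"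
  proof (rule measurable_splice)
    fix i assume "i < n"
    then have "(\<lambda>w. w i) \<in> borel_measurable (PiM {..<n} (\<lambda>_. std_normal))"
      using measurable_component_singleton[of i "{..<n}" "\<lambda>_. std_normal"] by (simp add: measurable_cong_sets[OF refl sets_normal_law])
    then show "(\<lambda>x. fst x i) \<in> borel_measurable (PiM {..<n} (\<lambda>_. std_normal) \<Otimes>\<^sub>M random_tape)"
      by (rule measurable_compose[OF measurable_fst])
  qed simp
  have "(\<integral>\<^sup>+\<omega>. f \<omega> \<partial>random_tape) = (\<integral>\<^sup>+\<omega>. f \<omega> \<partial>distr (random_tape \<Otimes>\<^sub>M random_tape) random_tape (\<lambda>(\<omega>, \<omega>'). comb_seq n \<omega> \<omega>'))"
    using S.PiM_comb_seq[of n] by (simp add: random_tape_def)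
  also have "\<dots> = (\<integral>\<^sup>+x. f (case_prod (comb_seq n) x) \<partial>(random_tape \<Otimes>\<^sub>M random_tape))"
    by (rule nn_integral_distr) measurable
  also have "\<dots> = (\<integral>\<^sup>+w. \<integral>\<^sup>+\<omega>. f (comb_seq n w \<omega>) \<partial>random_tape \<partial>random_tape)"
    by (subst T.nn_integral_fst[symmetric]) auto
  also have "\<dots> = (\<integral>\<^sup>+w. (\<lambda>w. \<integral>\<^sup>+\<omega>. f (comb_seq n w \<omega>) \<partial>random_tape) (restrict w {..<n}) \<partial>random_tape)"
  proof -
    have "comb_seq n (restrict w {..<n}) \<omega> = comb_seq n w \<omega>" for w \<omega> :: "nat \<Rightarrow> real"
      by (auto simp: comb_seq_def fun_eq_iff)
    then show ?thesis by simp
  qed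
  also have "\<dots> = (\<integral>\<^sup>+w. \<integral>\<^sup>+\<omega>. f (comb_seq n w \<omega>) \<partial>random_tape \<partial>distr random_tape (PiM {..<n} (\<lambda>_. std_normal)) (\<lambda>\<omega>. restrict \<omega> {..<n}))"
    by (subst nn_integral_distr) (auto intro!: T.borel_measurable_nn_integral simp: split_beta')
  finally show ?thesis unfolding dR .
qed

lemma nn_integral_assoc:
  assumes "prob_space L" "prob_space M" "prob_space N"
    and f[measurable]: "f \<in> borel_measurable ((L \<Otimes>\<^sub>M M) \<Otimes>\<^sub>M N)"
  shows "(\<integral>\<^sup>+x. f x \<partial>((L \<Otimes>\<^sub>M M) \<Otimes>\<^sub>M N)) = (\<integral>\<^sup>+x. f ((fst x, fst (snd x)), snd (snd x)) \<partial>(L \<Otimes>\<^sub>M (M \<Otimes>\<^sub>M N)))"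
proof -
  interpret L: prob_space L by fact
  interpret M: prob_space M by fact
  interpret N: prob_space N by fact
  interpret MN: pair_prob_space M N ..
  interpret LM: pair_prob_space L M ..
  have "(\<integral>\<^sup>+x. f x \<partial>((L \<Otimes>\<^sub>M M) \<Otimes>\<^sub>M N)) = (\<integral>\<^sup>+a. \<integral>\<^sup>+b. \<integral>\<^sup>+c. f ((a, b), c) \<partial>N \<partial>M \<partial>L)"
    by (subst N.nn_integral_fst[symmetric], simp, subst M.nn_integral_fst[symmetric]) auto
  also have "\<dots> = (\<integral>\<^sup>+a. \<integral>\<^sup>+y. f ((a, fst y), snd y) \<partial>(M \<Otimes>\<^sub>M N) \<partial>L)"
    by (intro nn_integral_cong) (subst N.nn_integral_fst[symmetric], auto)
  also have "\<dots> = (\<integral>\<^sup>+x. f ((fst x, fst (snd x)), snd (snd x)) \<partial>(L \<Otimes>\<^sub>M (M \<Otimes>\<^sub>M N)))"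
    by (subst MN.nn_integral_fst[symmetric]) auto
  finally show ?thesis .
qed

lemma distr_assoc:
  assumes "prob_space L" "prob_space M" "prob_space N"
  shows "(L \<Otimes>\<^sub>M M) \<Otimes>\<^sub>M N = distr (L \<Otimes>\<^sub>M (M \<Otimes>\<^sub>M N)) ((L \<Otimes>\<^sub>M M) \<Otimes>\<^sub>M N) (\<lambda>x. ((fst x, fst (snd x)), snd (snd x)))"
proof (rule measure_eqI)
  fix A assume A[measurable]: "A \<in> sets ((L \<Otimes>\<^sub>M M) \<Otimes>\<^sub>M N)"
  have "emeasure ((L \<Otimes>\<^sub>M M) \<Otimes>\<^sub>M N) A = (\<integral>\<^sup>+x. indicator A ((fst x, fst (snd x)), snd (snd x)) \<partial>(L \<Otimes>\<^sub>M (M \<Otimes>\<^sub>M N)))"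
    by (subst nn_integral_assoc[OF assms, symmetric]) auto
  also have "\<dots> = emeasure (distr (L \<Otimes>\<^sub>M (M \<Otimes>\<^sub>M N)) ((L \<Otimes>\<^sub>M M) \<Otimes>\<^sub>M N) (\<lambda>x. ((fst x, fst (snd x)), snd (snd x)))) A"
    by (rule emeasure_distr_nn_integral[symmetric]) simp_all
  finally show "emeasure ((L \<Otimes>\<^sub>M M) \<Otimes>\<^sub>M N) A
     = emeasure (distr (L \<Otimes>\<^sub>M (M \<Otimes>\<^sub>M N)) ((L \<Otimes>\<^sub>M M) \<Otimes>\<^sub>M N) (\<lambda>x. ((fst x, fst (snd x)), snd (snd x)))) A" .
qed simp

lemma prob_space_normal_pair: "prob_space (std_normal \<Otimes>\<^sub>M std_normal)"
proof -
  interpret N: prob_space std_normal by (simp add: prob_space_normal_law)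
  interpret P: pair_prob_space std_normal std_normal ..
  show ?thesis by unfold_locales
qed

lemma cf_normal_pair:
  "(CLINT x|std_normal \<Otimes>\<^sub>M std_normal. iexp (\<alpha> * fst x + \<beta> * snd x)) = exp (- (\<alpha>\<^sup>2 + \<beta>\<^sup>2) / 2)"
proof -
  interpret N: prob_space std_normal by (simp add: prob_space_normal_law)
  interpret P: pair_prob_space std_normal std_normal ..
  have "(CLINT x|std_normal \<Otimes>\<^sub>M std_normal. iexp (\<alpha> * fst x + \<beta> * snd x))
      = (CLINT x|std_normal \<Otimes>\<^sub>M std_normal. iexp (\<alpha> * fst x) * iexp (\<beta> * snd x))"
    by (simp add: exp_add distrib_left)
  also have "\<dots> = (CLINT x|std_normal. CLINT y|std_normal. iexp (\<alpha> * x) * iexp (\<beta> * y))"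
    by (subst P.integral_fst'[symmetric])
        (auto intro!: P.integrable_const_bound[where B=1] simp: norm_mult)
  also have "\<dots> = (CLINT x|std_normal. iexp (\<alpha> * x)) * (CLINT y|std_normal. iexp (\<beta> * y))"
    by (simp only: integral_mult_right_zero integral_mult_left_zero)
  also have "\<dots> = exp (- (\<alpha>\<^sup>2 + \<beta>\<^sup>2) / 2)"
    unfolding cf_std_normal by (simp add: exp_add[symmetric] add_divide_distrib diff_divide_distrib exp_of_real[symmetric])
  finally show ?thesis .
qed

lemma distr_normal_comb:
  assumes "s\<^sup>2 + r\<^sup>2 = 1"
  shows "std_normal = distr (std_normal \<Otimes>\<^sub>M std_normal) borel (\<lambda>x. s * fst x + r * snd x)"
proof (rule Levy_uniqueness)
  show "real_distribution std_normal"
    unfolding real_distribution_def real_distribution_axioms_def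
    by (auto intro!: prob_space_normal_law)
  show "real_distribution (distr (std_normal \<Otimes>\<^sub>M std_normal) borel (\<lambda>x. s * fst x + r * snd x))"
    by (rule real_distribution_distr[OF prob_space_normal_pair]) simp
  have "char (distr (std_normal \<Otimes>\<^sub>M std_normal) borel (\<lambda>x. s * fst x + r * snd x)) t
     = (CLINT x|std_normal \<Otimes>\<^sub>M std_normal. iexp ((t * s) * fst x + (t * r) * snd x))" for t
    unfolding char_def by (subst integral_distr) (auto simp: algebra_simps)
  also have "\<dots> t = exp (- (t\<^sup>2 * (s\<^sup>2 + r\<^sup>2)) / 2)" for t
    unfolding cf_normal_pair by (simp add: power_mult_distrib distrib_left)
  finally show "char std_normal = char (distr (std_normal \<Otimes>\<^sub>M std_normal) borel (\<lambda>x. s * fst x + r * snd x))"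
    using assms by (simp add: fun_eq_iff char_normal_law)
qed

text \<open>A symmetric orthogonal matrix, hence its own inverse: the map that separates
  \<open>z + r w\<close> from \<open>r z - w\<close> also recovers \<open>(z, w)\<close> from the
  two.\<close>

definition reflect :: "real \<Rightarrow> real \<times> real \<Rightarrow> real \<times> real" where
  "reflect r x = ((fst x + r * snd x) / sqrt (1 + r\<^sup>2), (r * fst x - snd x) / sqrt (1 + r\<^sup>2))"

lemma measurable_reflect [measurable]:
  "reflect r \<in> std_normal \<Otimes>\<^sub>M std_normal \<rightarrow>\<^sub>M std_normal \<Otimes>\<^sub>M std_normal"
  unfolding reflect_def[abs_def] by measurable

text \<open>Rotation invariance of the planar Gaussian: its characteristic function depends only on
  the norm of the argument. The pair is encoded as a family over \<open>{0,1}\<close> to fit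
  \<open>joint_cf_unique\<close>.\<close>

lemma distr_reflect:
  "std_normal \<Otimes>\<^sub>M std_normal = distr (std_normal \<Otimes>\<^sub>M std_normal) (std_normal \<Otimes>\<^sub>M std_normal) (reflect r)"
proof -
  interpret N: prob_space std_normal by (simp add: prob_space_normal_law)
  interpret P: pair_prob_space std_normal std_normal ..
  let ?D = "distr (std_normal \<Otimes>\<^sub>M std_normal) (std_normal \<Otimes>\<^sub>M std_normal) (reflect r)"
  define D where "D = sqrt (1 + r\<^sup>2)"
  have "1 + r\<^sup>2 > 0" by (simp add: add_pos_nonneg)
  then have D: "D > 0" "D\<^sup>2 = 1 + r\<^sup>2" by (simp_all add: D_def)
  show ?thesis
  proof (rule pair_measure_eqI)
    show "sigma_finite_measure std_normal" by unfold_locales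
    then show "sigma_finite_measure std_normal" .
    fix A B assume A: "A \<in> sets std_normal" "B \<in> sets std_normal"
    let ?X = "\<lambda>i::nat. if i = 0 then fst \<circ> reflect r else snd \<circ> reflect r"
    let ?Y = "\<lambda>i::nat. if i = 0 then fst else snd :: real \<times> real \<Rightarrow> real"
    let ?A = "\<lambda>i::nat. if i = 0 then A else B"
    have "measure (std_normal \<Otimes>\<^sub>M std_normal) {x\<in>space (std_normal \<Otimes>\<^sub>M std_normal). \<forall>i\<in>{0,1}. ?X i x \<in> ?A i}
       = measure (std_normal \<Otimes>\<^sub>M std_normal) {x\<in>space (std_normal \<Otimes>\<^sub>M std_normal). \<forall>i\<in>{0,1}. ?Y i x \<in> ?A i}"
    proof (rule joint_cf_unique[OF prob_space_normal_pair prob_space_normal_pair])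
      fix u :: "nat \<Rightarrow> real"
      have "(\<Sum>i\<in>{0,1}. u i * ?X i x) = ((u 0 + r * u 1) / D) * fst x + ((r * u 0 - u 1) / D) * snd x" for x
        using D(1) by (simp add: reflect_def D_def[symmetric] field_simps)
      then have "(CLINT x|std_normal \<Otimes>\<^sub>M std_normal. iexp (\<Sum>i\<in>{0,1}. u i * ?X i x))
        = exp (- (((u 0 + r * u 1) / D)\<^sup>2 + ((r * u 0 - u 1) / D)\<^sup>2) / 2)"
        by (simp only: cf_normal_pair)
      also have "((u 0 + r * u 1) / D)\<^sup>2 + ((r * u 0 - u 1) / D)\<^sup>2 = ((1 + r\<^sup>2) * ((u 0)\<^sup>2 + (u 1)\<^sup>2)) / D\<^sup>2"
        by (simp add: power_divide add_divide_distrib[symmetric]) (simp add: power2_eq_square algebra_simps)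
      also have "\<dots> = (u 0)\<^sup>2 + (u 1)\<^sup>2" using D by auto
      also have "exp (- ((u 0)\<^sup>2 + (u 1)\<^sup>2) / 2) = (CLINT x|std_normal \<Otimes>\<^sub>M std_normal. iexp (\<Sum>i\<in>{0,1}. u i * ?Y i x))"
        using cf_normal_pair[of "u 0" "u 1"] by simp
      finally show "(CLINT x|std_normal \<Otimes>\<^sub>M std_normal. iexp (\<Sum>i\<in>{0,1}. u i * ?X i x)) =
        (CLINT x|std_normal \<Otimes>\<^sub>M std_normal. iexp (\<Sum>i\<in>{0,1}. u i * ?Y i x))" .
    qed (use A in \<open>auto simp: comp_def intro: measurable_compose[OF measurable_reflect]\<close>)
    moreover have "{x\<in>space (std_normal \<Otimes>\<^sub>M std_normal). \<forall>i\<in>{0,1}. ?X i x \<in> ?A i} = reflect r -` (A \<times> B) \<inter> space (std_normal \<Otimes>\<^sub>M std_normal)"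
      by (auto simp: mem_Times_iff)
    moreover have "{x\<in>space (std_normal \<Otimes>\<^sub>M std_normal). \<forall>i\<in>{0,1}. ?Y i x \<in> ?A i} = A \<times> B"
      by (auto simp: space_pair_measure)
    ultimately have "measure ?D (A \<times> B) = measure (std_normal \<Otimes>\<^sub>M std_normal) (A \<times> B)"
      using A by (simp add: measure_distr)
    moreover have "emeasure ?D (A \<times> B) = measure ?D (A \<times> B)"
      by (rule finite_measure.emeasure_eq_measure, rule prob_space.finite_measure, rule P.prob_space_distr) simp
    ultimately have "emeasure ?D (A \<times> B) = emeasure (std_normal \<Otimes>\<^sub>M std_normal) (A \<times> B)"
      by (simp add: P.emeasure_eq_measure)
    then show "emeasure std_normal A * emeasure std_normal B = emeasure ?D (A \<times> B)"
      using A by (simp add: N.emeasure_pair_measure_Times)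
  qed simp
qed

section \<open>The two hypotheses as images of one probability space\<close>

text \<open>A sample consists of the design row, the residual \<open>\<xi>\<close> and the added
  noise \<open>w\<close>. Under the null hypothesis \<open>\<xi>\<close> is the first coordinate
  itself.\<close>

abbreviation base_space :: "nat \<Rightarrow> 'a measure \<Rightarrow> (nat \<Rightarrow> 'a \<times> real \<times> real) measure" where
  "base_space n \<nu> \<equiv> PiM {..<n} (\<lambda>_. \<nu> \<Otimes>\<^sub>M (std_normal \<Otimes>\<^sub>M std_normal))"

text \<open>The noise \<open>w\<close> is put at the front of the tape, where the distinguisher
  draws one normal per sample. The rest \<open>\<omega>\<close> is what the learner gets to read, so
  it is the whole tape in \<open>to_slr\<close>.\<close>

definition to_negspca :: "nat \<Rightarrow> ('a \<times> real \<Rightarrow> nat \<Rightarrow> real) \<Rightarrow> (nat \<Rightarrow> 'a \<times> real \<times> real) \<Rightarrow> (nat \<Rightarrow> real)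
    \<Rightarrow> (nat \<Rightarrow> nat \<Rightarrow> real) \<times> (nat \<Rightarrow> real)" where
  "to_negspca n \<phi> S \<omega> = (\<lambda>i\<in>{..<n}. \<phi> (fst (S i), fst (snd (S i))), comb_seq n (\<lambda>i. snd (snd (S i))) \<omega>)"

definition to_slr :: "nat \<Rightarrow> real \<Rightarrow> real \<Rightarrow> (nat \<Rightarrow> 'a \<times> real \<times> real) \<Rightarrow> (nat \<Rightarrow> real)
    \<Rightarrow> (nat \<Rightarrow> 'a \<times> real) \<times> (nat \<Rightarrow> real)" where
  "to_slr n s r S \<omega> = (\<lambda>i\<in>{..<n}. (fst (S i), s * fst (snd (S i)) + r * snd (snd (S i))), \<omega>)"

lemma distr_assoc_rev:
  assumes "prob_space L" "prob_space M" "prob_space N"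
  shows "L \<Otimes>\<^sub>M (M \<Otimes>\<^sub>M N) = distr ((L \<Otimes>\<^sub>M M) \<Otimes>\<^sub>M N) (L \<Otimes>\<^sub>M (M \<Otimes>\<^sub>M N)) (\<lambda>x. (fst (fst x), (snd (fst x), snd x)))"
proof -
  have "distr ((L \<Otimes>\<^sub>M M) \<Otimes>\<^sub>M N) (L \<Otimes>\<^sub>M (M \<Otimes>\<^sub>M N)) (\<lambda>x. (fst (fst x), (snd (fst x), snd x)))
    = distr (distr (L \<Otimes>\<^sub>M (M \<Otimes>\<^sub>M N)) ((L \<Otimes>\<^sub>M M) \<Otimes>\<^sub>M N) (\<lambda>x. ((fst x, fst (snd x)), snd (snd x))))
       (L \<Otimes>\<^sub>M (M \<Otimes>\<^sub>M N)) (\<lambda>x. (fst (fst x), (snd (fst x), snd x)))"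
    by (subst distr_assoc[OF assms]) (rule refl)
  also have "\<dots> = distr (L \<Otimes>\<^sub>M (M \<Otimes>\<^sub>M N)) (L \<Otimes>\<^sub>M (M \<Otimes>\<^sub>M N)) (\<lambda>x. x)"
    by (subst distr_distr) (auto simp: comp_def)
  finally show ?thesis by (simp add: distr_id2)
qed

lemma measurable_PiM_map:
  assumes "\<phi> \<in> M \<rightarrow>\<^sub>M N"
  shows "(\<lambda>S. \<lambda>i\<in>I. \<phi> (S i)) \<in> PiM I (\<lambda>_. M) \<rightarrow>\<^sub>M PiM I (\<lambda>_. N)"
  using assms by (intro measurable_restrict) (auto intro: measurable_compose[OF measurable_component_singleton])

lemma prob_space_base:
  assumes "prob_space \<nu>"
  shows "prob_space (\<nu> \<Otimes>\<^sub>M (std_normal \<Otimes>\<^sub>M std_normal))"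
proof -
  interpret A: prob_space \<nu> by fact
  interpret N: prob_space "std_normal \<Otimes>\<^sub>M std_normal" by (rule prob_space_normal_pair)
  interpret P: pair_prob_space \<nu> "std_normal \<Otimes>\<^sub>M std_normal" ..
  show ?thesis by unfold_locales
qed

context
  fixes \<nu> :: "'a measure" and B :: "(nat \<Rightarrow> real) measure" and \<phi> :: "'a \<times> real \<Rightarrow> nat \<Rightarrow> real" and \<mu> and n :: nat
  assumes \<nu>: "prob_space \<nu>" and \<phi>[measurable]: "\<phi> \<in> \<nu> \<Otimes>\<^sub>M std_normal \<rightarrow>\<^sub>M B"
    and \<mu>: "\<mu> = distr (\<nu> \<Otimes>\<^sub>M std_normal) B \<phi>"
begin

lemma measurable_to_negspca:
  "(\<lambda>x. to_negspca n \<phi> (fst x) (snd x)) \<in> base_space n \<nu> \<Otimes>\<^sub>M random_tape \<rightarrow>\<^sub>M negspca_space n \<mu>"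
  unfolding to_negspca_def negspca_space_def
proof (rule measurable_Pair)
  have "(\<lambda>x. \<phi> (fst x, fst (snd x))) \<in> \<nu> \<Otimes>\<^sub>M (std_normal \<Otimes>\<^sub>M std_normal) \<rightarrow>\<^sub>M \<mu>"
    unfolding \<mu> by simp
  note m = this
  show "(\<lambda>x. \<lambda>i\<in>{..<n}. \<phi> (fst (fst x i), fst (snd (fst x i)))) \<in> base_space n \<nu> \<Otimes>\<^sub>M random_tape \<rightarrow>\<^sub>M PiM {..<n} (\<lambda>_. \<mu>)"
    by (rule measurable_compose[OF measurable_fst measurable_PiM_map[OF m]])
  show "(\<lambda>x. comb_seq n (\<lambda>i. snd (snd (fst x i))) (snd x)) \<in> base_space n \<nu> \<Otimes>\<^sub>M random_tape \<rightarrow>\<^sub>M random_tape"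
  proof (rule measurable_splice)
    fix i assume "i < n"
    then have "(\<lambda>S. S i) \<in> base_space n \<nu> \<rightarrow>\<^sub>M \<nu> \<Otimes>\<^sub>M (std_normal \<Otimes>\<^sub>M std_normal)"
      by (simp add: measurable_component_singleton)
    then have "(\<lambda>x. fst x i) \<in> base_space n \<nu> \<Otimes>\<^sub>M random_tape \<rightarrow>\<^sub>M \<nu> \<Otimes>\<^sub>M (std_normal \<Otimes>\<^sub>M std_normal)"
      by (rule measurable_compose[OF measurable_fst])
    from measurable_compose[OF this, of "\<lambda>x. snd (snd x)" borel]
    show "(\<lambda>x. snd (snd (fst x i))) \<in> borel_measurable (base_space n \<nu> \<Otimes>\<^sub>M random_tape)"
      by simp
  qed simp
qed

lemma nn_integral_negspca_space:
  assumes f[measurable]: "f \<in> borel_measurable (negspca_space n \<mu>)"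
  shows "(\<integral>\<^sup>+x. f x \<partial>negspca_space n \<mu>) =
    (\<integral>\<^sup>+S. \<integral>\<^sup>+\<omega>. f (to_negspca n \<phi> S \<omega>) \<partial>random_tape \<partial>base_space n \<nu>)"
proof -
  let ?I = "{..<n}"
  interpret A: prob_space \<nu> by (rule \<nu>)
  interpret N: prob_space std_normal by (simp add: prob_space_normal_law)
  interpret T: prob_space random_tape by (rule prob_space_random_tape)
  interpret AN: pair_prob_space \<nu> std_normal ..
  have p\<mu>: "prob_space \<mu>" unfolding \<mu> by (rule AN.prob_space_distr) simp
  interpret M: prob_space \<mu> by (rule p\<mu>)
  have f'[measurable]: "f \<in> borel_measurable (PiM ?I (\<lambda>_. \<mu>) \<Otimes>\<^sub>M random_tape)"
    using f by (simp add: negspca_space_def)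
  define h where "h S = (\<integral>\<^sup>+\<omega>. f (\<lambda>i\<in>?I. fst (S i), comb_seq n (\<lambda>i. snd (S i)) \<omega>) \<partial>random_tape)" for S :: "nat \<Rightarrow> (nat \<Rightarrow> real) \<times> real"
  have "(\<lambda>x. comb_seq n (\<lambda>i. snd (fst x i)) (snd x)) \<in> PiM ?I (\<lambda>_. \<mu> \<Otimes>\<^sub>M std_normal) \<Otimes>\<^sub>M random_tape \<rightarrow>\<^sub>M random_tape"
  proof (rule measurable_splice)
    fix i assume "i < n"
    then have "(\<lambda>S. S i) \<in> PiM ?I (\<lambda>_. \<mu> \<Otimes>\<^sub>M std_normal) \<rightarrow>\<^sub>M \<mu> \<Otimes>\<^sub>M std_normal"
      by (simp add: measurable_component_singleton)
    then have "(\<lambda>x. fst x i) \<in> PiM ?I (\<lambda>_. \<mu> \<Otimes>\<^sub>M std_normal) \<Otimes>\<^sub>M random_tape \<rightarrow>\<^sub>M \<mu> \<Otimes>\<^sub>M std_normal"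
      by (rule measurable_compose[OF measurable_fst])
    from measurable_compose[OF this, of snd borel]
    show "(\<lambda>x. snd (fst x i)) \<in> borel_measurable (PiM ?I (\<lambda>_. \<mu> \<Otimes>\<^sub>M std_normal) \<Otimes>\<^sub>M random_tape)"
      by simp
  qed simp
  moreover have "(\<lambda>x. \<lambda>i\<in>?I. fst (fst x i)) \<in> PiM ?I (\<lambda>_. \<mu> \<Otimes>\<^sub>M std_normal) \<Otimes>\<^sub>M random_tape \<rightarrow>\<^sub>M PiM ?I (\<lambda>_. \<mu>)"
    by (rule measurable_compose[OF measurable_fst measurable_PiM_map[OF measurable_fst]])
  ultimately have "(\<lambda>x. f (\<lambda>i\<in>?I. fst (fst x i), comb_seq n (\<lambda>i. snd (fst x i)) (snd x)))
      \<in> borel_measurable (PiM ?I (\<lambda>_. \<mu> \<Otimes>\<^sub>M std_normal) \<Otimes>\<^sub>M random_tape)"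
    by (intro measurable_compose[OF measurable_Pair f'])
  then have h: "h \<in> borel_measurable (PiM ?I (\<lambda>_. \<mu> \<Otimes>\<^sub>M std_normal))"
    unfolding h_def by (intro T.borel_measurable_nn_integral) (simp add: split_beta')
  have eq: "\<mu> \<Otimes>\<^sub>M std_normal = distr (\<nu> \<Otimes>\<^sub>M (std_normal \<Otimes>\<^sub>M std_normal)) (B \<Otimes>\<^sub>M std_normal)
      (\<lambda>x. (\<phi> (fst x, fst (snd x)), snd (snd x)))"
  proof -
    have i: "distr std_normal std_normal (\<lambda>x. x) = std_normal" by (rule distr_id2) simp
    have "\<mu> \<Otimes>\<^sub>M std_normal = distr (\<nu> \<Otimes>\<^sub>M std_normal) B \<phi> \<Otimes>\<^sub>M distr std_normal std_normal (\<lambda>x. x)"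
      by (simp only: \<mu> i)
    also have "\<dots> = distr ((\<nu> \<Otimes>\<^sub>M std_normal) \<Otimes>\<^sub>M std_normal) (B \<Otimes>\<^sub>M std_normal) (\<lambda>(x, y). (\<phi> x, y))"
      by (rule pair_measure_distr) (simp_all add: i N.sigma_finite_measure_axioms)
    also have "\<dots> = distr (\<nu> \<Otimes>\<^sub>M (std_normal \<Otimes>\<^sub>M std_normal)) (B \<Otimes>\<^sub>M std_normal)
      (\<lambda>x. (\<phi> (fst x, fst (snd x)), snd (snd x)))"
      by (subst distr_assoc[OF \<nu> N.prob_space_axioms N.prob_space_axioms], subst distr_distr)
        (auto simp: comp_def split_beta')
    finally show ?thesis .
  qed
  have "(\<integral>\<^sup>+x. f x \<partial>negspca_space n \<mu>) = (\<integral>\<^sup>+Z. \<integral>\<^sup>+\<omega>. f (Z, \<omega>) \<partial>random_tape \<partial>PiM ?I (\<lambda>_. \<mu>))"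
    unfolding negspca_space_def by (subst T.nn_integral_fst[symmetric]) auto
  also have "\<dots> = (\<integral>\<^sup>+Z. \<integral>\<^sup>+w. h (\<lambda>i\<in>?I. (Z i, w i)) \<partial>PiM ?I (\<lambda>_. std_normal) \<partial>PiM ?I (\<lambda>_. \<mu>))"
  proof (rule nn_integral_cong)
    fix Z assume Z: "Z \<in> space (PiM ?I (\<lambda>_. \<mu>))"
    then have rZ: "restrict Z ?I = Z" by (simp add: space_PiM)
    have "(\<lambda>i\<in>?I. fst ((\<lambda>i\<in>?I. (Z i, w i)) i)) = restrict Z ?I" for w :: "nat \<Rightarrow> real"
      by (simp add: restrict_def cong: if_cong)
    moreover have "comb_seq n (\<lambda>i. snd ((\<lambda>i\<in>?I. (Z i, w i)) i)) \<omega> = comb_seq n w \<omega>" for w \<omega> :: "nat \<Rightarrow> real"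
      by (auto simp: comb_seq_def fun_eq_iff)
    ultimately have "h (\<lambda>i\<in>?I. (Z i, w i)) = (\<integral>\<^sup>+\<omega>. f (Z, comb_seq n w \<omega>) \<partial>random_tape)" for w
      unfolding h_def by (simp only: rZ)
    moreover have "(\<lambda>\<omega>. f (Z, \<omega>)) \<in> borel_measurable random_tape"
      using Z by (intro measurable_compose[OF _ f'] measurable_Pair1') auto
    ultimately show "(\<integral>\<^sup>+\<omega>. f (Z, \<omega>) \<partial>random_tape) = (\<integral>\<^sup>+w. h (\<lambda>i\<in>?I. (Z i, w i)) \<partial>PiM ?I (\<lambda>_. std_normal))"
      using nn_integral_random_tape by simp
  qed
  also have "\<dots> = (\<integral>\<^sup>+S. h S \<partial>PiM ?I (\<lambda>_. \<mu> \<Otimes>\<^sub>M std_normal))"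
    by (rule nn_integral_PiM_pair[OF p\<mu> N.prob_space_axioms _ h, symmetric]) simp
  also have "\<dots> = (\<integral>\<^sup>+S. h (\<lambda>i\<in>?I. (\<phi> (fst (S i), fst (snd (S i))), snd (snd (S i)))) \<partial>base_space n \<nu>)"
    by (rule nn_integral_PiM_distr[OF prob_space_base[OF \<nu>] _ _ eq h]) simp_all
  also have "\<dots> = (\<integral>\<^sup>+S. \<integral>\<^sup>+\<omega>. f (to_negspca n \<phi> S \<omega>) \<partial>random_tape \<partial>base_space n \<nu>)"
  proof -
    have "(\<lambda>i\<in>?I. fst ((\<lambda>i\<in>?I. (\<phi> (fst (S i), fst (snd (S i))), snd (snd (S i)))) i)) = (\<lambda>i\<in>?I. \<phi> (fst (S i), fst (snd (S i))))"
      for S :: "nat \<Rightarrow> 'a \<times> real \<times> real"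
      by (simp add: restrict_def cong: if_cong)
    moreover have "comb_seq n (\<lambda>i. snd ((\<lambda>i\<in>?I. (\<phi> (fst (S i), fst (snd (S i))), snd (snd (S i)))) i)) \<omega>
       = comb_seq n (\<lambda>i. snd (snd (S i))) \<omega>" for S :: "nat \<Rightarrow> 'a \<times> real \<times> real" and \<omega>
      by (auto simp: comb_seq_def fun_eq_iff)
    ultimately show ?thesis unfolding h_def to_negspca_def by simp
  qed
  finally show ?thesis .
qed

end

text \<open>The unit noise of the learner's model is produced as \<open>s * \<xi> + r * w\<close>,
  which is standard normal because \<open>s\<^sup>2 + r\<^sup>2 = 1\<close>.\<close>

lemma nn_integral_slr_space:
  fixes d n and \<Sigma> s r
  defines "\<nu> \<equiv> mv_normal d \<Sigma>"
  assumes \<nu>: "prob_space \<nu>" and sr: "s\<^sup>2 + r\<^sup>2 = 1"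
    and f: "f \<in> borel_measurable (slr_space n d 1 \<Sigma>)"
  shows "(\<integral>\<^sup>+x. f x \<partial>slr_space n d 1 \<Sigma>) =
    (\<integral>\<^sup>+S. \<integral>\<^sup>+\<omega>. f (to_slr n s r S \<omega>) \<partial>random_tape \<partial>base_space n \<nu>)"
proof -
  let ?I = "{..<n}"
  interpret A: prob_space \<nu> by (rule \<nu>)
  interpret N: prob_space std_normal by (simp add: prob_space_normal_law)
  interpret T: prob_space random_tape by (rule prob_space_random_tape)
  have f'[measurable]: "f \<in> borel_measurable (PiM ?I (\<lambda>_. \<nu> \<Otimes>\<^sub>M std_normal) \<Otimes>\<^sub>M random_tape)"
    using f by (simp add: slr_space_def \<nu>_def)
  define h where "h S = (\<integral>\<^sup>+\<omega>. f (S, \<omega>) \<partial>random_tape)" for S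
  have h: "h \<in> borel_measurable (PiM ?I (\<lambda>_. \<nu> \<Otimes>\<^sub>M std_normal))"
    unfolding h_def by (intro T.borel_measurable_nn_integral) simp
  have eq: "\<nu> \<Otimes>\<^sub>M std_normal = distr (\<nu> \<Otimes>\<^sub>M (std_normal \<Otimes>\<^sub>M std_normal)) (\<nu> \<Otimes>\<^sub>M borel)
      (\<lambda>x. (fst x, s * fst (snd x) + r * snd (snd x)))"
  proof -
    have i: "distr \<nu> \<nu> (\<lambda>x. x) = \<nu>" by (rule distr_id2) simp
    have "\<nu> \<Otimes>\<^sub>M std_normal = distr \<nu> \<nu> (\<lambda>x. x) \<Otimes>\<^sub>M distr (std_normal \<Otimes>\<^sub>M std_normal) borel (\<lambda>x. s * fst x + r * snd x)"
      by (simp only: i distr_normal_comb[OF sr, symmetric])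
    also have "\<dots> = distr (\<nu> \<Otimes>\<^sub>M (std_normal \<Otimes>\<^sub>M std_normal)) (\<nu> \<Otimes>\<^sub>M borel) (\<lambda>(x, y). (x, s * fst y + r * snd y))"
      by (rule pair_measure_distr) (simp_all add: distr_normal_comb[OF sr, symmetric] N.sigma_finite_measure_axioms)
    finally show ?thesis by (simp add: split_beta')
  qed
  have "(\<integral>\<^sup>+x. f x \<partial>slr_space n d 1 \<Sigma>) = (\<integral>\<^sup>+S. h S \<partial>PiM ?I (\<lambda>_. \<nu> \<Otimes>\<^sub>M std_normal))"
    unfolding slr_space_def h_def \<nu>_def[symmetric] by (subst T.nn_integral_fst[symmetric]) auto
  also have "\<dots> = (\<integral>\<^sup>+S. h (\<lambda>i\<in>?I. (fst (S i), s * fst (snd (S i)) + r * snd (snd (S i)))) \<partial>base_space n \<nu>)"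
    by (rule nn_integral_PiM_distr[OF prob_space_base[OF \<nu>] _ _ eq h]) simp_all
  finally show ?thesis by (simp add: h_def to_slr_def)
qed

section \<open>Second moments and small-ball estimates\<close>

lemma nn_integral_std_normal_square: "(\<integral>\<^sup>+x. ennreal (x\<^sup>2) \<partial>std_normal) = 1"
proof -
  have "std_normal = std_normal_distribution" by (simp add: normal_law_def)
  then show ?thesis
    using std_normal_distribution_even_moments[of 1]
    by (subst nn_integral_eq_integral) (auto simp: numeral_2_eq_2)
qed

lemma nn_integral_base_square:
  assumes \<nu>: "prob_space \<nu>" and i: "i < n"
  shows "(\<integral>\<^sup>+S. ennreal ((fst (snd (S i)))\<^sup>2) \<partial>base_space n \<nu>) = 1"
proof -
  interpret A: prob_space \<nu> by (rule \<nu>)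
  interpret N: prob_space std_normal by (simp add: prob_space_normal_law)
  interpret NN: prob_space "std_normal \<Otimes>\<^sub>M std_normal" by (rule prob_space_normal_pair)
  let ?B = "\<nu> \<Otimes>\<^sub>M (std_normal \<Otimes>\<^sub>M std_normal)"
  have c: "(\<lambda>S. S i) \<in> base_space n \<nu> \<rightarrow>\<^sub>M ?B"
    using i by (simp add: measurable_component_singleton)
  have "(\<integral>\<^sup>+S. ennreal ((fst (snd (S i)))\<^sup>2) \<partial>base_space n \<nu>) = (\<integral>\<^sup>+x. ennreal ((fst (snd x))\<^sup>2) \<partial>distr (base_space n \<nu>) ?B (\<lambda>S. S i))"
    by (subst nn_integral_distr[OF c]) auto
  also have "\<dots> = (\<integral>\<^sup>+x. ennreal ((fst (snd x))\<^sup>2) \<partial>?B)"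
    using i by (subst distr_PiM_component) (auto intro: prob_space_base \<nu>)
  also have "\<dots> = (\<integral>\<^sup>+a. \<integral>\<^sup>+y. ennreal ((fst y)\<^sup>2) \<partial>(std_normal \<Otimes>\<^sub>M std_normal) \<partial>\<nu>)"
    by (subst NN.nn_integral_fst[symmetric]) auto
  also have "\<dots> = (\<integral>\<^sup>+y. ennreal ((fst y)\<^sup>2) \<partial>(std_normal \<Otimes>\<^sub>M std_normal))"
    by (simp add: A.emeasure_space_1)
  also have "\<dots> = (\<integral>\<^sup>+x. \<integral>\<^sup>+y. ennreal (x\<^sup>2) \<partial>std_normal \<partial>std_normal)"
    by (subst N.nn_integral_fst[symmetric]) auto
  also have "\<dots> = 1"
    using N.emeasure_space_1 by (simp add: nn_integral_std_normal_square)
  finally show ?thesis .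
qed

lemma normal_density_le_half: "normal_density 0 1 x \<le> 1 / 2"
proof -
  have "sqrt (2 * pi) \<ge> sqrt (2 * 2)" using pi_ge_two by (intro real_sqrt_le_mono) simp
  then have "sqrt (2 * pi) \<ge> 2" by simp
  then have "1 / sqrt (2 * pi) * exp (- x\<^sup>2 / 2) \<le> 1 / 2 * 1"
    by (intro mult_mono) (auto simp: field_simps)
  then show ?thesis by (simp add: normal_density_def)
qed

text \<open>An interval of length \<open>2 * b / c\<close> times the density bound 1/2; for negative
  \<open>b\<close> both sides are 0.\<close>

lemma std_normal_small_ball:
  assumes c: "c > 0"
  shows "emeasure std_normal {q. \<bar>c * q - m\<bar> < b} \<le> ennreal (b / c)"
proof (cases "b \<ge> 0")
  case True
  have e: "{q. \<bar>c * q - m\<bar> < b} = {(m - b) / c<..<(m + b) / c}"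
    using c by (auto simp: field_simps abs_less_iff)
  have "emeasure std_normal {q. \<bar>c * q - m\<bar> < b}
     = (\<integral>\<^sup>+q. ennreal (normal_density 0 1 q) * indicator {(m - b) / c<..<(m + b) / c} q \<partial>lborel)"
    unfolding e by (simp add: normal_law_def emeasure_density)
  also have "\<dots> \<le> (\<integral>\<^sup>+q. ennreal (1 / 2) * indicator {(m - b) / c<..<(m + b) / c} q \<partial>lborel)"
    by (intro nn_integral_mono mult_right_mono ennreal_leI normal_density_le_half) simp
  also have "\<dots> = ennreal (1 / 2) * ennreal ((m + b) / c - (m - b) / c)"
    using c True by (subst nn_integral_cmult_indicator) (auto simp: divide_right_mono)
  also have "\<dots> = ennreal (b / c)"
    using c True by (subst ennreal_mult'[symmetric]) (simp_all add: diff_divide_distrib[symmetric])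
  finally show ?thesis .
next
  case False
  then have "{q. \<bar>c * q - m\<bar> < b} = {}" by auto
  then show ?thesis by simp
qed

text \<open>\<open>8 / 15 = 40 / 75\<close> is the Chernoff exponent that the threshold 1/75
  contributes per sample. The bound is \<open>1 + x \<le> exp x\<close> at
  \<open>x = - 2 / 15\<close>, inverted and raised to the fourth power.\<close>

lemma exp_four_fifteenths: "exp (8 / 15 :: real) \<le> 16 / 9"
proof -
  have "1 + (- 2 / 15) \<le> exp (- 2 / 15 :: real)" by (rule exp_ge_add_one_self)
  then have "exp (2 / 15 :: real) \<le> 15 / 13" by (simp add: exp_minus field_simps)
  then have "exp (2 / 15 :: real) ^ 4 \<le> (15 / 13) ^ 4" by (intro power_mono) auto
  also have "exp (2 / 15 :: real) ^ 4 = exp (8 / 15)" by (simp add: exp_of_nat_mult[symmetric])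
  also have "(15 / 13) ^ 4 \<le> (16 / 9 :: real)" by (simp add: power_divide)
  finally show ?thesis .
qed

text \<open>\<open>5 / 2 = 40 * (1 / 4)\<^sup>2\<close> is the Chernoff exponent at the cutoff
  \<open>1 / 4\<close>.\<close>

lemma exp_minus_five_halves: "exp (- (5 / 2) :: real) \<le> 1 / 10"
proof -
  have "1 + 5 / 8 + (5 / 8)\<^sup>2 / 2 \<le> exp (5 / 8 :: real)"
    by (rule exp_lower_Taylor_quadratic) simp
  then have "1.82 \<le> exp (5 / 8 :: real)" by (simp add: power2_eq_square)
  then have "1.82 ^ 4 \<le> exp (5 / 8 :: real) ^ 4" by (intro power_mono) auto
  also have "exp (5 / 8 :: real) ^ 4 = exp (5 / 2)" by (simp add: exp_of_nat_mult[symmetric])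
  finally have "10 \<le> exp (5 / 2 :: real)" by (simp add: power_divide)
  then show ?thesis by (simp add: exp_minus field_simps)
qed

text \<open>A Chernoff bound with \<open>\<lambda> = 40\<close>, after bounding \<open>exp (- 40 x\<^sup>2)\<close> by a two-valued function.\<close>

lemma small_ball_product:
  fixes m :: "nat \<Rightarrow> real" and c :: real
  assumes c: "c \<ge> 2 / 3 - 1 / 150"
    and F: "\<And>q. F q \<le> 1" "\<And>q. F q \<noteq> 0 \<Longrightarrow> 75 * (\<Sum>i<n. (c * q i - m i)\<^sup>2) < real n"
  shows "(\<integral>\<^sup>+q. F q \<partial>PiM {..<n} (\<lambda>_. std_normal)) \<le> ennreal ((9 / 10) ^ n)"
proof -
  interpret N: prob_space std_normal by (simp add: prob_space_normal_law)
  interpret P: product_prob_space "\<lambda>_. std_normal" "{..<n}" by (rule product_prob_spaceI) unfold_locales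
  \<comment> \<open>A majorant of \<open>exp (8 / 15 - 40 * x\<^sup>2)\<close> at
    \<open>x = c * q - m i\<close>: 16/9 bounds the constant factor, and the Gaussian factor is at
    most 1 within distance 1/4 and at most 1/10 beyond. Its integral needs nothing but a small-ball
    probability.\<close>
  define g where "g i q = (16 / 9) * (indicator {q. \<bar>c * q - m i\<bar> < 1 / 4} q + 1 / 10 :: real)" for i q
  have gm[measurable]: "g i \<in> borel_measurable borel" for i unfolding g_def by measurable
  have g0: "g i q \<ge> 0" for i q by (simp add: g_def)
  have "F q \<le> (\<Prod>i<n. ennreal (g i (q i)))" for q
  proof (cases "F q = 0")
    case False
    define x where "x i = c * q i - m i" for i
    have x: "75 * (\<Sum>i<n. (x i)\<^sup>2) < real n" using F(2)[OF False] by (simp add: x_def)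
    have "exp (8 / 15 - 40 * (x i)\<^sup>2) \<le> g i (q i)" for i
    proof -
      have "exp (- 40 * (x i)\<^sup>2) \<le> indicator {q. \<bar>c * q - m i\<bar> < 1 / 4} (q i) + 1 / 10"
      proof (cases "\<bar>x i\<bar> < 1 / 4")
        case True
        then have "indicator {q. \<bar>c * q - m i\<bar> < 1 / 4} (q i) = (1 :: real)" by (simp add: x_def)
        moreover have "exp (- 40 * (x i)\<^sup>2) \<le> 1" by simp
        ultimately show ?thesis by linarith
      next
        case False
        then have "(1 / 4)\<^sup>2 \<le> \<bar>x i\<bar>\<^sup>2" by (intro power_mono) auto
        then have "exp (- 40 * (x i)\<^sup>2) \<le> exp (- (5 / 2))" by (simp add: power2_eq_square)
        also have "\<dots> \<le> 1 / 10" by (rule exp_minus_five_halves)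
        finally show ?thesis by (simp add: add_increasing)
      qed
      then have "exp (8 / 15) * exp (- 40 * (x i)\<^sup>2) \<le> g i (q i)"
        unfolding g_def using exp_four_fifteenths by (intro mult_mono) auto
      then show ?thesis by (simp add: exp_add[symmetric])
    qed
    then have "(\<Prod>i<n. exp (8 / 15 - 40 * (x i)\<^sup>2)) \<le> (\<Prod>i<n. g i (q i))"
      by (intro prod_mono) auto
    moreover have "(\<Prod>i<n. exp (8 / 15 - 40 * (x i)\<^sup>2)) = exp (8 / 15 * real n - 40 * (\<Sum>i<n. (x i)\<^sup>2))"
      by (simp add: exp_sum[symmetric] sum_subtractf sum_distrib_left)
    \<comment> \<open>The support condition on \<open>F\<close> enters here: the sum of squares is
      below \<open>n / 75\<close>, and \<open>40 / 75 = 8 / 15\<close>.\<close>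
    moreover have "exp (8 / 15 * real n - 40 * (\<Sum>i<n. (x i)\<^sup>2)) \<ge> 1"
      using x by simp
    ultimately have "1 \<le> (\<Prod>i<n. g i (q i))" by linarith
    then have "1 \<le> (\<Prod>i<n. ennreal (g i (q i)))"
      using g0 by (simp add: prod_ennreal)
    then show ?thesis using F(1)[of q] by (rule order_trans[rotated])
  qed simp
  then have "(\<integral>\<^sup>+q. F q \<partial>PiM {..<n} (\<lambda>_. std_normal)) \<le> (\<integral>\<^sup>+q. (\<Prod>i<n. ennreal (g i (q i))) \<partial>PiM {..<n} (\<lambda>_. std_normal))"
    by (intro nn_integral_mono)
  also have "\<dots> = (\<Prod>i<n. \<integral>\<^sup>+q. ennreal (g i q) \<partial>std_normal)"
    by (intro P.product_nn_integral_prod) auto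
  also have "\<dots> \<le> (\<Prod>i<n. ennreal (9 / 10))"
  proof (rule prod_mono_ennreal)
    fix i
    have cp: "c > 0" using c by simp
    have "(\<integral>\<^sup>+q. ennreal (g i q) \<partial>std_normal)
       = (\<integral>\<^sup>+q. ennreal (16 / 9) * (indicator {q. \<bar>c * q - m i\<bar> < 1 / 4} q + ennreal (1 / 10)) \<partial>std_normal)"
      unfolding g_def
      by (intro nn_integral_cong) (simp add: ennreal_mult'[symmetric] ennreal_plus[symmetric] ennreal_indicator[symmetric] del: ennreal_plus)
    also have "\<dots> = ennreal (16 / 9) * (emeasure std_normal {q. \<bar>c * q - m i\<bar> < 1 / 4} + ennreal (1 / 10))"
      using N.emeasure_space_1 by (subst nn_integral_cmult, simp, subst nn_integral_add) auto
    also have "\<dots> \<le> ennreal (16 / 9) * (ennreal ((1 / 4) / c) + ennreal (1 / 10))"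
      by (intro mult_left_mono add_right_mono std_normal_small_ball cp) simp
    also have "\<dots> = ennreal ((16 / 9) * ((1 / 4) / c + 1 / 10))"
      using cp by (simp add: ennreal_mult'[symmetric] ennreal_plus[symmetric] del: ennreal_plus)
    also have "\<dots> \<le> ennreal (9 / 10)"
      using c by (intro ennreal_leI) (simp add: field_simps)
    finally show "(\<integral>\<^sup>+q. ennreal (g i q) \<partial>std_normal) \<le> ennreal (9 / 10)" .
  qed
  also have "\<dots> = ennreal ((9 / 10) ^ n)" by (simp add: ennreal_power)
  finally show ?thesis .
qed

text \<open>Neither measurability nor sparsity is asked of the estimate \<open>V\<close>. In the
  coordinates of \<open>reflect\<close>, what \<open>V\<close> sees depends on \<open>U\<close> and
  \<open>\<omega>\<close> alone, so Fubini's theorem allows the hidden coordinates \<open>q\<close>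
  to be integrated first, with the estimate held constant. There remains a small-ball bound that is
  uniform in this constant.\<close>

lemma null_bound:
  fixes \<nu> :: "'a measure" and V :: "(nat \<Rightarrow> 'a) \<Rightarrow> (nat \<Rightarrow> real) \<Rightarrow> (nat \<Rightarrow> real) \<Rightarrow> nat \<Rightarrow> real"
  assumes \<nu>: "prob_space \<nu>" and r: "9 / 10 \<le> r" "r \<le> 1"
    and G[measurable]: "Measurable.pred (base_space n \<nu> \<Otimes>\<^sub>M random_tape) (\<lambda>x. G (fst x) (snd x))"
    and V: "\<And>S \<omega>. G S \<omega> \<Longrightarrow> 75 * (\<Sum>i<n. (fst (snd (S i)) -
       V (\<lambda>i\<in>{..<n}. fst (S i)) (\<lambda>i\<in>{..<n}. fst (snd (S i)) + r * snd (snd (S i))) \<omega> i)\<^sup>2) < real n"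
  shows "(\<integral>\<^sup>+S. \<integral>\<^sup>+\<omega>. indicator {\<omega>. G S \<omega>} \<omega> \<partial>random_tape \<partial>base_space n \<nu>) \<le> ennreal ((9 / 10) ^ n)"
proof -
  let ?I = "{..<n}" and ?N = "PiM {..<n} (\<lambda>_. std_normal)"
  interpret A: prob_space \<nu> by (rule \<nu>)
  interpret N: prob_space std_normal by (simp add: prob_space_normal_law)
  interpret NN: prob_space "std_normal \<Otimes>\<^sub>M std_normal" by (rule prob_space_normal_pair)
  interpret AN: pair_prob_space \<nu> std_normal ..
  interpret T: prob_space random_tape by (rule prob_space_random_tape)
  interpret PN: prob_space ?N by (rule prob_space_PiM_normal)
  interpret NT: pair_prob_space ?N random_tape ..
  interpret PA: prob_space "PiM ?I (\<lambda>_. \<nu> \<Otimes>\<^sub>M std_normal)"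
    by (intro prob_space_PiM AN.prob_space_axioms)
  define \<psi> where "\<psi> y = (fst (fst y), reflect r (snd (fst y), snd y))" for y :: "('a \<times> real) \<times> real"
  define D where "D = sqrt (1 + r\<^sup>2)"
  have "r\<^sup>2 \<ge> (9/10)\<^sup>2" using r by (intro power_mono) auto
  then have r2: "r\<^sup>2 \<ge> 81/100" by (simp add: power2_eq_square)
  have D: "D > 0" "D\<^sup>2 = 1 + r\<^sup>2" using r by (simp_all add: D_def add_pos_nonneg)
  \<comment> \<open>The bound \<open>2 / 3 - 1 / 150 = 33 / 50\<close> requires
    \<open>r\<^sup>2\<close> to be at least about 0.772; \<open>r \<ge> 9 / 10\<close> provides
    0.81.\<close>
  have c: "r / D \<ge> 2 / 3 - 1 / 150"
  proof (rule power2_le_imp_le)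
    have "(r / D)\<^sup>2 = r\<^sup>2 / (1 + r\<^sup>2)" by (simp add: power_divide D)
    moreover have "(33 / 50)\<^sup>2 * (1 + r\<^sup>2) \<le> r\<^sup>2" using r2 by (simp add: power2_eq_square)
    moreover have "2 / 3 - 1 / 150 = (33 / 50 :: real)" by simp
    ultimately show "(2 / 3 - 1 / 150)\<^sup>2 \<le> (r / D)\<^sup>2"
      using r2 by (simp only: pos_le_divide_eq[of "1 + r\<^sup>2"])
  qed (use r D in auto)
  have \<psi>[measurable]: "\<psi> \<in> (\<nu> \<Otimes>\<^sub>M std_normal) \<Otimes>\<^sub>M std_normal \<rightarrow>\<^sub>M \<nu> \<Otimes>\<^sub>M (std_normal \<Otimes>\<^sub>M std_normal)"
    unfolding \<psi>_def[abs_def] by measurable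
  have eq: "\<nu> \<Otimes>\<^sub>M (std_normal \<Otimes>\<^sub>M std_normal) = distr ((\<nu> \<Otimes>\<^sub>M std_normal) \<Otimes>\<^sub>M std_normal) (\<nu> \<Otimes>\<^sub>M (std_normal \<Otimes>\<^sub>M std_normal)) \<psi>"
  proof -
    have i: "distr \<nu> \<nu> (\<lambda>x. x) = \<nu>" by (rule distr_id2) simp
    have "\<nu> \<Otimes>\<^sub>M (std_normal \<Otimes>\<^sub>M std_normal) = distr \<nu> \<nu> (\<lambda>x. x) \<Otimes>\<^sub>M distr (std_normal \<Otimes>\<^sub>M std_normal) (std_normal \<Otimes>\<^sub>M std_normal) (reflect r)"
      by (simp only: i distr_reflect[symmetric])
    also have "\<dots> = distr (\<nu> \<Otimes>\<^sub>M (std_normal \<Otimes>\<^sub>M std_normal)) (\<nu> \<Otimes>\<^sub>M (std_normal \<Otimes>\<^sub>M std_normal)) (\<lambda>(x, y). (x, reflect r y))"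
      by (rule pair_measure_distr) (simp_all add: distr_reflect[symmetric] NN.sigma_finite_measure_axioms)
    also have "\<dots> = distr ((\<nu> \<Otimes>\<^sub>M std_normal) \<Otimes>\<^sub>M std_normal) (\<nu> \<Otimes>\<^sub>M (std_normal \<Otimes>\<^sub>M std_normal)) \<psi>"
      by (subst distr_assoc_rev[OF \<nu> N.prob_space_axioms N.prob_space_axioms], subst distr_distr)
        (simp_all add: comp_def split_beta' \<psi>_def[abs_def])
    finally show ?thesis .
  qed
  define F where "F S \<omega> = (indicator {\<omega>. G S \<omega>} \<omega> :: ennreal)" for S \<omega>
  have F: "(\<lambda>x. F (fst x) (snd x)) \<in> borel_measurable (base_space n \<nu> \<Otimes>\<^sub>M random_tape)"
  proof -
    have "(\<lambda>x. F (fst x) (snd x)) = (\<lambda>x. if G (fst x) (snd x) then 1 else 0)"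
      by (auto simp: F_def fun_eq_iff)
    then show ?thesis by simp
  qed
  define h where "h S = (\<integral>\<^sup>+\<omega>. F S \<omega> \<partial>random_tape)" for S
  have h: "h \<in> borel_measurable (base_space n \<nu>)"
    unfolding h_def using F by (intro T.borel_measurable_nn_integral) (simp add: split_beta')
  define S where "S U q = (\<lambda>i\<in>?I. \<psi> (U i, q i))" for U q
  have "(\<integral>\<^sup>+S. h S \<partial>base_space n \<nu>) = (\<integral>\<^sup>+S. h (\<lambda>i\<in>?I. \<psi> (S i)) \<partial>PiM ?I (\<lambda>_. (\<nu> \<Otimes>\<^sub>M std_normal) \<Otimes>\<^sub>M std_normal))"
  proof (rule nn_integral_PiM_distr[OF _ _ _ eq h])
    interpret ANN: pair_prob_space "\<nu> \<Otimes>\<^sub>M std_normal" std_normal ..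
    show "prob_space ((\<nu> \<Otimes>\<^sub>M std_normal) \<Otimes>\<^sub>M std_normal)" by unfold_locales
  qed simp_all
  also have "\<dots> = (\<integral>\<^sup>+U. \<integral>\<^sup>+q. h (\<lambda>i\<in>?I. \<psi> ((\<lambda>i\<in>?I. (U i, q i)) i)) \<partial>?N \<partial>PiM ?I (\<lambda>_. \<nu> \<Otimes>\<^sub>M std_normal))"
    by (rule nn_integral_PiM_pair[OF AN.prob_space_axioms N.prob_space_axioms])
      (auto intro: measurable_compose[OF measurable_PiM_map[OF \<psi>] h])
  also have "\<dots> = (\<integral>\<^sup>+U. \<integral>\<^sup>+q. h (S U q) \<partial>?N \<partial>PiM ?I (\<lambda>_. \<nu> \<Otimes>\<^sub>M std_normal))"
  proof -
    have "(\<lambda>i\<in>?I. \<psi> ((\<lambda>i\<in>?I. (U i, q i)) i)) = S U q" for U q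
      by (auto simp: S_def fun_eq_iff)
    then show ?thesis by simp
  qed
  also have "\<dots> \<le> (\<integral>\<^sup>+U. ennreal ((9 / 10) ^ n) \<partial>PiM ?I (\<lambda>_. \<nu> \<Otimes>\<^sub>M std_normal))"
  proof (rule nn_integral_mono)
    fix U assume U: "U \<in> space (PiM ?I (\<lambda>_. \<nu> \<Otimes>\<^sub>M std_normal))"
    have SU: "S U \<in> ?N \<rightarrow>\<^sub>M base_space n \<nu>"
      unfolding S_def
    proof (rule measurable_restrict)
      fix i assume i: "i \<in> ?I"
      then have "U i \<in> space (\<nu> \<Otimes>\<^sub>M std_normal)" using U by (auto simp: space_PiM)
      then have "(\<lambda>q. (U i, q i)) \<in> ?N \<rightarrow>\<^sub>M (\<nu> \<Otimes>\<^sub>M std_normal) \<Otimes>\<^sub>M std_normal"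
        using i by (intro measurable_Pair measurable_const measurable_component_singleton) auto
      then show "(\<lambda>q. \<psi> (U i, q i)) \<in> ?N \<rightarrow>\<^sub>M \<nu> \<Otimes>\<^sub>M (std_normal \<Otimes>\<^sub>M std_normal)"
        by (rule measurable_compose[OF _ \<psi>])
    qed
    then have "(\<lambda>x. (S U (fst x), snd x)) \<in> ?N \<Otimes>\<^sub>M random_tape \<rightarrow>\<^sub>M base_space n \<nu> \<Otimes>\<^sub>M random_tape"
      by (intro measurable_Pair measurable_compose[OF measurable_fst]) auto
    from measurable_compose[OF this F]
    have m: "(\<lambda>(q, \<omega>). F (S U q) \<omega>) \<in> borel_measurable (?N \<Otimes>\<^sub>M random_tape)"
      by (simp add: split_beta')
    have "(\<integral>\<^sup>+q. h (S U q) \<partial>?N) = (\<integral>\<^sup>+\<omega>. \<integral>\<^sup>+q. F (S U q) \<omega> \<partial>?N \<partial>random_tape)"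
      unfolding h_def using NT.Fubini'[OF m] by simp
    also have "\<dots> \<le> (\<integral>\<^sup>+\<omega>. ennreal ((9 / 10) ^ n) \<partial>random_tape)"
    proof (rule nn_integral_mono)
      fix \<omega>
      define p where "p i = snd (U i)" for i
      \<comment> \<open>Constant in \<open>q\<close>: by the two identities below, \<open>V\<close>
        is given the design and the values \<open>D * p i\<close>, from which \<open>q\<close> has
        disappeared.\<close>
      define v where "v = V (\<lambda>i\<in>?I. fst (U i)) (\<lambda>i\<in>?I. D * p i) \<omega>"
      show "(\<integral>\<^sup>+q. F (S U q) \<omega> \<partial>?N) \<le> ennreal ((9 / 10) ^ n)"
      proof (rule small_ball_product[OF c, where m="\<lambda>i. v i - p i / D"])
        fix q assume "F (S U q) \<omega> \<noteq> 0"
        then have "G (S U q) \<omega>" by (auto simp: F_def indicator_def split: if_splits)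
        note V[OF this]
        moreover have "(\<lambda>i\<in>?I. fst (S U q i)) = (\<lambda>i\<in>?I. fst (U i))"
          by (auto simp: S_def \<psi>_def)
        moreover have "(\<lambda>i\<in>?I. fst (snd (S U q i)) + r * snd (snd (S U q i))) = (\<lambda>i\<in>?I. D * p i)"
        proof (rule restrict_ext)
          fix i assume "i \<in> ?I"
          then have "fst (snd (S U q i)) + r * snd (snd (S U q i)) = (p i + r * q i) / D + r * ((r * p i - q i) / D)"
            by (simp add: S_def \<psi>_def reflect_def p_def D_def)
          also have "\<dots> = (1 + r\<^sup>2) * p i / D"
            by (simp add: add_divide_distrib[symmetric] power2_eq_square algebra_simps)
          also have "\<dots> = D * p i"
            using D(1) unfolding D(2)[symmetric] by (simp add: power2_eq_square)
          finally show "fst (snd (S U q i)) + r * snd (snd (S U q i)) = D * p i" .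
        qed
        ultimately have "75 * (\<Sum>i<n. (fst (snd (S U q i)) - v i)\<^sup>2) < real n"
          by (simp only: v_def)
        moreover have "(\<Sum>i<n. (fst (snd (S U q i)) - v i)\<^sup>2) = (\<Sum>i<n. (r / D * q i - (v i - p i / D))\<^sup>2)"
          by (intro sum.cong refl) (simp add: S_def \<psi>_def reflect_def p_def D_def[symmetric] add_divide_distrib algebra_simps)
        ultimately show "75 * (\<Sum>i<n. (r / D * q i - (v i - p i / D))\<^sup>2) < real n" by simp
      qed (simp add: F_def indicator_def)
    qed
    also have "\<dots> = ennreal ((9 / 10) ^ n)" by (simp add: T.emeasure_space_1)
    finally show "(\<integral>\<^sup>+q. h (S U q) \<partial>?N) \<le> ennreal ((9 / 10) ^ n)" .
  qed
  also have "\<dots> = ennreal ((9 / 10) ^ n)" by (simp add: PA.emeasure_space_1)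
  finally show ?thesis unfolding h_def F_def .
qed

text \<open>Point by point on the base space, success of the learner carries over to the
  distinguisher unless the residuals are large. Since each \<open>\<xi>\<close> has second moment 1,
  Markov's inequality bounds the exception by \<open>6000 * s\<^sup>2\<close>.\<close>

lemma planted_bound:
  fixes \<nu> :: "(nat \<Rightarrow> real) measure"
  assumes \<nu>: "prob_space \<nu>" "\<nu> = mv_normal d \<Sigma>" and \<phi>: "\<phi> \<in> \<nu> \<Otimes>\<^sub>M std_normal \<rightarrow>\<^sub>M B"
    and \<mu>: "\<mu> = distr (\<nu> \<Otimes>\<^sub>M std_normal) B \<phi>"
    and sr: "s\<^sup>2 + r\<^sup>2 = 1" and n: "0 < n"
    and G: "G \<in> sets (negspca_space n \<mu>)" and H: "H \<in> sets (slr_space n d 1 \<Sigma>)"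
    and imp: "\<And>S \<omega>. to_slr n s r S \<omega> \<in> H \<Longrightarrow> 6000 * s\<^sup>2 * (\<Sum>i<n. (fst (snd (S i)))\<^sup>2) < real n \<Longrightarrow>
       to_negspca n \<phi> S \<omega> \<in> space (negspca_space n \<mu>) \<Longrightarrow> to_negspca n \<phi> S \<omega> \<in> G"
  shows "emeasure (slr_space n d 1 \<Sigma>) H \<le> emeasure (negspca_space n \<mu>) G + ennreal (6000 * s\<^sup>2)"
proof -
  interpret T: prob_space random_tape by (rule prob_space_random_tape)
  interpret Bs: prob_space "base_space n \<nu>" by (intro prob_space_PiM prob_space_base \<nu>(1))
  \<comment> \<open>Markov's inequality inside the integral: \<open>?b S\<close> is at least 1 on
    the exceptional event and has integral \<open>6000 * s\<^sup>2\<close>.\<close>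
  let ?b = "\<lambda>S. \<Sum>i<n. ennreal (6000 * s\<^sup>2 / real n) * ennreal ((fst (snd (S i)))\<^sup>2)"
  have c[measurable]: "(\<lambda>S. fst (snd (S i))) \<in> borel_measurable (base_space n \<nu>)" if "i < n" for i
  proof -
    have "(\<lambda>S. S i) \<in> base_space n \<nu> \<rightarrow>\<^sub>M \<nu> \<Otimes>\<^sub>M (std_normal \<Otimes>\<^sub>M std_normal)"
      using that by (simp add: measurable_component_singleton)
    from measurable_compose[OF this, of "\<lambda>x. fst (snd x)" borel] show ?thesis by simp
  qed
  have Gm: "(\<lambda>x. indicator G (to_negspca n \<phi> (fst x) (snd x)) :: ennreal) \<in> borel_measurable (base_space n \<nu> \<Otimes>\<^sub>M random_tape)"
    using G by (intro measurable_compose[OF measurable_to_negspca[OF \<nu>(1) \<phi> \<mu>]]) simp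
  have "emeasure (slr_space n d 1 \<Sigma>) H = (\<integral>\<^sup>+x. indicator H x \<partial>slr_space n d 1 \<Sigma>)"
    using H by simp
  also have "\<dots> = (\<integral>\<^sup>+S. \<integral>\<^sup>+\<omega>. indicator H (to_slr n s r S \<omega>) \<partial>random_tape \<partial>base_space n \<nu>)"
    using \<nu> sr H unfolding \<nu>(2) by (intro nn_integral_slr_space) auto
  also have "\<dots> \<le> (\<integral>\<^sup>+S. \<integral>\<^sup>+\<omega>. (indicator G (to_negspca n \<phi> S \<omega>) + ?b S) \<partial>random_tape \<partial>base_space n \<nu>)"
  proof (intro nn_integral_mono)
    fix S \<omega> assume S: "S \<in> space (base_space n \<nu>)" "\<omega> \<in> space random_tape"
    have sp: "to_negspca n \<phi> S \<omega> \<in> space (negspca_space n \<mu>)"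
      using measurable_space[OF measurable_to_negspca[OF \<nu>(1) \<phi> \<mu>], of "(S, \<omega>)" n] S
      by (simp add: space_pair_measure)
    show "indicator H (to_slr n s r S \<omega>) \<le> (indicator G (to_negspca n \<phi> S \<omega>) + ?b S :: ennreal)"
    proof (cases "6000 * s\<^sup>2 * (\<Sum>i<n. (fst (snd (S i)))\<^sup>2) < real n")
      case True
      then have "indicator H (to_slr n s r S \<omega>) \<le> (indicator G (to_negspca n \<phi> S \<omega>) :: ennreal)"
        using imp[of S \<omega>] sp by (auto simp: indicator_def)
      then show ?thesis by (rule add_increasing2[rotated]) simp
    next
      case False
      have "?b S = ennreal (6000 * s\<^sup>2 / real n * (\<Sum>i<n. (fst (snd (S i)))\<^sup>2))"
        by (simp add: ennreal_mult'[symmetric] sum_distrib_left sum_nonneg)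
      moreover have "1 \<le> 6000 * s\<^sup>2 / real n * (\<Sum>i<n. (fst (snd (S i)))\<^sup>2)"
        using False n by (simp add: field_simps)
      ultimately have "1 \<le> ?b S" by (simp add: ennreal_1[symmetric] del: ennreal_1)
      then have "indicator H (to_slr n s r S \<omega>) \<le> ?b S"
        by (rule order_trans[rotated]) (simp add: indicator_def)
      then show ?thesis by (rule add_increasing[rotated]) simp
    qed
  qed
  also have "\<dots> = (\<integral>\<^sup>+S. (\<integral>\<^sup>+\<omega>. indicator G (to_negspca n \<phi> S \<omega>) \<partial>random_tape) + ?b S \<partial>base_space n \<nu>)"
  proof (rule nn_integral_cong)
    fix S assume "S \<in> space (base_space n \<nu>)"
    then have "(\<lambda>\<omega>. indicator G (to_negspca n \<phi> S \<omega>) :: ennreal) \<in> borel_measurable random_tape"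
      using measurable_compose[OF measurable_Pair1' Gm] by simp
    then show "(\<integral>\<^sup>+\<omega>. (indicator G (to_negspca n \<phi> S \<omega>) + ?b S) \<partial>random_tape) =
       (\<integral>\<^sup>+\<omega>. indicator G (to_negspca n \<phi> S \<omega>) \<partial>random_tape) + ?b S"
      by (subst nn_integral_add) (auto simp: T.emeasure_space_1)
  qed
  also have "\<dots> = (\<integral>\<^sup>+S. \<integral>\<^sup>+\<omega>. indicator G (to_negspca n \<phi> S \<omega>) \<partial>random_tape \<partial>base_space n \<nu>) + (\<integral>\<^sup>+S. ?b S \<partial>base_space n \<nu>)"
    using Gm by (intro nn_integral_add T.borel_measurable_nn_integral) (auto simp: split_beta')
  also have "(\<integral>\<^sup>+S. ?b S \<partial>base_space n \<nu>) = (\<Sum>i<n. ennreal (6000 * s\<^sup>2 / real n))"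
    by (subst nn_integral_sum) (auto simp: nn_integral_cmult nn_integral_base_square[OF \<nu>(1)])
  also have "\<dots> = ennreal (6000 * s\<^sup>2)"
    using n by (simp add: ennreal_of_nat_eq_real_of_nat ennreal_mult'[symmetric])
  also have "(\<integral>\<^sup>+S. \<integral>\<^sup>+\<omega>. indicator G (to_negspca n \<phi> S \<omega>) \<partial>random_tape \<partial>base_space n \<nu>) = (\<integral>\<^sup>+x. indicator G x \<partial>negspca_space n \<mu>)"
    using G by (intro nn_integral_negspca_space[OF \<nu>(1) \<phi> \<mu>, symmetric]) simp
  finally show ?thesis using G by simp
qed

section \<open>Locality and measurability of programs\<close>

primrec nexp_below :: "nat \<Rightarrow> nexp \<Rightarrow> bool" where
  "nexp_below N (NConst c) = True"
| "nexp_below N (NVar v) = (v < N)"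
| "nexp_below N (NAdd e f) = (nexp_below N e \<and> nexp_below N f)"
| "nexp_below N (NSub e f) = (nexp_below N e \<and> nexp_below N f)"

primrec rexp_below :: "nat \<Rightarrow> rexp \<Rightarrow> bool" where
  "rexp_below N (RNat e) = nexp_below N e"
| "rexp_below N (RCell a e f) = (a < N \<and> nexp_below N e \<and> nexp_below N f)"
| "rexp_below N (RAdd p q) = (rexp_below N p \<and> rexp_below N q)"
| "rexp_below N (RSub p q) = (rexp_below N p \<and> rexp_below N q)"
| "rexp_below N (RMul p q) = (rexp_below N p \<and> rexp_below N q)"
| "rexp_below N (RDiv p q) = (rexp_below N p \<and> rexp_below N q)"

primrec bexp_below :: "nat \<Rightarrow> bexp \<Rightarrow> bool" where
  "bexp_below N (NLess e f) = (nexp_below N e \<and> nexp_below N f)"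
| "bexp_below N (RLess p q) = (rexp_below N p \<and> rexp_below N q)"

primrec com_below :: "nat \<Rightarrow> com \<Rightarrow> bool" where
  "com_below N Skip = True"
| "com_below N (NAssign v e) = (v < N \<and> nexp_below N e)"
| "com_below N (RAssign a e f p) = (a < N \<and> nexp_below N e \<and> nexp_below N f \<and> rexp_below N p)"
| "com_below N (Gauss a e f) = (a < N \<and> nexp_below N e \<and> nexp_below N f)"
| "com_below N (Seq c1 c2) = (com_below N c1 \<and> com_below N c2)"
| "com_below N (If b c1 c2) = (bexp_below N b \<and> com_below N c1 \<and> com_below N c2)"
| "com_below N (While b c) = (bexp_below N b \<and> com_below N c)"

text \<open>A program mentions finitely many names. Saying so with an eventual quantifier combines
  the bounds for subterms without maxima.\<close>

lemma eventually_nexp_below: "\<forall>\<^sub>F N in sequentially. nexp_below N e"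
  by (induction e) (auto intro: eventually_conj simp: eventually_gt_at_top)

lemma eventually_rexp_below: "\<forall>\<^sub>F N in sequentially. rexp_below N p"
  by (induction p) (auto intro!: eventually_conj eventually_nexp_below simp: eventually_gt_at_top)

lemma eventually_bexp_below: "\<forall>\<^sub>F N in sequentially. bexp_below N b"
  by (induction b) (auto intro!: eventually_conj eventually_nexp_below eventually_rexp_below)

lemma eventually_com_below: "\<forall>\<^sub>F N in sequentially. com_below N c"
  by (induction c) (auto intro!: eventually_conj eventually_nexp_below eventually_rexp_below
      eventually_bexp_below simp: eventually_gt_at_top)

text \<open>The first state belongs to a run inside the distinguisher, which has already consumed
  \<open>p\<close> tape entries; the second belongs to a stand-alone run on the tape shifted by
  \<open>p\<close>.\<close>

definition agree :: "nat \<Rightarrow> nat \<Rightarrow> ram_state \<Rightarrow> ram_state \<Rightarrow> bool" where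
  "agree N p s s' \<longleftrightarrow> (\<forall>v<N. counter s v = counter s' v) \<and> (\<forall>a<N. arr s a = arr s' a) \<and>
     tape_pos s = tape_pos s' + p"

definition same_above :: "nat \<Rightarrow> ram_state \<Rightarrow> ram_state \<Rightarrow> bool" where
  "same_above N s s' \<longleftrightarrow> (\<forall>v\<ge>N. counter s' v = counter s v) \<and> (\<forall>a\<ge>N. arr s' a = arr s a)"

lemma same_above_refl: "same_above N s s"
  by (simp add: same_above_def)

lemma same_above_trans: "same_above N s s' \<Longrightarrow> same_above N s' s'' \<Longrightarrow> same_above N s s''"
  by (simp add: same_above_def)

lemma nval_agree: "agree N p s s' \<Longrightarrow> nexp_below N e \<Longrightarrow> nval e s = nval e s'"
  by (induction e) (auto simp: agree_def)

lemma rval_agree: "agree N p s s' \<Longrightarrow> rexp_below N q \<Longrightarrow> rval q s = rval q s'"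
  by (induction q) (auto simp: nval_agree, simp_all add: agree_def)

lemma bval_agree: "agree N p s s' \<Longrightarrow> bexp_below N b \<Longrightarrow> bval b s = bval b s'"
  by (cases b) (auto simp: nval_agree rval_agree)

lemma exec_simps:
  "exec \<omega> Skip s t s' \<longleftrightarrow> t = 1 \<and> s' = s"
  "exec \<omega> (NAssign v e) s t s' \<longleftrightarrow> t = 1 \<and> s' = s\<lparr>counter := (counter s)(v := nval e s)\<rparr>"
  "exec \<omega> (RAssign a e f p) s t s' \<longleftrightarrow> t = 1 \<and> s' = set_cell a (nval e s) (nval f s) (rval p s) s"
  "exec \<omega> (Gauss a e f) s t s' \<longleftrightarrow> t = 1 \<and> s' =
     set_cell a (nval e s) (nval f s) (\<omega> (tape_pos s)) (s\<lparr>tape_pos := Suc (tape_pos s)\<rparr>)"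
  "exec \<omega> (Seq c1 c2) s t s' \<longleftrightarrow> (\<exists>t1 s1 t2. t = t1 + t2 \<and> exec \<omega> c1 s t1 s1 \<and> exec \<omega> c2 s1 t2 s')"
  "exec \<omega> (If b c1 c2) s t s' \<longleftrightarrow> (\<exists>u. t = Suc u \<and> (if bval b s then exec \<omega> c1 s u s' else exec \<omega> c2 s u s'))"
  by (subst exec.simps; auto)+

lemma exec_While:
  "exec \<omega> (While b c) s t s' \<longleftrightarrow> (if bval b s then
     (\<exists>t1 s1 t2. t = Suc (t1 + t2) \<and> exec \<omega> c s t1 s1 \<and> exec \<omega> (While b c) s1 t2 s') else t = 1 \<and> s' = s)"
  using exec.simps[of \<omega> "While b c" s t s'] by auto

text \<open>Makes the learner usable as a subroutine. A program sees only its own names, so data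
  stored from \<open>N\<close> on neither influence it nor are changed by it; the step counts
  coincide because the two runs stay in lockstep.\<close>

lemma exec_agree:
  assumes "exec (\<lambda>i. \<omega> (i + p)) c s2 t s2'" "com_below N c" "agree N p s s2"
  shows "\<exists>s'. exec \<omega> c s t s' \<and> agree N p s' s2' \<and> same_above N s s'"
  using assms
proof (induction arbitrary: s rule: exec.induct)
  case (Skip s0)
  then show ?case by (auto simp: exec_simps same_above_refl)
next
  case (NAssign v e s0)
  then have "nval e s = nval e s0" by (auto intro: nval_agree)
  with NAssign show ?case
    by (auto simp: exec_simps agree_def same_above_def)
next
  case (RAssign a e f q s0)
  then have "nval e s = nval e s0" "nval f s = nval f s0" "rval q s = rval q s0"
    by (auto intro: nval_agree rval_agree)
  with RAssign show ?case
    by (auto simp: exec_simps agree_def same_above_def set_cell_def)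
next
  case (Gauss a e f s0)
  then have "nval e s = nval e s0" "nval f s = nval f s0"
    by (auto intro: nval_agree)
  with Gauss show ?case
    by (auto simp: exec_simps agree_def same_above_def set_cell_def)
next
  case (Seq c1 s1 t1 s2 c2 t2 s3)
  obtain s' where s': "exec \<omega> c1 s t1 s'" "agree N p s' s2" "same_above N s s'"
    using Seq by auto
  obtain s'' where "exec \<omega> c2 s' t2 s''" "agree N p s'' s3" "same_above N s' s''"
    using Seq s' by auto
  with s' show ?case by (blast intro: exec.Seq same_above_trans)
next
  case (IfTrue b s0 c1 t s0' c2)
  then have "bval b s" by (auto simp: bval_agree)
  with IfTrue show ?case by (auto intro: exec.IfTrue)
next
  case (IfFalse b s0 c2 t s0' c1)
  then have "\<not> bval b s" by (auto simp: bval_agree)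
  with IfFalse show ?case by (auto intro: exec.IfFalse)
next
  case (WhileFalse b s0 c)
  then have "\<not> bval b s" by (auto simp: bval_agree)
  with WhileFalse show ?case by (auto simp: exec_While[of _ _ _ s] intro: same_above_refl)
next
  case (WhileTrue b s1 c t1 s2 t2 s3)
  then have b: "bval b s" by (auto simp: bval_agree)
  obtain s' where s': "exec \<omega> c s t1 s'" "agree N p s' s2" "same_above N s s'"
    using WhileTrue by auto
  obtain s'' where "exec \<omega> (While b c) s' t2 s''" "agree N p s'' s3" "same_above N s' s''"
    using WhileTrue s' by blast
  with s' b show ?case by (blast intro: exec.WhileTrue same_above_trans)
qed

section \<open>Measurability of halting events\<close>

text \<open>Arrays are uncurried, so that a configuration is a countable family of coordinates with
  the product sigma-algebra, pulled back because states are records.\<close>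

definition conf_space :: "(ram_state \<times> (nat \<Rightarrow> real)) measure" where
  "conf_space = vimage_algebra UNIV (\<lambda>(s, \<omega>). (counter s, (\<lambda>(a, i, j). arr s a i j), tape_pos s, \<omega>))
     (PiM UNIV (\<lambda>_. count_space UNIV) \<Otimes>\<^sub>M PiM UNIV (\<lambda>_. borel) \<Otimes>\<^sub>M count_space UNIV \<Otimes>\<^sub>M PiM UNIV (\<lambda>_. borel))"

lemma space_conf_space [simp]: "space conf_space = UNIV"
  by (simp add: conf_space_def)

lemma measurable_into_conf_space:
  assumes "\<And>v. (\<lambda>x. counter (f x) v) \<in> M \<rightarrow>\<^sub>M count_space UNIV"
    and "\<And>a i j. (\<lambda>x. arr (f x) a i j) \<in> borel_measurable M"
    and "(\<lambda>x. tape_pos (f x)) \<in> M \<rightarrow>\<^sub>M count_space UNIV"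
    and "\<And>i. (\<lambda>x. g x i) \<in> borel_measurable M"
  shows "(\<lambda>x. (f x, g x)) \<in> M \<rightarrow>\<^sub>M conf_space"
  unfolding conf_space_def
proof (rule measurable_vimage_algebra2)
  have "(\<lambda>x. counter (f x)) \<in> M \<rightarrow>\<^sub>M PiM UNIV (\<lambda>_. count_space UNIV)"
    using assms(1) by (intro measurable_PiM_single') (auto simp: PiE_iff)
  moreover have "(\<lambda>x (a, i, j). arr (f x) a i j) \<in> M \<rightarrow>\<^sub>M PiM UNIV (\<lambda>_. borel)"
    using assms(2) by (intro measurable_PiM_single') (auto simp: PiE_iff split_beta)
  moreover have "g \<in> M \<rightarrow>\<^sub>M PiM UNIV (\<lambda>_. borel)"
    using assms(4) by (intro measurable_PiM_single') (auto simp: PiE_iff)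
  ultimately show "(\<lambda>x. case (f x, g x) of (s, \<omega>) \<Rightarrow> (counter s, (\<lambda>(a, i, j). arr s a i j), tape_pos s, \<omega>))
    \<in> M \<rightarrow>\<^sub>M PiM UNIV (\<lambda>_. count_space UNIV) \<Otimes>\<^sub>M PiM UNIV (\<lambda>_. borel) \<Otimes>\<^sub>M count_space UNIV \<Otimes>\<^sub>M PiM UNIV (\<lambda>_. borel)"
    using assms(3) by simp
qed simp

lemma
  shows measurable_conf_counter: "(\<lambda>x. counter (fst x) v) \<in> conf_space \<rightarrow>\<^sub>M count_space UNIV"
    and measurable_conf_arr: "(\<lambda>x. arr (fst x) a i j) \<in> borel_measurable conf_space"
    and measurable_conf_tape_pos: "(\<lambda>x. tape_pos (fst x)) \<in> conf_space \<rightarrow>\<^sub>M count_space UNIV"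
    and measurable_conf_tape: "(\<lambda>x. snd x i) \<in> borel_measurable conf_space"
proof -
  let ?T = "PiM UNIV (\<lambda>_. count_space UNIV) \<Otimes>\<^sub>M PiM UNIV (\<lambda>_. borel) \<Otimes>\<^sub>M count_space UNIV \<Otimes>\<^sub>M PiM UNIV (\<lambda>_. borel)
    :: ((nat \<Rightarrow> nat) \<times> (nat \<times> nat \<times> nat \<Rightarrow> real) \<times> nat \<times> (nat \<Rightarrow> real)) measure"
  have e: "(\<lambda>(s, \<omega>). (counter s, (\<lambda>(a, i, j). arr s a i j), tape_pos s, \<omega>)) \<in> conf_space \<rightarrow>\<^sub>M ?T"
    unfolding conf_space_def
    by (rule measurable_vimage_algebra1) (auto simp: space_pair_measure space_PiM)
  have "(\<lambda>y. fst y v) \<in> ?T \<rightarrow>\<^sub>M count_space UNIV"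
    by (intro measurable_compose[OF measurable_fst] measurable_component_singleton) simp
  from measurable_compose[OF e this]
  show "(\<lambda>x. counter (fst x) v) \<in> conf_space \<rightarrow>\<^sub>M count_space UNIV" by (simp add: split_beta')
  have "(\<lambda>y. fst (snd y) (a, i, j)) \<in> borel_measurable ?T"
    by (intro measurable_compose[OF measurable_snd] measurable_compose[OF measurable_fst] measurable_component_singleton) simp
  from measurable_compose[OF e this]
  show "(\<lambda>x. arr (fst x) a i j) \<in> borel_measurable conf_space" by (simp add: split_beta')
  have "(\<lambda>y. fst (snd (snd y))) \<in> ?T \<rightarrow>\<^sub>M count_space UNIV" by measurable
  from measurable_compose[OF e this]
  show "(\<lambda>x. tape_pos (fst x)) \<in> conf_space \<rightarrow>\<^sub>M count_space UNIV" by (simp add: split_beta')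
  have "(\<lambda>y. snd (snd (snd y)) i) \<in> borel_measurable ?T"
    by (intro measurable_compose[OF measurable_snd] measurable_component_singleton) simp
  from measurable_compose[OF e this]
  show "(\<lambda>x. snd x i) \<in> borel_measurable conf_space" by (simp add: split_beta')
qed

lemmas measurable_conf [measurable] =
  measurable_conf_counter measurable_conf_arr measurable_conf_tape_pos measurable_conf_tape

text \<open>Handles indirect addressing: a data-dependent subscript takes countably many values, so
  measurability for each fixed subscript suffices.\<close>

lemma measurable_nat_indexed:
  fixes g :: "'a \<Rightarrow> nat"
  assumes "\<And>n. (\<lambda>x. f n x) \<in> M \<rightarrow>\<^sub>M N" "g \<in> M \<rightarrow>\<^sub>M count_space UNIV"
  shows "(\<lambda>x. f (g x) x) \<in> M \<rightarrow>\<^sub>M N"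
  using assms by (rule measurable_compose_countable)

lemma measurable_nval [measurable]: "(\<lambda>x. nval e (fst x)) \<in> conf_space \<rightarrow>\<^sub>M count_space UNIV"
proof (induction e)
  case (NAdd e f)
  have "(\<lambda>x. m + nval f (fst x)) \<in> conf_space \<rightarrow>\<^sub>M count_space UNIV" for m
    by (rule measurable_compose[OF NAdd(2)]) simp
  from measurable_nat_indexed[OF this NAdd(1)] show ?case by simp
next
  case (NSub e f)
  have "(\<lambda>x. m - nval f (fst x)) \<in> conf_space \<rightarrow>\<^sub>M count_space UNIV" for m
    by (rule measurable_compose[OF NSub(2)]) simp
  from measurable_nat_indexed[OF this NSub(1)] show ?case by simp
qed simp_all

lemma measurable_rval [measurable]: "(\<lambda>x. rval q (fst x)) \<in> borel_measurable conf_space"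
proof (induction q)
  case (RNat e)
  show ?case using measurable_compose[OF measurable_nval[of e], of real borel] by simp
next
  case (RCell a e f)
  have "(\<lambda>x. arr (fst x) a i (nval f (fst x))) \<in> borel_measurable conf_space" for i
    by (rule measurable_nat_indexed[OF measurable_conf_arr measurable_nval])
  from measurable_nat_indexed[OF this measurable_nval[of e]] show ?case by simp
qed simp_all

lemma measurable_bval [measurable]: "Measurable.pred conf_space (\<lambda>x. bval b (fst x))"
proof (cases b)
  case (NLess e f)
  have "Measurable.pred conf_space (\<lambda>x. m < nval f (fst x))" for m
    by (rule measurable_compose[OF measurable_nval]) simp
  from measurable_nat_indexed[OF this measurable_nval[of e]] show ?thesis using NLess by simp
qed simp

lemma measurable_set_cell:
  assumes r[measurable]: "r \<in> borel_measurable conf_space"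
  shows "(\<lambda>x. (set_cell a (nval e (fst x)) (nval f (fst x)) (r x) (fst x), snd x)) \<in> conf_space \<rightarrow>\<^sub>M conf_space"
proof (rule measurable_into_conf_space)
  fix a' i j
  have "(\<lambda>x. if a' = a \<and> i = nval e (fst x) \<and> j = nval f (fst x) then r x else arr (fst x) a' i j)
    \<in> borel_measurable conf_space"
    by measurable
  moreover have "arr (set_cell a (nval e (fst x)) (nval f (fst x)) (r x) (fst x)) a' i j
     = (if a' = a \<and> i = nval e (fst x) \<and> j = nval f (fst x) then r x else arr (fst x) a' i j)" for x
    by (auto simp: set_cell_def)
  ultimately show "(\<lambda>x. arr (set_cell a (nval e (fst x)) (nval f (fst x)) (r x) (fst x)) a' i j)
    \<in> borel_measurable conf_space" by simp
qed (simp_all add: set_cell_def)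

text \<open>A predecessor set with an exact step count: the count makes the recursion for loops
  well-founded, and halting becomes a countable union over \<open>t\<close>.\<close>

definition wp :: "com \<Rightarrow> nat \<Rightarrow> (ram_state \<times> (nat \<Rightarrow> real)) set \<Rightarrow> (ram_state \<times> (nat \<Rightarrow> real)) set" where
  "wp c t X = {x. \<exists>s'. exec (snd x) c (fst x) t s' \<and> (s', snd x) \<in> X}"

lemma sets_conf_space_vimage:
  "f \<in> conf_space \<rightarrow>\<^sub>M conf_space \<Longrightarrow> X \<in> sets conf_space \<Longrightarrow> {x. f x \<in> X} \<in> sets conf_space"
  using measurable_sets[of f conf_space conf_space X] by (simp add: vimage_def)

lemma sets_bval: "{x. bval b (fst x)} \<in> sets conf_space"
  using measurable_bval[of b] by (simp add: pred_def)

text \<open>With \<open>t\<close> fixed, composition is a finite union over the ways to split the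
  steps, and a loop unfolds into itself with strictly fewer steps, since the test alone costs one.
  Hence the inner induction on \<open>t\<close>.\<close>

lemma sets_wp: "X \<in> sets conf_space \<Longrightarrow> wp c t X \<in> sets conf_space"
proof (induction c arbitrary: t X)
  case Skip
  then show ?case by (cases "t = 1") (simp_all add: wp_def exec_simps)
next
  case (NAssign v e)
  have m: "(\<lambda>x. ((fst x)\<lparr>counter := (counter (fst x))(v := nval e (fst x))\<rparr>, snd x)) \<in> conf_space \<rightarrow>\<^sub>M conf_space"
    by (rule measurable_into_conf_space) (auto simp: fun_upd_def)
  show ?case using sets_conf_space_vimage[OF m NAssign]
    by (cases "t = 1") (simp_all add: wp_def exec_simps)
next
  case (RAssign a e f p)
  have m: "(\<lambda>x. (set_cell a (nval e (fst x)) (nval f (fst x)) (rval p (fst x)) (fst x), snd x)) \<in> conf_space \<rightarrow>\<^sub>M conf_space"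
    by (rule measurable_set_cell) simp
  show ?case using sets_conf_space_vimage[OF m RAssign]
    by (cases "t = 1") (simp_all add: wp_def exec_simps)
next
  case (Gauss a e f)
  have r: "(\<lambda>x. snd x (tape_pos (fst x))) \<in> borel_measurable conf_space"
    by (rule measurable_nat_indexed[OF measurable_conf_tape measurable_conf_tape_pos])
  have tp: "(\<lambda>x. ((fst x)\<lparr>tape_pos := Suc (tape_pos (fst x))\<rparr>, snd x)) \<in> conf_space \<rightarrow>\<^sub>M conf_space"
    by (rule measurable_into_conf_space) auto
  \<comment> \<open>Writing the cell and advancing the tape commute. In this order the update is a
    composition of two measurable maps, and the tape is read at the old position.\<close>
  have e: "set_cell a i j y (s\<lparr>tape_pos := Suc (tape_pos s)\<rparr>) = (set_cell a i j y s)\<lparr>tape_pos := Suc (tape_pos (set_cell a i j y s))\<rparr>" for i j y s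
    by (simp add: set_cell_def)
  note m = measurable_compose[OF measurable_set_cell[OF r] tp]
  show ?case using sets_conf_space_vimage[OF m[of a e f] Gauss]
    by (cases "t = 1") (simp_all add: wp_def exec_simps e)
next
  case (Seq c1 c2)
  have "wp (Seq c1 c2) t X = (\<Union>t1\<in>{..t}. wp c1 t1 (wp c2 (t - t1) X))"
    
  proof (intro set_eqI iffI)
    fix x assume "x \<in> wp (Seq c1 c2) t X"
    then obtain t1 s1 t2 s' where "t = t1 + t2" "exec (snd x) c1 (fst x) t1 s1" "exec (snd x) c2 s1 t2 s'" "(s', snd x) \<in> X"
      by (auto simp: wp_def exec_simps)
    then show "x \<in> (\<Union>t1\<in>{..t}. wp c1 t1 (wp c2 (t - t1) X))"
      by (intro UN_I[of t1]) (auto simp: wp_def)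
  next
    fix x assume "x \<in> (\<Union>t1\<in>{..t}. wp c1 t1 (wp c2 (t - t1) X))"
    then show "x \<in> wp (Seq c1 c2) t X"
      by (auto simp: wp_def exec_simps) (metis le_add_diff_inverse)
  qed
  also have "\<dots> \<in> sets conf_space"
    by (intro sets.finite_UN Seq) auto
  finally show ?case .
next
  case (If b c1 c2)
  show ?case
  proof (cases t)
    case 0
    then show ?thesis by (simp add: wp_def exec_simps)
  next
    case (Suc u)
    have "wp (If b c1 c2) t X = {x. bval b (fst x)} \<inter> wp c1 u X \<union> wp c2 u X \<inter> (space conf_space - {x. bval b (fst x)})"
      by (auto simp: wp_def exec_simps Suc)
    also have "\<dots> \<in> sets conf_space"
      using If sets_bval by blast
    finally show ?thesis .
  qed
next
  case (While b c)
  show ?case using While.prems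
  proof (induction t arbitrary: X rule: less_induct)
    case (less t)
    \<comment> \<open>The test takes one step, and \<open>t1 < t\<close> keeps
      \<open>t - 1 - t1\<close> from being truncated.\<close>
    have "wp (While b c) t X = {x. bval b (fst x)} \<inter> (\<Union>t1\<in>{..<t}. wp c t1 (wp (While b c) (t - 1 - t1) X))
       \<union> (if t = 1 then X - {x. bval b (fst x)} else {})"
      (is "?L = ?R")
    proof (intro set_eqI iffI)
      fix x assume "x \<in> ?L"
      then obtain s' where s': "exec (snd x) (While b c) (fst x) t s'" "(s', snd x) \<in> X"
        by (auto simp: wp_def)
      show "x \<in> ?R"
      proof (cases "bval b (fst x)")
        case True
        then obtain t1 s1 t2 where "t = Suc (t1 + t2)" "exec (snd x) c (fst x) t1 s1" "exec (snd x) (While b c) s1 t2 s'"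
          using s'(1) by (subst (asm) exec_While) auto
        with True s'(2) show ?thesis
          by (intro UnI1 IntI UN_I[of t1]) (auto simp: wp_def)
      next
        case False
        then show ?thesis using s' by (subst (asm) exec_While) auto
      qed
    next
      fix x assume "x \<in> ?R"
      then consider "t = 1" "x \<in> X" "\<not> bval b (fst x)"
        | t1 s1 s' where "t1 < t" "bval b (fst x)" "exec (snd x) c (fst x) t1 s1"
           "exec (snd x) (While b c) s1 (t - 1 - t1) s'" "(s', snd x) \<in> X"
        by (auto simp: wp_def split: if_splits)
      then show "x \<in> ?L"
      proof cases
        case 1
        then show ?thesis by (auto simp: wp_def exec_While intro!: exI[of _ "fst x"])
      next
        case 2
        have "exec (snd x) (While b c) (fst x) (Suc (t1 + (t - 1 - t1))) s'"
          by (rule exec.WhileTrue[OF 2(2,3,4)])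
        moreover have "Suc (t1 + (t - 1 - t1)) = t" using 2(1) by simp
        ultimately show ?thesis using 2(5) by (auto simp: wp_def)
      qed
    qed
    also have "\<dots> \<in> sets conf_space"
      by (intro sets.Un sets.Int sets_bval sets.finite_UN While.IH less.IH)
        (use less.prems sets_bval in auto)
    finally show ?case .
  qed
qed

section \<open>The distinguisher\<close>

definition runs_to :: "(nat \<Rightarrow> real) \<Rightarrow> com \<Rightarrow> ram_state \<Rightarrow> nat \<Rightarrow> (ram_state \<Rightarrow> bool) \<Rightarrow> bool" where
  "runs_to \<omega> c s \<tau> Q \<longleftrightarrow> (\<exists>t s'. exec \<omega> c s t s' \<and> t \<le> \<tau> \<and> Q s')"

lemma runs_to_Seq:
  "runs_to \<omega> c1 s \<tau>1 R \<Longrightarrow> (\<And>s'. R s' \<Longrightarrow> runs_to \<omega> c2 s' \<tau>2 Q) \<Longrightarrow> runs_to \<omega> (Seq c1 c2) s (\<tau>1 + \<tau>2) Q"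
  unfolding runs_to_def by (meson add_mono exec.Seq)

lemma runs_to_mono: "runs_to \<omega> c s \<tau> Q \<Longrightarrow> \<tau> \<le> \<tau>' \<Longrightarrow> (\<And>s'. Q s' \<Longrightarrow> Q' s') \<Longrightarrow> runs_to \<omega> c s \<tau>' Q'"
  unfolding runs_to_def by (meson le_trans)

lemma runs_to_NAssign: "Q (s\<lparr>counter := (counter s)(v := nval e s)\<rparr>) \<Longrightarrow> runs_to \<omega> (NAssign v e) s 1 Q"
  by (auto simp: runs_to_def exec_simps)

lemma runs_to_RAssign: "Q (set_cell a (nval e s) (nval f s) (rval p s) s) \<Longrightarrow> runs_to \<omega> (RAssign a e f p) s 1 Q"
  by (auto simp: runs_to_def exec_simps)

lemma runs_to_Gauss:
  "Q (set_cell a (nval e s) (nval f s) (\<omega> (tape_pos s)) (s\<lparr>tape_pos := Suc (tape_pos s)\<rparr>)) \<Longrightarrow> runs_to \<omega> (Gauss a e f) s 1 Q"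
  by (auto simp: runs_to_def exec_simps)

lemma runs_to_Seq_NAssign:
  "runs_to \<omega> c (s\<lparr>counter := (counter s)(v := nval e s)\<rparr>) \<tau> Q \<Longrightarrow> runs_to \<omega> (Seq (NAssign v e) c) s (1 + \<tau>) Q"
  by (rule runs_to_Seq[OF runs_to_NAssign[where Q="\<lambda>s'. s' = s\<lparr>counter := (counter s)(v := nval e s)\<rparr>"]]) simp_all

lemma runs_to_Seq_RAssign:
  "runs_to \<omega> c (set_cell a (nval e s) (nval f s) (rval p s) s) \<tau> Q \<Longrightarrow> runs_to \<omega> (Seq (RAssign a e f p) c) s (1 + \<tau>) Q"
  by (rule runs_to_Seq[OF runs_to_RAssign[where Q="\<lambda>s'. s' = set_cell a (nval e s) (nval f s) (rval p s) s"]]) simp_all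

lemma runs_to_If:
  assumes "bval b s \<Longrightarrow> runs_to \<omega> c1 s \<tau> Q" "\<not> bval b s \<Longrightarrow> runs_to \<omega> c2 s \<tau> Q"
  shows "runs_to \<omega> (If b c1 c2) s (Suc \<tau>) Q"
  using assms unfolding runs_to_def by (meson Suc_le_mono exec.IfTrue exec.IfFalse)

definition for_up :: "nat \<Rightarrow> nexp \<Rightarrow> com \<Rightarrow> com" where
  "for_up i e c = Seq (NAssign i (NConst 0))
     (While (NLess (NVar i) e) (Seq c (NAssign i (NAdd (NVar i) (NConst 1)))))"

text \<open>\<open>P m\<close> describes the state in which the loop variable has just been set to
  \<open>m\<close>. A round costs the body, the increment and a test; the final 2 are the
  initialization and the failing test.\<close>

lemma runs_to_for_up:
  assumes init: "P 0 (s\<lparr>counter := (counter s)(i := 0)\<rparr>)"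
    and bound: "\<And>m s. P m s \<Longrightarrow> nval e s = M"
    and body: "\<And>m s. m < M \<Longrightarrow> P m s \<Longrightarrow> counter s i = m \<Longrightarrow>
      runs_to \<omega> c s \<tau> (\<lambda>s'. counter s' i = m \<and> P (Suc m) (s'\<lparr>counter := (counter s')(i := Suc m)\<rparr>))"
  shows "runs_to \<omega> (for_up i e c) s (M * (\<tau> + 2) + 2) (P M)"
proof -
  let ?w = "While (NLess (NVar i) e) (Seq c (NAssign i (NAdd (NVar i) (NConst 1))))"
  have loop: "runs_to \<omega> ?w s (r * (\<tau> + 2) + 1) (P M)"
    if "P m s" "counter s i = m" "m + r = M" for m r s
    using that
  proof (induction r arbitrary: m s)
    case 0
    then have "\<not> bval (NLess (NVar i) e) s" using bound by simp
    then have "exec \<omega> ?w s 1 s" by (rule exec.WhileFalse)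
    with 0 show ?case unfolding runs_to_def by auto
  next
    case (Suc r)
    then have b: "bval (NLess (NVar i) e) s" using bound by simp
    obtain t1 s1 where s1: "exec \<omega> c s t1 s1" "t1 \<le> \<tau>" "counter s1 i = m"
      "P (Suc m) (s1\<lparr>counter := (counter s1)(i := Suc m)\<rparr>)"
      using body[of m s] Suc.prems unfolding runs_to_def by auto
    let ?s2 = "s1\<lparr>counter := (counter s1)(i := Suc m)\<rparr>"
    have "exec \<omega> (NAssign i (NAdd (NVar i) (NConst 1))) s1 1 ?s2"
      using s1(3) by (simp add: exec_simps)
    then have e1: "exec \<omega> (Seq c (NAssign i (NAdd (NVar i) (NConst 1)))) s (t1 + 1) ?s2"
      by (rule exec.Seq[OF s1(1)])
    obtain t3 s3 where s3: "exec \<omega> ?w ?s2 t3 s3" "t3 \<le> r * (\<tau> + 2) + 1" "P M s3"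
      using Suc.IH[of "Suc m" ?s2] s1(4) Suc.prems(3) unfolding runs_to_def by auto
    have "exec \<omega> ?w s (Suc ((t1 + 1) + t3)) s3"
      by (rule exec.WhileTrue[OF b e1 s3(1)])
    moreover have "Suc ((t1 + 1) + t3) \<le> Suc r * (\<tau> + 2) + 1"
      using s1(2) s3(2) by simp
    ultimately show ?case using s3(3) unfolding runs_to_def by blast
  qed
  have "runs_to \<omega> (for_up i e c) s (1 + (M * (\<tau> + 2) + 1)) (P M)"
    unfolding for_up_def
    by (rule runs_to_Seq_NAssign) (simp only: nval.simps, rule loop[OF init], simp_all)
  then show ?thesis by simp
qed

definition noise_factor :: "nat \<Rightarrow> real" where
  "noise_factor n = (real n + 1) / (real n + 2)"

definition noisy_response :: "nat \<Rightarrow> (nat \<Rightarrow> nat \<Rightarrow> real) \<Rightarrow> (nat \<Rightarrow> real) \<Rightarrow> nat \<Rightarrow> real" where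
  "noisy_response n Z \<omega> i = Z i 0 + noise_factor n * \<omega> i"

text \<open>
  Names from \<open>N\<close> on are fresh for the learner: counters \<open>N\<close> and \<open>N + 1\<close> are loop variables,
  \<open>N + 2\<close> and \<open>N + 3\<close> keep \<open>n\<close> and \<open>d\<close>, array \<open>N\<close> keeps the samples, and cells \<open>(0,0)\<close> and
  \<open>(0,1)\<close> of array \<open>N + 1\<close> hold a residual and the sum of squared residuals.
\<close>

definition shift_row :: "nat \<Rightarrow> com" where
  "shift_row N = for_up (N + 1) (NVar 1)
              (Seq (RAssign N (NVar N) (NAdd (NVar (N + 1)) (NConst 1))
                     (RCell 0 (NVar N) (NAdd (NVar (N + 1)) (NConst 1))))
                   (RAssign 0 (NVar N) (NVar (N + 1)) (RCell 0 (NVar N) (NAdd (NVar (N + 1)) (NConst 1)))))"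

text \<open>Coordinate 0 is saved in array \<open>N\<close> before the shift overwrites it, and the
  response cell doubles as scratch space for the fresh normal. The last assignment clears column
  \<open>d\<close>, because the learner's input format has only \<open>d\<close> columns and zeros
  elsewhere.\<close>

definition prepare_sample :: "nat \<Rightarrow> com" where
  "prepare_sample N = Seq (RAssign N (NVar N) (NConst 0) (RCell 0 (NVar N) (NConst 0)))
       (Seq (Gauss 1 (NVar N) (NConst 0))
       (Seq (RAssign 1 (NVar N) (NConst 0)
              (RAdd (RCell 0 (NVar N) (NConst 0))
                (RMul (RDiv (RNat (NAdd (NVar 0) (NConst 1))) (RNat (NAdd (NVar 0) (NConst 2))))
                  (RCell 1 (NVar N) (NConst 0)))))
       (Seq (shift_row N)
         (RAssign 0 (NVar N) (NVar 1) (RNat (NConst 0))))))"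

definition prepare :: "nat \<Rightarrow> com" where
  "prepare N = Seq
     (for_up N (NVar 0)
       (prepare_sample N))
     (Seq (RAssign 2 (NConst 0) (NConst 0) (RNat (NConst 1)))
     (Seq (NAssign (N + 2) (NVar 0)) (NAssign (N + 3) (NVar 1))))"

definition subtract_prediction :: "nat \<Rightarrow> com" where
  "subtract_prediction N = for_up (N + 1) (NVar (N + 3))
              (RAssign (N + 1) (NConst 0) (NConst 0)
                (RSub (RCell (N + 1) (NConst 0) (NConst 0))
                  (RMul (RCell N (NVar N) (NAdd (NVar (N + 1)) (NConst 1)))
                    (RCell 3 (NVar (N + 1)) (NConst 0)))))"

definition add_residual :: "nat \<Rightarrow> com" where
  "add_residual N = Seq (RAssign (N + 1) (NConst 0) (NConst 0) (RCell N (NVar N) (NConst 0)))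
       (Seq (subtract_prediction N)
         (RAssign (N + 1) (NConst 0) (NConst 1)
           (RAdd (RCell (N + 1) (NConst 0) (NConst 1))
             (RMul (RCell (N + 1) (NConst 0) (NConst 0)) (RCell (N + 1) (NConst 0) (NConst 0))))))"

text \<open>The threshold 1/75 for the mean squared residual leaves room above the guaranteed 1/100
  for the planted residual, and lies far below \<open>r\<^sup>2 / (1 + r\<^sup>2)\<close>, about
  1/2, the conditional variance of the first coordinate under the null hypothesis given what the
  learner sees.\<close>

definition test_residual :: "nat \<Rightarrow> com" where
  "test_residual N = Seq
     (for_up N (NVar (N + 2))
       (add_residual N))
     (If (RLess (RMul (RNat (NConst 75)) (RCell (N + 1) (NConst 0) (NConst 1))) (RNat (NVar (N + 2))))
       (NAssign 3 (NConst 1)) (NAssign 3 (NConst 0)))"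

definition distinguisher :: "nat \<Rightarrow> com \<Rightarrow> com" where
  "distinguisher N L = Seq (prepare N) (Seq L (test_residual N))"

lemma set_cell_simp:
  "set_cell a i j r \<lparr>counter = C, arr = A, tape_pos = p\<rparr> = \<lparr>counter = C, arr = A(a := (A a)(i := (A a i)(j := r))), tape_pos = p\<rparr>"
  by (simp add: set_cell_def)

text \<open>The complete state after \<open>m\<close> samples, so that each step is an equation
  between states. The inner loop variable is 0 before the first row and \<open>d\<close> afterwards,
  and \<theta> stays in array 1 until the first response overwrites it.\<close>

definition prep_state :: "nat \<Rightarrow> nat \<Rightarrow> nat \<Rightarrow> nat \<Rightarrow> real \<Rightarrow> (nat \<Rightarrow> nat \<Rightarrow> real) \<Rightarrow> (nat \<Rightarrow> real) \<Rightarrow> nat \<Rightarrow> ram_state" where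
  "prep_state N n d k \<theta> Z \<omega> m = \<lparr>
     counter = (counter_input n d k)(N := m, N + 1 := if m = 0 then 0 else d),
     arr = (\<lambda>a i j.
       if a = 0 then if i < n \<and> j \<le> d then if i < m then if j < d then Z i (Suc j) else 0 else Z i j else 0
       else if a = 1 then if i < m \<and> j = 0 then noisy_response n Z \<omega> i else if i = 0 \<and> j = 0 then \<theta> else 0
       else if a = N then if i < m \<and> j \<le> d then Z i j else 0
       else 0),
     tape_pos = m\<rparr>"

text \<open>The response of row \<open>m\<close> is finished and \<open>l\<close> of its columns are
  shifted. Array \<open>N\<close> is one column ahead, so overwriting column \<open>l\<close>
  destroys only an entry that has been saved.\<close>

definition row_state :: "nat \<Rightarrow> nat \<Rightarrow> nat \<Rightarrow> nat \<Rightarrow> real \<Rightarrow> (nat \<Rightarrow> nat \<Rightarrow> real) \<Rightarrow> (nat \<Rightarrow> real) \<Rightarrow> nat \<Rightarrow> nat \<Rightarrow> ram_state" where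
  "row_state N n d k \<theta> Z \<omega> m l = \<lparr>
     counter = (counter_input n d k)(N := m, N + 1 := l),
     arr = (\<lambda>a i j.
       if a = 0 then if i < n \<and> j \<le> d then if i < m then if j < d then Z i (Suc j) else 0
           else if i = m \<and> j < l then Z i (Suc j) else Z i j else 0
       else if a = 1 then if i \<le> m \<and> j = 0 then noisy_response n Z \<omega> i else if i = 0 \<and> j = 0 then \<theta> else 0
       else if a = N then if i < m \<and> j \<le> d \<or> i = m \<and> j \<le> l then Z i j else 0
       else 0),
     tape_pos = Suc m\<rparr>"

text \<open>The inner loop variable still has the value \<open>l\<close> left by the previous row;
  it is arbitrary because the loop resets it.\<close>

lemma runs_to_prepare_row:
  assumes "4 \<le> N" "m < n"
  shows "runs_to \<omega> (shift_row N)
      ((row_state N n d k \<theta> Z \<omega> m 0)\<lparr>counter := (counter_input n d k)(N := m, N + 1 := l)\<rparr>) (d * 4 + 2)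
      (\<lambda>s. s = row_state N n d k \<theta> Z \<omega> m d)"
  unfolding shift_row_def
proof (rule runs_to_mono[OF runs_to_for_up[where P="\<lambda>l s. l \<le> d \<and> s = row_state N n d k \<theta> Z \<omega> m l" and M=d and \<tau>="1 + 1"]])
  fix l s assume l: "l < d" and s: "l \<le> d \<and> s = row_state N n d k \<theta> Z \<omega> m l"
  show "runs_to \<omega> (Seq (RAssign N (NVar N) (NAdd (NVar (N + 1)) (NConst 1))
             (RCell 0 (NVar N) (NAdd (NVar (N + 1)) (NConst 1))))
           (RAssign 0 (NVar N) (NVar (N + 1)) (RCell 0 (NVar N) (NAdd (NVar (N + 1)) (NConst 1)))))
       s (1 + 1) (\<lambda>s'. counter s' (N + 1) = l \<and> Suc l \<le> d \<and>
        s'\<lparr>counter := (counter s')(N + 1 := Suc l)\<rparr> = row_state N n d k \<theta> Z \<omega> m (Suc l))"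
    apply (rule runs_to_Seq_RAssign)
    apply (rule runs_to_RAssign)
    using assms l s by (simp add: row_state_def set_cell_simp) (auto simp: fun_eq_iff less_Suc_eq)
qed (use assms in \<open>auto simp: row_state_def counter_input_def\<close>)

text \<open>\<open>1 \<le> n\<close> matters: without a first response, \<theta> would remain in the
  array from which the learner reads its responses.\<close>

lemma runs_to_prepare:
  assumes "4 \<le> N" "1 \<le> n"
  shows "runs_to \<omega> (prepare N) (negspca_input n d k \<theta> Z) (n * (d * 4 + 8) + 5)
    (\<lambda>s. agree N n s (slr_input n d k 1 (\<lambda>i j. Z i (Suc j)) (noisy_response n Z \<omega>)) \<and>
      counter s (N + 2) = n \<and> counter s (N + 3) = d \<and>
      (\<forall>i<n. \<forall>j\<le>d. arr s N i j = Z i j) \<and> (\<forall>i j. arr s (N + 1) i j = 0))"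
proof -
  have "runs_to \<omega> (prepare N) (negspca_input n d k \<theta> Z) ((n * ((1 + (1 + (1 + ((d * 4 + 2) + 1)))) + 2) + 2) + (1 + (1 + 1)))
    (\<lambda>s. agree N n s (slr_input n d k 1 (\<lambda>i j. Z i (Suc j)) (noisy_response n Z \<omega>)) \<and>
      counter s (N + 2) = n \<and> counter s (N + 3) = d \<and>
      (\<forall>i<n. \<forall>j\<le>d. arr s N i j = Z i j) \<and> (\<forall>i j. arr s (N + 1) i j = 0))"
    unfolding prepare_def
  proof (rule runs_to_Seq)
    show "runs_to \<omega> (for_up N (NVar 0)
       (prepare_sample N))
       (negspca_input n d k \<theta> Z) (n * ((1 + (1 + (1 + ((d * 4 + 2) + 1)))) + 2) + 2) (\<lambda>s. s = prep_state N n d k \<theta> Z \<omega> n)"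
    proof (rule runs_to_for_up[where P="\<lambda>m s. s = prep_state N n d k \<theta> Z \<omega> m"])
      show "(negspca_input n d k \<theta> Z)\<lparr>counter := (counter (negspca_input n d k \<theta> Z))(N := 0)\<rparr> = prep_state N n d k \<theta> Z \<omega> 0"
        using assms by (simp add: negspca_input_def prep_state_def counter_input_def) (auto simp: fun_eq_iff)
      show "nval (NVar 0) s = n" if "s = prep_state N n d k \<theta> Z \<omega> m" for m s
        using that assms by (simp add: prep_state_def counter_input_def)
      fix m s assume m: "m < n" and s: "s = prep_state N n d k \<theta> Z \<omega> m"
      let ?s1 = "set_cell N m 0 (Z m 0) s"
      let ?s2 = "set_cell 1 m 0 (\<omega> m) (?s1\<lparr>tape_pos := Suc m\<rparr>)"
      let ?s3 = "(row_state N n d k \<theta> Z \<omega> m 0)\<lparr>counter := (counter_input n d k)(N := m, N + 1 := if m = 0 then 0 else d)\<rparr>"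
      show "runs_to \<omega> (prepare_sample N)
        s (1 + (1 + (1 + ((d * 4 + 2) + 1))))
        (\<lambda>s'. counter s' N = m \<and> s'\<lparr>counter := (counter s')(N := Suc m)\<rparr> = prep_state N n d k \<theta> Z \<omega> (Suc m))"
        unfolding prepare_sample_def
        apply (rule runs_to_Seq[where R="\<lambda>s'. s' = ?s1"])
         apply (rule runs_to_RAssign)
        subgoal using assms m s by (simp add: prep_state_def)
        apply (rule runs_to_Seq[where R="\<lambda>s'. s' = ?s2"])
         apply (rule runs_to_Gauss)
        subgoal using assms m s by (simp add: prep_state_def set_cell_simp)
        apply (rule runs_to_Seq[where R="\<lambda>s'. s' = ?s3"])
         apply (rule runs_to_RAssign)
        subgoal using assms m s
          by (simp add: prep_state_def row_state_def set_cell_simp)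
            (auto simp: fun_eq_iff noisy_response_def noise_factor_def counter_input_def less_Suc_eq_le add_ac)
        apply (rule runs_to_Seq)
         apply clarify
         apply (rule runs_to_prepare_row[OF assms(1) m])
        apply (rule runs_to_RAssign)
        using assms m by (simp add: prep_state_def row_state_def set_cell_simp)
          (auto simp: fun_eq_iff counter_input_def less_Suc_eq less_Suc_eq_le)
    qed
    fix s' assume s': "s' = prep_state N n d k \<theta> Z \<omega> n"
    show "runs_to \<omega> (Seq (RAssign 2 (NConst 0) (NConst 0) (RNat (NConst 1)))
     (Seq (NAssign (N + 2) (NVar 0)) (NAssign (N + 3) (NVar 1)))) s' (1 + (1 + 1))
     (\<lambda>s. agree N n s (slr_input n d k 1 (\<lambda>i j. Z i (Suc j)) (noisy_response n Z \<omega>)) \<and>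
      counter s (N + 2) = n \<and> counter s (N + 3) = d \<and>
      (\<forall>i<n. \<forall>j\<le>d. arr s N i j = Z i j) \<and> (\<forall>i j. arr s (N + 1) i j = 0))"
      apply (rule runs_to_Seq_RAssign)
      apply (rule runs_to_Seq_NAssign)
      apply (rule runs_to_NAssign)
      using assms s' by (simp add: prep_state_def set_cell_simp agree_def slr_input_def counter_input_def)
        (auto simp: fun_eq_iff)
  qed
  then show ?thesis by (rule runs_to_mono) (simp_all add: algebra_simps)
qed

lemma runs_to_test_residual:
  assumes N: "4 \<le> N" and s: "counter s (N + 2) = n" "counter s (N + 3) = d"
    "\<And>i j. i < n \<Longrightarrow> j \<le> d \<Longrightarrow> arr s N i j = Z i j" "arr s (N + 1) 0 1 = 0"
  shows "runs_to \<omega> (test_residual N) s (n * (d * 3 + 6) + 4)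
    (\<lambda>s'. says_planted s' \<longleftrightarrow>
      75 * (\<Sum>i<n. (Z i 0 - inner_prod d (\<lambda>j. Z i (Suc j)) (slr_output s))\<^sup>2) < real n)"
proof -
  define x where "x = slr_output s"
  define res where "res i l = Z i 0 - (\<Sum>j<l. Z i (Suc j) * x j)" for i l
  \<comment> \<open>The estimate is read in every round, so the invariant freezes column 0 of array
    3. Cell \<open>(0,0)\<close> of array \<open>N + 1\<close> is left free, being recomputed for
    each row.\<close>
  define I where "I m s' \<longleftrightarrow> counter s' (N + 2) = n \<and> counter s' (N + 3) = d \<and> counter s' N = m \<and>
      (\<forall>i<n. \<forall>j\<le>d. arr s' N i j = Z i j) \<and> (\<forall>j. arr s' 3 j 0 = x j) \<and>
      arr s' (N + 1) 0 1 = (\<Sum>i<m. (res i d)\<^sup>2)" for m and s' :: ram_state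
  have "runs_to \<omega> (test_residual N) s ((n * ((1 + ((d * (1 + 2) + 2) + 1)) + 2) + 2) + Suc 1)
    (\<lambda>s'. says_planted s' \<longleftrightarrow> 75 * (\<Sum>i<n. (res i d)\<^sup>2) < real n)"
    unfolding test_residual_def
  proof (rule runs_to_Seq)
    show "runs_to \<omega> (for_up N (NVar (N + 2))
       (add_residual N)) s
       (n * ((1 + ((d * (1 + 2) + 2) + 1)) + 2) + 2) (I n)"
    proof (rule runs_to_for_up[where P=I])
      show "I 0 (s\<lparr>counter := (counter s)(N := 0)\<rparr>)"
        using s by (simp add: I_def x_def slr_output_def)
      show "nval (NVar (N + 2)) s' = n" if "I m s'" for m s'
        using that by (simp add: I_def)
      fix m s' assume m: "m < n" and s': "I m s'"
      show "runs_to \<omega> (add_residual N) s'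
         (1 + ((d * (1 + 2) + 2) + 1))
         (\<lambda>s''. counter s'' N = m \<and> I (Suc m) (s''\<lparr>counter := (counter s'')(N := Suc m)\<rparr>))"
        unfolding add_residual_def
      proof (rule runs_to_Seq[where R="\<lambda>s''. I m s'' \<and> arr s'' (N + 1) 0 0 = res m 0"])
        show "runs_to \<omega> (RAssign (N + 1) (NConst 0) (NConst 0) (RCell N (NVar N) (NConst 0))) s' 1
          (\<lambda>s''. I m s'' \<and> arr s'' (N + 1) 0 0 = res m 0)"
          using N s' m by (intro runs_to_RAssign) (auto simp: I_def set_cell_def res_def)
        fix s1 assume s1: "I m s1 \<and> arr s1 (N + 1) 0 0 = res m 0"
        show "runs_to \<omega> (Seq (subtract_prediction N)
         (RAssign (N + 1) (NConst 0) (NConst 1)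
           (RAdd (RCell (N + 1) (NConst 0) (NConst 1))
             (RMul (RCell (N + 1) (NConst 0) (NConst 0)) (RCell (N + 1) (NConst 0) (NConst 0)))))) s1
          ((d * (1 + 2) + 2) + 1)
          (\<lambda>s''. counter s'' N = m \<and> I (Suc m) (s''\<lparr>counter := (counter s'')(N := Suc m)\<rparr>))"
        proof (rule runs_to_Seq)
          show "runs_to \<omega> (subtract_prediction N) s1 (d * (1 + 2) + 2)
              (\<lambda>s''. I m s'' \<and> arr s'' (N + 1) 0 0 = res m d)"
            unfolding subtract_prediction_def
          proof (rule runs_to_for_up[where P="\<lambda>l s''. I m s'' \<and> arr s'' (N + 1) 0 0 = res m l"])
            show "I m (s1\<lparr>counter := (counter s1)(N + 1 := 0)\<rparr>) \<and>
               arr (s1\<lparr>counter := (counter s1)(N + 1 := 0)\<rparr>) (N + 1) 0 0 = res m 0"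
              using s1 by (simp add: I_def)
            show "nval (NVar (N + 3)) s' = d" if "I m s' \<and> arr s' (N + 1) 0 0 = res m l" for l s'
              using that by (simp add: I_def)
            fix l s2 assume l: "l < d" and s2: "I m s2 \<and> arr s2 (N + 1) 0 0 = res m l" "counter s2 (N + 1) = l"
            have "res m (Suc l) = res m l - Z m (Suc l) * x l" by (simp add: res_def)
            with l s2 m N show "runs_to \<omega> (RAssign (N + 1) (NConst 0) (NConst 0)
                (RSub (RCell (N + 1) (NConst 0) (NConst 0))
                  (RMul (RCell N (NVar N) (NAdd (NVar (N + 1)) (NConst 1)))
                    (RCell 3 (NVar (N + 1)) (NConst 0))))) s2 1
               (\<lambda>s'. counter s' (N + 1) = l \<and> I m (s'\<lparr>counter := (counter s')(N + 1 := Suc l)\<rparr>) \<and>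
                 arr (s'\<lparr>counter := (counter s')(N + 1 := Suc l)\<rparr>) (N + 1) 0 0 = res m (Suc l))"
              by (intro runs_to_RAssign) (auto simp: I_def set_cell_def)
          qed
          fix s3 assume "I m s3 \<and> arr s3 (N + 1) 0 0 = res m d"
          with N show "runs_to \<omega> (RAssign (N + 1) (NConst 0) (NConst 1)
             (RAdd (RCell (N + 1) (NConst 0) (NConst 1))
             (RMul (RCell (N + 1) (NConst 0) (NConst 0)) (RCell (N + 1) (NConst 0) (NConst 0))))) s3 1
             (\<lambda>s''. counter s'' N = m \<and> I (Suc m) (s''\<lparr>counter := (counter s'')(N := Suc m)\<rparr>))"
            by (intro runs_to_RAssign) (auto simp: I_def set_cell_def power2_eq_square)
        qed
      qed
    qed
    fix s' assume "I n s'"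
    then show "runs_to \<omega> (If (RLess (RMul (RNat (NConst 75)) (RCell (N + 1) (NConst 0) (NConst 1))) (RNat (NVar (N + 2))))
       (NAssign 3 (NConst 1)) (NAssign 3 (NConst 0))) s' (Suc 1)
       (\<lambda>s'. says_planted s' \<longleftrightarrow> 75 * (\<Sum>i<n. (res i d)\<^sup>2) < real n)"
      by (intro runs_to_If runs_to_NAssign) (simp_all add: I_def says_planted_def)
  qed
  then show ?thesis
    by (rule runs_to_mono) (simp_all add: res_def inner_prod_def x_def algebra_simps)
qed

text \<open>Inside the distinguisher the learner starts at tape position \<open>n\<close> among
  stored data; \<open>exec_agree\<close> matches this with a clean run on the shifted tape. The
  overhead is of order \<open>n * d\<close>, whatever the learner does.\<close>

lemma exec_distinguisher:
  assumes "1 \<le> n" "4 \<le> N" "com_below N L"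
    and L: "exec (\<lambda>i. \<omega> (i + n)) L (slr_input n d k 1 (\<lambda>i j. Z i (Suc j)) (noisy_response n Z \<omega>)) t s"
  shows "runs_to \<omega> (distinguisher N L) (negspca_input n d k \<theta> Z) (t + (n * (d * 7 + 14) + 9))
    (\<lambda>s'. says_planted s' \<longleftrightarrow>
      75 * (\<Sum>i<n. (Z i 0 - inner_prod d (\<lambda>j. Z i (Suc j)) (slr_output s))\<^sup>2) < real n)"
proof -
  let ?Q = "\<lambda>s'. says_planted s' \<longleftrightarrow>
      75 * (\<Sum>i<n. (Z i 0 - inner_prod d (\<lambda>j. Z i (Suc j)) (slr_output s))\<^sup>2) < real n"
  have "runs_to \<omega> (distinguisher N L) (negspca_input n d k \<theta> Z)
     ((n * (d * 4 + 8) + 5) + (t + (n * (d * 3 + 6) + 4))) ?Q"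
    unfolding distinguisher_def
  proof (rule runs_to_Seq[OF runs_to_prepare[OF assms(2,1)]], elim conjE, rule runs_to_Seq)
    fix s1 assume ag: "agree N n s1 (slr_input n d k 1 (\<lambda>i j. Z i (Suc j)) (noisy_response n Z \<omega>))"
      and s1: "counter s1 (N + 2) = n" "counter s1 (N + 3) = d"
        "\<forall>i<n. \<forall>j\<le>d. arr s1 N i j = Z i j" "\<forall>i j. arr s1 (N + 1) i j = 0"
    from exec_agree[OF L assms(3) ag]
    show "runs_to \<omega> L s1 t (\<lambda>s'. agree N n s' s \<and> same_above N s1 s')"
      unfolding runs_to_def by auto
    fix s2 assume s2: "agree N n s2 s \<and> same_above N s1 s2"
    have "slr_output s2 = slr_output s"
      using s2 assms(2) by (simp add: slr_output_def agree_def)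
    moreover have "runs_to \<omega> (test_residual N) s2 (n * (d * 3 + 6) + 4)
     (\<lambda>s'. says_planted s' \<longleftrightarrow>
      75 * (\<Sum>i<n. (Z i 0 - inner_prod d (\<lambda>j. Z i (Suc j)) (slr_output s2))\<^sup>2) < real n)"
      using s2 s1 by (intro runs_to_test_residual assms) (auto simp: same_above_def)
    ultimately show "runs_to \<omega> (test_residual N) s2 (n * (d * 3 + 6) + 4) ?Q" by simp
  qed
  then show ?thesis by (rule runs_to_mono) (simp_all add: algebra_simps)
qed

section \<open>Success probabilities\<close>

text \<open>The answer event is the union over the step count of preimages of \<open>wp\<close>
  sets.\<close>

lemma sets_answer:
  assumes \<mu>: "sets \<mu> = sets (PiM {..<d + 1} (\<lambda>_. borel :: real measure))"
  shows "{(Z, \<omega>) \<in> space (negspca_space n \<mu>). \<exists>t s'. exec \<omega> B (negspca_input n d k \<theta> Z) t s' \<and>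
    says_planted s' = b} \<in> sets (negspca_space n \<mu>)" (is "?A \<in> _")
proof -
  have Z: "(\<lambda>x. fst x i j) \<in> borel_measurable (negspca_space n \<mu>)" if "i < n" "j \<le> d" for i j
  proof -
    have "(\<lambda>Z. Z i) \<in> PiM {..<n} (\<lambda>_. \<mu>) \<rightarrow>\<^sub>M \<mu>"
      using that by (simp add: measurable_component_singleton)
    then have "(\<lambda>x. fst x i) \<in> negspca_space n \<mu> \<rightarrow>\<^sub>M \<mu>"
      unfolding negspca_space_def by (rule measurable_compose[OF measurable_fst])
    moreover have "(\<lambda>z. z j) \<in> borel_measurable \<mu>"
      unfolding measurable_cong_sets[OF \<mu> refl]
      using that by (intro measurable_component_singleton) auto
    ultimately show ?thesis by (rule measurable_compose)
  qed
  have w: "(\<lambda>x. snd x i) \<in> borel_measurable (negspca_space n \<mu>)" for i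
  proof -
    have "(\<lambda>\<omega>. \<omega> i) \<in> borel_measurable random_tape"
      unfolding measurable_cong_sets[OF sets_random_tape refl] by (rule measurable_component_singleton) simp
    then show ?thesis unfolding negspca_space_def by (rule measurable_compose[OF measurable_snd])
  qed
  have m: "(\<lambda>x. (negspca_input n d k \<theta> (fst x), snd x)) \<in> negspca_space n \<mu> \<rightarrow>\<^sub>M conf_space"
  proof (rule measurable_into_conf_space)
    fix a i j
    show "(\<lambda>x. arr (negspca_input n d k \<theta> (fst x)) a i j) \<in> borel_measurable (negspca_space n \<mu>)"
    proof (cases "a = 0 \<and> i < n \<and> j \<le> d")
      case True
      then show ?thesis by (simp add: negspca_input_def Z)
    next
      case False
      show ?thesis
        by (simp only: negspca_input_def ram_state.select_convs if_not_P[OF False]) (rule measurable_const, simp)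
    qed
  qed (simp_all add: negspca_input_def w)
  have "{x. (counter (fst x) 3 = 1) = b} \<in> sets conf_space"
  proof -
    have "Measurable.pred conf_space (\<lambda>x. (counter (fst x) 3 = 1) = b)" by measurable
    then show ?thesis by (simp add: pred_def)
  qed
  then have "(\<Union>t. (\<lambda>x. (negspca_input n d k \<theta> (fst x), snd x)) -` wp B t {x. (counter (fst x) 3 = 1) = b}
       \<inter> space (negspca_space n \<mu>)) \<in> sets (negspca_space n \<mu>)"
    by (intro sets.countable_UN) (auto intro!: measurable_sets[OF m] sets_wp simp del: One_nat_def)
  also have "(\<Union>t. (\<lambda>x. (negspca_input n d k \<theta> (fst x), snd x)) -` wp B t {x. (counter (fst x) 3 = 1) = b}
       \<inter> space (negspca_space n \<mu>)) = ?A"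
    by (intro set_eqI iffI) (clarsimp simp: wp_def says_planted_def, blast)+
  finally show ?thesis .
qed

lemma slr_input_cong:
  "(\<And>i j. i < n \<Longrightarrow> j < d \<Longrightarrow> A i j = A' i j) \<Longrightarrow> (\<And>i. i < n \<Longrightarrow> y i = y' i) \<Longrightarrow>
    slr_input n d k \<sigma> A y = slr_input n d k \<sigma> A' y'"
  by (auto simp: slr_input_def fun_eq_iff)

lemma inner_prod_cong:
  "(\<And>i. i < d \<Longrightarrow> u i = u' i) \<Longrightarrow> (\<And>i. i < d \<Longrightarrow> v i = v' i) \<Longrightarrow> inner_prod d u v = inner_prod d u' v'"
  unfolding inner_prod_def by (rule sum.cong) auto

text \<open>Serves both hypotheses: planted with the regression coefficient \<open>b\<close> and
  small \<open>s\<close>, null with \<open>b = 0\<close> and \<open>s = 1\<close>. The tape shift by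
  \<open>n\<close> undoes the splicing in \<open>to_negspca\<close>, so the learner runs on
  \<open>\<omega>\<close> itself.\<close>

lemma distinguisher_on_base:
  fixes S :: "nat \<Rightarrow> (nat \<Rightarrow> real) \<times> real \<times> real" and b \<omega> :: "nat \<Rightarrow> real" and s r :: real and n d k N L
  defines "Z \<equiv> fst (to_negspca n (prepend_response d b s) S \<omega>)"
    and "\<omega>' \<equiv> snd (to_negspca n (prepend_response d b s) S \<omega>)"
  assumes n: "1 \<le> n" and N: "4 \<le> N" "com_below N L"
    and L: "exec \<omega> L (slr_input n d k 1 A y) t s'"
    and A: "\<And>i. i < n \<Longrightarrow> A i = fst (S i)"
    and y: "\<And>i. i < n \<Longrightarrow> y i = inner_prod d (fst (S i)) b + s * fst (snd (S i)) + noise_factor n * snd (snd (S i))"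
  shows "runs_to \<omega>' (distinguisher N L) (negspca_input n d k \<theta> Z) (t + (n * (d * 7 + 14) + 9))
    (\<lambda>s''. says_planted s'' \<longleftrightarrow> 75 * (\<Sum>i<n. (inner_prod d (fst (S i)) b + s * fst (snd (S i))
       - inner_prod d (fst (S i)) (slr_output s'))\<^sup>2) < real n)"
proof -
  have Z0: "Z i 0 = inner_prod d (fst (S i)) b + s * fst (snd (S i))" if "i < n" for i
    using that by (simp add: Z_def to_negspca_def prepend_response_def)
  have Z1: "Z i (Suc j) = fst (S i) j" if "i < n" "j < d" for i j
    using that by (simp add: Z_def to_negspca_def prepend_response_def)
  have w: "\<omega>' i = snd (snd (S i))" if "i < n" for i
    using that by (simp add: \<omega>'_def to_negspca_def comb_seq_def)
  have sh: "(\<lambda>i. \<omega>' (i + n)) = \<omega>"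
    by (simp add: \<omega>'_def to_negspca_def comb_seq_add)
  have "slr_input n d k 1 A y = slr_input n d k 1 (\<lambda>i j. Z i (Suc j)) (noisy_response n Z \<omega>')"
    by (rule slr_input_cong) (simp_all add: A y Z0 Z1 w noisy_response_def)
  with L sh have "exec (\<lambda>i. \<omega>' (i + n)) L (slr_input n d k 1 (\<lambda>i j. Z i (Suc j)) (noisy_response n Z \<omega>')) t s'"
    by simp
  from exec_distinguisher[OF n N this, of \<theta>]
  have "runs_to \<omega>' (distinguisher N L) (negspca_input n d k \<theta> Z) (t + (n * (d * 7 + 14) + 9))
    (\<lambda>s''. says_planted s'' \<longleftrightarrow>
      75 * (\<Sum>i<n. (Z i 0 - inner_prod d (\<lambda>j. Z i (Suc j)) (slr_output s'))\<^sup>2) < real n)" .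
  moreover have "(\<Sum>i<n. (Z i 0 - inner_prod d (\<lambda>j. Z i (Suc j)) (slr_output s'))\<^sup>2)
     = (\<Sum>i<n. (inner_prod d (fst (S i)) b + s * fst (snd (S i)) - inner_prod d (fst (S i)) (slr_output s'))\<^sup>2)"
  proof (rule sum.cong)
    fix i assume "i \<in> {..<n}"
    then have i: "i < n" by simp
    have "inner_prod d (\<lambda>j. Z i (Suc j)) (slr_output s') = inner_prod d (fst (S i)) (slr_output s')"
      using Z1[OF i] by (intro inner_prod_cong) auto
    then show "(Z i 0 - inner_prod d (\<lambda>j. Z i (Suc j)) (slr_output s'))\<^sup>2 =
      (inner_prod d (fst (S i)) b + s * fst (snd (S i)) - inner_prod d (fst (S i)) (slr_output s'))\<^sup>2"
      by (simp add: Z0[OF i])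
  qed simp
  ultimately show ?thesis by simp
qed

lemma measurable_prepend_response:
  assumes \<nu>: "sets \<nu> = sets (PiM {..<d} (\<lambda>_. borel :: real measure))"
  shows "prepend_response d b s \<in> \<nu> \<Otimes>\<^sub>M std_normal \<rightarrow>\<^sub>M PiM {..<d + 1} (\<lambda>_. borel)"
proof -
  have [measurable]: "(\<lambda>x. fst x i) \<in> borel_measurable (\<nu> \<Otimes>\<^sub>M std_normal)" if "i < d" for i
  proof -
    have "(\<lambda>a. a i) \<in> borel_measurable \<nu>"
      unfolding measurable_cong_sets[OF \<nu> refl] using that by (simp add: measurable_component_singleton)
    then show ?thesis by (rule measurable_compose[OF measurable_fst])
  qed
  show ?thesis
    unfolding prepend_response_def split_beta
  proof (rule measurable_restrict)
    fix j assume "j \<in> {..<d + 1}"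
    then show "(\<lambda>x. if j = 0 then inner_prod d (fst x) b + s * snd x else fst x (j - 1))
        \<in> borel_measurable (\<nu> \<Otimes>\<^sub>M std_normal)"
      by (cases "j = 0") auto
  qed
qed

section \<open>The null hypothesis\<close>

lemma noise_factor_bounds: "0 < noise_factor n" "noise_factor n < 1"
  by (simp_all add: noise_factor_def)

lemma noise_factor_ge: "8 \<le> n \<Longrightarrow> 9 / 10 \<le> noise_factor n"
  by (simp add: noise_factor_def field_simps)

lemma prob_space_negspca_space: "prob_space \<mu> \<Longrightarrow> prob_space (negspca_space n \<mu>)"
  unfolding negspca_space_def
proof -
  assume \<mu>: "prob_space \<mu>"
  interpret A: prob_space "PiM {..<n} (\<lambda>_. \<mu>)" by (rule prob_space_PiM[OF \<mu>])
  interpret T: prob_space random_tape by (rule prob_space_random_tape)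
  interpret P: pair_prob_space "PiM {..<n} (\<lambda>_. \<mu>)" random_tape ..
  show "prob_space (PiM {..<n} (\<lambda>_. \<mu>) \<Otimes>\<^sub>M random_tape)" by unfold_locales
qed

text \<open>As the learner halts on every input, so does the distinguisher; its two answer events
  are measurable and cover the space, so it suffices to bound the probability of answering
  planted.\<close>

lemma null_success:
  assumes n: "8 \<le> n" and N: "4 \<le> N" "com_below N L"
    and halts: "\<And>A y \<omega>. \<exists>t s'. exec \<omega> L (slr_input n d k 1 A y) t s'"
  shows "null_success_prob (distinguisher N L) n d k \<theta> \<ge> 1 - (9 / 10) ^ n"
proof -
  let ?\<nu> = "mv_normal d (spiked_cov 0 (\<lambda>_. 0))" and ?B = "PiM {..<d + 1} (\<lambda>_. borel :: real measure)"
  let ?\<phi> = "prepend_response d (\<lambda>_. 0) 1"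
  define \<mu> where "\<mu> = mv_normal (d + 1) id_cov"
  have id: "id_cov = spiked_cov 0 (\<lambda>_. 0)" by (simp add: fun_eq_iff id_cov_def spiked_cov_def)
  \<comment> \<open>The regression lemma with zero spike: coordinate 0 is pure residual, independent
    of the design.\<close>
  have \<mu>: "\<mu> = distr (?\<nu> \<Otimes>\<^sub>M std_normal) ?B ?\<phi>"
    using mv_normal_regression[where d=d and x="\<lambda>_. 0" and \<theta>=0 and \<beta>=0 and s=1] by (simp add: \<mu>_def id)
  have \<nu>: "prob_space ?\<nu>" and s\<nu>: "sets ?\<nu> = sets (PiM {..<d} (\<lambda>_. borel :: real measure))"
    by (auto intro!: prob_space_mv_normal_spiked sets_mv_normal_spiked simp del: One_nat_def)
  note \<phi> = measurable_prepend_response[OF s\<nu>, of "\<lambda>_. 0" 1]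
  have p\<mu>: "prob_space \<mu>"
    unfolding \<mu>_def id by (rule prob_space_mv_normal_spiked) simp_all
  interpret P: prob_space "negspca_space n \<mu>" by (rule prob_space_negspca_space[OF p\<mu>])
  define X where "X b = {(Z, \<omega>) \<in> space (negspca_space n \<mu>). \<exists>t s'. exec \<omega> (distinguisher N L) (negspca_input n d k \<theta> Z) t s' \<and>
    says_planted s' = b}" for b
  have X[measurable]: "X b \<in> sets (negspca_space n \<mu>)" for b
    unfolding X_def by (rule sets_answer) (simp add: \<mu>)
  \<comment> \<open>\<open>null_bound\<close> wants the estimate as a function of design, responses
    and tape. Determinism identifies the chosen final state with the actual one.\<close>
  define F where "F a y \<omega> = (SOME s'. \<exists>t. exec \<omega> L (slr_input n d k 1 a y) t s')" for a y \<omega>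
  have F: "F a y \<omega> = s'" if "exec \<omega> L (slr_input n d k 1 a y) t s'" for a y \<omega> t s'
  proof -
    have "\<exists>t. exec \<omega> L (slr_input n d k 1 a y) t (F a y \<omega>)"
      unfolding F_def by (rule someI_ex) (use that in blast)
    then show ?thesis using exec_deterministic[OF that] by blast
  qed
  have "space (negspca_space n \<mu>) \<subseteq> X True \<union> X False"
  proof
    fix x assume x: "x \<in> space (negspca_space n \<mu>)"
    obtain Z \<omega> where x': "x = (Z, \<omega>)" by (cases x)
    obtain t s' where "exec (\<lambda>i. \<omega> (i + n)) L (slr_input n d k 1 (\<lambda>i j. Z i (Suc j)) (noisy_response n Z \<omega>)) t s'"
      using halts by blast
    from exec_distinguisher[OF _ N this, of \<theta>] n
    have "\<exists>t s'. exec \<omega> (distinguisher N L) (negspca_input n d k \<theta> Z) t s'"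
      unfolding runs_to_def by auto
    then show "x \<in> X True \<union> X False" using x x' by (auto simp: X_def)
  qed
  then have "X True \<union> X False = space (negspca_space n \<mu>)"
    using sets.sets_into_space[OF X] by blast
  then have "1 \<le> P.prob (X True) + P.prob (X False)"
    using P.prob_space measure_Un_le[OF X X, of True False] by simp
  moreover have "P.prob (X True) \<le> (9 / 10) ^ n"
  proof -
    have m: "(\<lambda>x. to_negspca n ?\<phi> (fst x) (snd x)) \<in> base_space n ?\<nu> \<Otimes>\<^sub>M random_tape \<rightarrow>\<^sub>M negspca_space n \<mu>"
      by (rule measurable_to_negspca[OF \<nu> \<phi> \<mu>])
    have "emeasure (negspca_space n \<mu>) (X True) = (\<integral>\<^sup>+x. indicator (X True) x \<partial>negspca_space n \<mu>)"
      by simp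
    also have "\<dots> = (\<integral>\<^sup>+S. \<integral>\<^sup>+\<omega>. indicator (X True) (to_negspca n ?\<phi> S \<omega>) \<partial>random_tape \<partial>base_space n ?\<nu>)"
      by (rule nn_integral_negspca_space[OF \<nu> \<phi> \<mu>]) simp
    also have "\<dots> = (\<integral>\<^sup>+S. \<integral>\<^sup>+\<omega>. indicator {\<omega>. to_negspca n ?\<phi> S \<omega> \<in> X True} \<omega> \<partial>random_tape \<partial>base_space n ?\<nu>)"
      by (intro nn_integral_cong) (simp add: indicator_def)
    also have "\<dots> \<le> ennreal ((9 / 10) ^ n)"
    proof (rule null_bound[OF \<nu> noise_factor_ge[OF n] less_imp_le[OF noise_factor_bounds(2)],
        where V="\<lambda>a y \<omega> i. inner_prod d (a i) (slr_output (F a y \<omega>))"])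
      show "Measurable.pred (base_space n ?\<nu> \<Otimes>\<^sub>M random_tape) (\<lambda>x. to_negspca n ?\<phi> (fst x) (snd x) \<in> X True)"
        by (rule measurable_compose[OF m]) simp
      fix S :: "nat \<Rightarrow> (nat \<Rightarrow> real) \<times> real \<times> real" and \<omega>
      assume G: "to_negspca n ?\<phi> S \<omega> \<in> X True"
      let ?a = "\<lambda>i\<in>{..<n}. fst (S i)" and ?y = "\<lambda>i\<in>{..<n}. fst (snd (S i)) + noise_factor n * snd (snd (S i))"
      obtain t s' where L: "exec \<omega> L (slr_input n d k 1 ?a ?y) t s'" using halts by blast
      note R = distinguisher_on_base[OF _ N L, of S "\<lambda>_. 0" 1 \<theta>]
      have "runs_to (snd (to_negspca n ?\<phi> S \<omega>)) (distinguisher N L) (negspca_input n d k \<theta> (fst (to_negspca n ?\<phi> S \<omega>)))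
        (t + (n * (d * 7 + 14) + 9))
        (\<lambda>s''. says_planted s'' \<longleftrightarrow> 75 * (\<Sum>i<n. (inner_prod d (fst (S i)) (\<lambda>_. 0) + 1 * fst (snd (S i))
         - inner_prod d (fst (S i)) (slr_output s'))\<^sup>2) < real n)"
        by (rule R) (use n in \<open>simp_all add: inner_prod_def\<close>)
      then obtain t1 s1 where s1: "exec (snd (to_negspca n ?\<phi> S \<omega>)) (distinguisher N L) (negspca_input n d k \<theta> (fst (to_negspca n ?\<phi> S \<omega>))) t1 s1"
        "says_planted s1 \<longleftrightarrow> 75 * (\<Sum>i<n. (fst (snd (S i)) - inner_prod d (fst (S i)) (slr_output s'))\<^sup>2) < real n"
        unfolding runs_to_def by (auto simp: inner_prod_def)
      obtain t2 s2 where s2: "exec (snd (to_negspca n ?\<phi> S \<omega>)) (distinguisher N L) (negspca_input n d k \<theta> (fst (to_negspca n ?\<phi> S \<omega>))) t2 s2"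
        "says_planted s2"
        using G by (auto simp: X_def split_beta)
      have "s2 = s1" using exec_deterministic[OF s1(1) s2(1)] by simp
      with s1 s2 have "75 * (\<Sum>i<n. (fst (snd (S i)) - inner_prod d (fst (S i)) (slr_output s'))\<^sup>2) < real n"
        by simp
      then show "75 * (\<Sum>i<n. (fst (snd (S i)) - inner_prod d (?a i) (slr_output (F ?a ?y \<omega>)))\<^sup>2) < real n"
        unfolding F[OF L] by simp
    qed
    finally show ?thesis by (simp add: P.emeasure_eq_measure)
  qed
  ultimately show ?thesis
    unfolding null_success_prob_def answer_prob_def \<mu>_def[symmetric] X_def[symmetric] by linarith
qed

section \<open>The planted hypothesis\<close>

text \<open>The solution \<theta> of \<open>(1 - \<theta>) / (1 - \<theta> * k / (k + 1)) = 1 -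
  r\<^sup>2\<close>, where the left side is the variance of coordinate 0 given the others under the
  planted law.\<close>

definition spike_strength :: "nat \<Rightarrow> nat \<Rightarrow> real" where
  "spike_strength n k = (real k + 1) * (noise_factor n)\<^sup>2 / (real k * (noise_factor n)\<^sup>2 + 1)"

lemma noise_factor_square_less: "(noise_factor n)\<^sup>2 < 1"
  using noise_factor_bounds[of n] by (simp add: abs_square_less_1)

lemma spike_strength_bounds: "0 < spike_strength n k" "spike_strength n k < 1"
proof -
  have r: "0 < (noise_factor n)\<^sup>2" "(noise_factor n)\<^sup>2 < 1"
    using noise_factor_bounds(1)[of n] noise_factor_square_less[of n] by simp_all
  then have D: "real k * (noise_factor n)\<^sup>2 + 1 > 0" by (simp add: add_nonneg_pos)
  show "0 < spike_strength n k" using r D by (simp add: spike_strength_def)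
  show "spike_strength n k < 1" using r D by (simp add: spike_strength_def field_simps)
qed

lemma spikes_square:
  assumes x: "x \<in> spikes d k"
  shows "(\<Sum>i<d. (x (Suc i))\<^sup>2) = real k / (real k + 1)" "(x 0)\<^sup>2 = 1 / (real k + 1)"
proof -
  have x0: "x 0 = - 1 / sqrt (real k + 1)" and xj: "\<And>j. j \<in> {1..d} \<Longrightarrow> x j \<in> {1 / sqrt (real k + 1), - 1 / sqrt (real k + 1), 0}"
    and c: "card {j\<in>{1..d}. x j \<noteq> 0} = k"
    using x unfolding spikes_def by auto
  show "(x 0)\<^sup>2 = 1 / (real k + 1)" by (simp add: x0 power_divide)
  have "(\<Sum>i<d. (x (Suc i))\<^sup>2) = (\<Sum>j\<in>{1..d}. (x j)\<^sup>2)"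
    by (rule sum.reindex_bij_witness[of _ "\<lambda>j. j - 1" Suc]) auto
  also have "\<dots> = (\<Sum>j\<in>{1..d}. if x j \<noteq> 0 then 1 / (real k + 1) else 0)"
  proof (rule sum.cong)
    fix j assume "j \<in> {1..d}"
    from xj[OF this] show "(x j)\<^sup>2 = (if x j \<noteq> 0 then 1 / (real k + 1) else 0)"
      by (auto simp: power_divide)
  qed simp
  also have "\<dots> = real (card {j\<in>{1..d}. x j \<noteq> 0}) * (1 / (real k + 1))"
    by (subst sum.inter_filter[symmetric]) auto
  finally show "(\<Sum>i<d. (x (Suc i))\<^sup>2) = real k / (real k + 1)" unfolding c by simp
qed

lemma spikes_sparse:
  assumes x: "x \<in> spikes d k"
  shows "sparse d k (\<lambda>i. \<beta> * x (Suc i))"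
proof -
  have "card {i. i < d \<and> \<beta> * x (Suc i) \<noteq> 0} = card (Suc ` {i. i < d \<and> \<beta> * x (Suc i) \<noteq> 0})"
    by (simp add: card_image)
  also have "\<dots> \<le> card {j\<in>{1..d}. x j \<noteq> 0}"
    by (rule card_mono) auto
  also have "\<dots> = k" using x by (simp add: spikes_def)
  finally show ?thesis by (simp add: sparse_def)
qed

text \<open>Young's inequality, from the square of \<open>e / 2 - 2 * f\<close>. With prediction
  error below 1/100 and threshold 1/75 the first term uses up
  \<open>75 * 5 / 4 / 100 = 15 / 16\<close> of the budget. The remaining 1/16 against
  \<open>75 * 5\<close> is the origin of \<open>6000 = 16 * 375\<close>.\<close>

lemma sum_square_add_le:
  fixes e f :: "nat \<Rightarrow> real"
  shows "(\<Sum>i<n. (e i + f i)\<^sup>2) \<le> 5 / 4 * (\<Sum>i<n. (e i)\<^sup>2) + 5 * (\<Sum>i<n. (f i)\<^sup>2)"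
proof -
  have "(e i + f i)\<^sup>2 \<le> 5 / 4 * (e i)\<^sup>2 + 5 * (f i)\<^sup>2" for i
    using zero_le_power2[of "e i / 2 - 2 * f i"] by (simp add: power2_eq_square algebra_simps)
  then have "(\<Sum>i<n. (e i + f i)\<^sup>2) \<le> (\<Sum>i<n. 5 / 4 * (e i)\<^sup>2 + 5 * (f i)\<^sup>2)"
    by (intro sum_mono)
  then show ?thesis by (simp add: sum.distrib sum_distrib_left)
qed

text \<open>
  The regression coefficient is \<open>\<beta> u\<close> for the spike \<open>u\<close> without its first coordinate, and the choice
  of \<open>\<theta>\<close> makes the residual variance \<open>1 - r\<^sup>2\<close>.
\<close>

lemma planted_answer:
  assumes n: "1 \<le> n" and N: "4 \<le> N" "com_below N L" and x: "x \<in> spikes d k"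
    and L: "\<And>\<Sigma> x. psd d \<Sigma> \<Longrightarrow> sparse d k x \<Longrightarrow> slr_success_prob L n d k 1 (1 / 100) \<Sigma> x \<ge> 1 - \<epsilon>"
    and \<epsilon>: "\<epsilon> < 1"
  shows "answer_prob (distinguisher N L) n d k (spike_strength n k)
      (mv_normal (d + 1) (spiked_cov (spike_strength n k) x)) True \<ge> 1 - \<epsilon> - 6000 * (1 - (noise_factor n)\<^sup>2)"
proof -
  let ?B = "PiM {..<d + 1} (\<lambda>_. borel :: real measure)"
  define r where "r = noise_factor n"
  define s where "s = sqrt (1 - r\<^sup>2)"
  define \<theta> where "\<theta> = spike_strength n k"
  define K where "K = real k + 1"
  \<comment> \<open>Solves \<open>\<beta> * (1 - \<theta> * U) = - \<theta> * x 0\<close>, where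
    \<open>1 - \<theta> * U = 1 / D\<close>, \<open>\<theta> = K * r\<^sup>2 / D\<close> and
    \<open>x 0 = - 1 / sqrt K\<close>.\<close>
  define \<beta> where "\<beta> = sqrt K * r\<^sup>2"
  define u where "u i = x (Suc i)" for i
  define U where "U = (\<Sum>i<d. (u i)\<^sup>2)"
  have K: "K > 0" by (simp add: K_def)
  have r: "0 < r" "r\<^sup>2 < 1" unfolding r_def by (rule noise_factor_bounds noise_factor_square_less)+
  have s2: "s\<^sup>2 = 1 - r\<^sup>2" using r by (simp add: s_def)
  have U: "U = real k / K" and x0: "(x 0)\<^sup>2 = 1 / K"
    unfolding U_def u_def K_def using spikes_square[OF x] by simp_all
  have \<theta>: "0 \<le> \<theta>" "\<theta> \<le> 1" using spike_strength_bounds[of n k] by (simp_all add: \<theta>_def)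
  define D where "D = real k * r\<^sup>2 + 1"
  have D: "D > 0" by (simp add: D_def add_nonneg_pos)
  have \<theta>D: "\<theta> = K * r\<^sup>2 / D" by (simp add: \<theta>_def spike_strength_def K_def D_def r_def)
  have tot: "(\<Sum>i<d+1. (x i)\<^sup>2) = 1"
    using U x0 K by (simp add: sum.lessThan_Suc_shift U_def u_def del: sum.lessThan_Suc)
      (simp add: K_def add_divide_distrib[symmetric])
  have \<theta>1: "\<theta> * (\<Sum>i<d+1. (x i)\<^sup>2) \<le> 1" using tot \<theta> by simp
  have "U \<le> 1" using K by (simp add: U K_def)
  then have \<theta>U: "\<theta> * (\<Sum>i<d. (u i)\<^sup>2) \<le> 1"
    using \<theta> mult_mono[of \<theta> 1 U 1] unfolding U_def[symmetric] by (simp add: U K_def)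
  have res: "1 - \<theta> * U = 1 / D"
    using K D by (simp add: \<theta>D U field_simps) (simp add: D_def)
  have \<beta>: "\<beta> * (1 - \<theta> * (\<Sum>i<d. (x (Suc i))\<^sup>2)) = - \<theta> * x 0"
  proof -
    have "x 0 = - 1 / sqrt K" using x by (simp add: spikes_def K_def)
    then have "- \<theta> * x 0 = K / sqrt K * (r\<^sup>2 / D)" by (simp add: \<theta>D)
    also have "K / sqrt K = sqrt K" using K by (simp add: real_div_sqrt)
    finally show ?thesis unfolding res[unfolded U_def u_def] by (simp add: \<beta>_def)
  qed
  have s: "s\<^sup>2 = 1 - \<theta> * (x 0)\<^sup>2 - \<beta>\<^sup>2 * (\<Sum>i<d. (x (Suc i))\<^sup>2) * (1 - \<theta> * (\<Sum>i<d. (x (Suc i))\<^sup>2))"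
  proof -
    have "\<beta>\<^sup>2 = K * (r\<^sup>2)\<^sup>2" using K by (simp add: \<beta>_def power_mult_distrib)
    then have "\<beta>\<^sup>2 * U * (1 / D) = real k * (r\<^sup>2)\<^sup>2 / D" using K by (simp add: U)
    moreover have "\<theta> * (x 0)\<^sup>2 = r\<^sup>2 / D" using K by (simp add: \<theta>D x0)
    ultimately have "1 - \<theta> * (x 0)\<^sup>2 - \<beta>\<^sup>2 * U * (1 - \<theta> * U) = 1 - (r\<^sup>2 + real k * (r\<^sup>2)\<^sup>2) / D"
      unfolding res by (simp add: add_divide_distrib)
    also have "r\<^sup>2 + real k * (r\<^sup>2)\<^sup>2 = r\<^sup>2 * D" by (simp add: D_def power2_eq_square algebra_simps)
    finally show ?thesis using D by (simp add: U_def u_def s2)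
  qed
  define b where "b i = \<beta> * u i" for i
  define \<nu> where "\<nu> = mv_normal d (spiked_cov \<theta> u)"
  define \<mu> where "\<mu> = mv_normal (d + 1) (spiked_cov \<theta> x)"
  let ?\<phi> = "prepend_response d b s"
  have \<mu>: "\<mu> = distr (\<nu> \<Otimes>\<^sub>M std_normal) ?B ?\<phi>"
    using mv_normal_regression[OF \<theta>(1) \<theta>1 \<beta> s] by (simp add: \<mu>_def \<nu>_def b_def[abs_def] u_def[abs_def])
  have \<nu>: "prob_space \<nu>" and s\<nu>: "sets \<nu> = sets (PiM {..<d} (\<lambda>_. borel :: real measure))"
    unfolding \<nu>_def by (rule prob_space_mv_normal_spiked[OF \<theta>(1) \<theta>U] sets_mv_normal_spiked[OF \<theta>(1) \<theta>U])+
  have p\<mu>: "prob_space \<mu>" unfolding \<mu>_def by (rule prob_space_mv_normal_spiked[OF \<theta>(1) \<theta>1])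
  interpret P: prob_space "negspca_space n \<mu>" by (rule prob_space_negspca_space[OF p\<mu>])
  define X where "X = {(Z, \<omega>) \<in> space (negspca_space n \<mu>). \<exists>t s'. exec \<omega> (distinguisher N L) (negspca_input n d k \<theta> Z) t s' \<and>
    says_planted s' = True}"
  have X: "X \<in> sets (negspca_space n \<mu>)"
    unfolding X_def by (rule sets_answer) (simp add: \<mu>)
  define H where "H = {(S, \<omega>) \<in> space (slr_space n d 1 (spiked_cov \<theta> u)).
      let A = (\<lambda>i. fst (S i)); y = (\<lambda>i. inner_prod d (A i) b + snd (S i))
      in \<exists>t s'. exec \<omega> L (slr_input n d k 1 A y) t s' \<and> prediction_error n d A b (slr_output s') < 1 / 100}"
  have H1: "measure (slr_space n d 1 (spiked_cov \<theta> u)) H \<ge> 1 - \<epsilon>"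
    unfolding H_def slr_success_prob_def[symmetric]
    by (rule L[OF psd_spiked_cov[OF \<theta>(1) \<theta>U]]) (use spikes_sparse[OF x, of \<beta>] in \<open>simp add: b_def[abs_def] u_def[abs_def]\<close>)
  text \<open>A non-measurable set would have measure \<open>0\<close>.\<close>
  have H: "H \<in> sets (slr_space n d 1 (spiked_cov \<theta> u))"
    using H1 \<epsilon> measure_notin_sets[of H "slr_space n d 1 (spiked_cov \<theta> u)"] by fastforce
  have "emeasure (slr_space n d 1 (spiked_cov \<theta> u)) H \<le> emeasure (negspca_space n \<mu>) X + ennreal (6000 * s\<^sup>2)"
  proof (rule planted_bound[OF \<nu> \<nu>_def measurable_prepend_response[OF s\<nu>] \<mu> _ _ X H])
    show "s\<^sup>2 + r\<^sup>2 = 1" by (simp add: s2)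
    show "0 < n" using n by simp
    fix S :: "nat \<Rightarrow> (nat \<Rightarrow> real) \<times> real \<times> real" and \<omega>
    assume SH: "to_slr n s r S \<omega> \<in> H" and small: "6000 * s\<^sup>2 * (\<Sum>i<n. (fst (snd (S i)))\<^sup>2) < real n"
      and sp: "to_negspca n ?\<phi> S \<omega> \<in> space (negspca_space n \<mu>)"
    let ?A = "\<lambda>i. fst (fst (to_slr n s r S \<omega>) i)"
    let ?y = "\<lambda>i. inner_prod d (?A i) b + snd (fst (to_slr n s r S \<omega>) i)"
    have "snd (to_slr n s r S \<omega>) = \<omega>" by (simp add: to_slr_def)
    with SH obtain t s' where e: "exec \<omega> L (slr_input n d k 1 ?A ?y) t s'"
      and pe: "prediction_error n d ?A b (slr_output s') < 1 / 100"
      unfolding H_def by (auto simp: split_beta Let_def)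
    have A: "?A i = fst (S i)" if "i < n" for i using that by (simp add: to_slr_def)
    have y: "?y i = inner_prod d (fst (S i)) b + s * fst (snd (S i)) + noise_factor n * snd (snd (S i))" if "i < n" for i
      using that by (simp add: to_slr_def r_def)
    obtain t1 s1 where s1: "exec (snd (to_negspca n ?\<phi> S \<omega>)) (distinguisher N L) (negspca_input n d k \<theta> (fst (to_negspca n ?\<phi> S \<omega>))) t1 s1"
      "says_planted s1 \<longleftrightarrow> 75 * (\<Sum>i<n. (inner_prod d (fst (S i)) b + s * fst (snd (S i))
       - inner_prod d (fst (S i)) (slr_output s'))\<^sup>2) < real n"
      using distinguisher_on_base[OF n N e A y, of \<theta>] unfolding runs_to_def by blast
    define ee where "ee i = inner_prod d (fst (S i)) b - inner_prod d (fst (S i)) (slr_output s')" for i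
    have "(\<Sum>i<n. (ee i)\<^sup>2) / real n < 1 / 100"
      using pe A by (simp add: prediction_error_def ee_def)
    then have "100 * (\<Sum>i<n. (ee i)\<^sup>2) < real n" using n by (simp add: field_simps)
    moreover have "(\<Sum>i<n. (ee i + s * fst (snd (S i)))\<^sup>2) \<le> 5 / 4 * (\<Sum>i<n. (ee i)\<^sup>2) + 5 * (\<Sum>i<n. (s * fst (snd (S i)))\<^sup>2)"
      by (rule sum_square_add_le)
    moreover have "(\<Sum>i<n. (s * fst (snd (S i)))\<^sup>2) = s\<^sup>2 * (\<Sum>i<n. (fst (snd (S i)))\<^sup>2)"
      by (simp add: power_mult_distrib sum_distrib_left)
    ultimately have "75 * (\<Sum>i<n. (ee i + s * fst (snd (S i)))\<^sup>2) < real n"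
      using small by simp
    moreover have "ee i + s * fst (snd (S i)) = inner_prod d (fst (S i)) b + s * fst (snd (S i)) - inner_prod d (fst (S i)) (slr_output s')" for i
      by (simp add: ee_def)
    ultimately have "says_planted s1" using s1(2) by simp
    then show "to_negspca n ?\<phi> S \<omega> \<in> X"
      using sp s1(1) unfolding X_def by (auto simp: split_beta)
  qed
  \<comment> \<open>Only this direction is used, and it holds in every measure space.\<close>
  moreover have "ennreal (measure (slr_space n d 1 (spiked_cov \<theta> u)) H) \<le> emeasure (slr_space n d 1 (spiked_cov \<theta> u)) H"
    by (simp add: measure_def ennreal_enn2real_if)
  ultimately have "ennreal (measure (slr_space n d 1 (spiked_cov \<theta> u)) H) \<le> ennreal (P.prob X) + ennreal (6000 * s\<^sup>2)"
    unfolding P.emeasure_eq_measure by (rule order_trans[rotated])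
  also have "\<dots> = ennreal (P.prob X + 6000 * s\<^sup>2)" by (rule ennreal_plus[symmetric]) simp_all
  finally have "ennreal (measure (slr_space n d 1 (spiked_cov \<theta> u)) H) \<le> ennreal (P.prob X + 6000 * s\<^sup>2)" .
  then have "measure (slr_space n d 1 (spiked_cov \<theta> u)) H \<le> P.prob X + 6000 * s\<^sup>2"
    by (subst (asm) ennreal_le_iff) (auto intro!: add_nonneg_nonneg)
  with H1 have "P.prob X \<ge> 1 - \<epsilon> - 6000 * s\<^sup>2" by linarith
  then show ?thesis
    unfolding answer_prob_def \<theta>_def[symmetric] \<mu>_def[symmetric] X_def[symmetric] s2 r_def .
qed

lemma finite_spikes: "finite (spikes d k)"
proof -
  define V where "V = {1 / sqrt (real k + 1), - 1 / sqrt (real k + 1), 0}"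
  have "x j \<in> V" if "x \<in> spikes d k" "j \<in> {0..d}" for x j
    using that by (cases "j = 0") (simp_all add: spikes_def V_def)
  moreover have "x j = 0" if "x \<in> spikes d k" "j \<notin> {0..d}" for x j
    using that by (simp add: spikes_def)
  ultimately have "spikes d k \<subseteq> {x. \<forall>j. (j \<in> {0..d} \<longrightarrow> x j \<in> V) \<and> (j \<notin> {0..d} \<longrightarrow> x j = 0)}"
    by blast
  then show ?thesis
    by (rule finite_subset) (rule finite_set_of_finite_funs, simp_all add: V_def)
qed

lemma spikes_nonempty:
  assumes "k \<le> d"
  shows "spikes d k \<noteq> {}"
proof -
  let ?c = "1 / sqrt (real k + 1)"
  have "{j\<in>{1..d}. (if j = 0 then - ?c else if j \<le> k then ?c else 0) \<noteq> 0} = {1..k}"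
    using assms by auto
  then have "(\<lambda>j. if j = 0 then - ?c else if j \<le> k then ?c else 0) \<in> spikes d k"
    using assms by (auto simp: spikes_def)
  then show ?thesis by blast
qed

text \<open>A bound valid for each single spike survives averaging over the prior.\<close>

lemma planted_success:
  assumes "k \<le> d" "\<And>x. x \<in> spikes d k \<Longrightarrow> answer_prob B n d k \<theta> (mv_normal (d + 1) (spiked_cov \<theta> x)) True \<ge> p"
  shows "planted_success_prob B n d k \<theta> \<ge> p"
proof -
  have "real (card (spikes d k)) * p \<le> (\<Sum>x\<in>spikes d k. answer_prob B n d k \<theta> (mv_normal (d + 1) (spiked_cov \<theta> x)) True)"
    using sum_mono[of "spikes d k" "\<lambda>_. p"] assms(2) by simp
  moreover have "real (card (spikes d k)) > 0"
    using finite_spikes spikes_nonempty[OF assms(1)] by (simp add: card_gt_0_iff)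
  ultimately show ?thesis
    unfolding planted_success_prob_def
    by (simp add: integral_pmf_of_set[OF spikes_nonempty[OF assms(1)] finite_spikes] pos_le_divide_eq mult.commute)
qed

section \<open>The reduction\<close>

lemma smallo_one_iff: "f \<in> o(\<lambda>_. 1) \<longleftrightarrow> f \<longlonglongrightarrow> (0 :: real)"
  using smalloD_tendsto[of f sequentially "\<lambda>_. 1"] smalloI_tendsto[of f "\<lambda>_. 1" sequentially] by auto

lemma noise_factor_tendsto: "(\<lambda>n. 6000 * (1 - (noise_factor n)\<^sup>2)) \<longlonglongrightarrow> 0"
  unfolding noise_factor_def by real_asymp

text \<open>Extracts the growth used in the time comparison: \<open>d\<close> is at least
  \<open>n\<close>, and \<open>k\<close> grows at least like the square root of \<open>n\<close>, so
  it tends to infinity.\<close>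

lemma sample_regime_eventually:
  assumes "sample_regime \<delta> d k" "0 < \<delta>"
  shows "\<forall>\<^sub>F n in sequentially. n \<le> d n \<and> n \<le> (k n)\<^sup>2"
proof -
  have "(\<lambda>n. real n) \<in> o(\<lambda>n. min (real (d n)) (real (k n) powr (2 - \<delta>)))"
    using assms by (simp add: sample_regime_def)
  from landau_o.smallD[OF this zero_less_one]
  show ?thesis using eventually_ge_at_top[of 1]
  proof eventually_elim
    case (elim n)
    then have n: "real n \<le> real (d n)" "real n \<le> real (k n) powr (2 - \<delta>)" "1 \<le> n" by auto
    \<comment> \<open>For \<open>k n = 0\<close> the power is 0 by convention, below
      \<open>n\<close>.\<close>
    then have "k n \<noteq> 0" by (auto intro: ccontr)
    then have "real (k n) powr (2 - \<delta>) \<le> real (k n) powr 2"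
      using assms(2) by (intro powr_mono) auto
    also have "\<dots> = (real (k n))\<^sup>2" using \<open>k n \<noteq> 0\<close> by (simp add: powr_numeral)
    finally have "real n \<le> (real (k n))\<^sup>2" using n(2) by linarith
    then have "n \<le> (k n)\<^sup>2" by (metis of_nat_le_iff of_nat_power)
    with n show ?case by simp
  qed
qed

text \<open>With \<open>a = k powr (c / 2)\<close>, both the learner's time and the overhead are
  eventually at most \<open>d powr a\<close>, whereas the lower bound is
  \<open>d powr (a * a)\<close>. As soon as \<open>a \<ge> 3\<close> and \<open>d > 2\<close>, the
  latter exceeds twice the former.\<close>

lemma not_superpolynomial:
  fixes d k :: "nat \<Rightarrow> nat" and T :: "nat \<Rightarrow> real"
  assumes reg: "\<forall>\<^sub>F n in sequentially. n \<le> d n \<and> n \<le> (k n)\<^sup>2"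
    and T: "time_d_k_o1 d k T"
  shows "\<not> time_d_k_Omega1 d k (\<lambda>n. T n + real (n * (d n * 7 + 14) + 9))"
proof
  assume "time_d_k_Omega1 d k (\<lambda>n. T n + real (n * (d n * 7 + 14) + 9))"
  then obtain c where c: "c > 0"
    and low: "\<forall>\<^sub>F n in sequentially. T n + real (n * (d n * 7 + 14) + 9) \<ge> real (d n) powr (real (k n) powr c)"
    unfolding time_d_k_Omega1_def by blast
  obtain f where f: "f \<in> o(\<lambda>_. 1)" and up: "\<forall>\<^sub>F n in sequentially. T n \<le> real (d n) powr (real (k n) powr f n)"
    using T unfolding time_d_k_o1_def by blast
  have "f \<longlonglongrightarrow> 0" using f by (simp add: smallo_one_iff)
  then have fc: "\<forall>\<^sub>F n in sequentially. f n < c / 2" using c by (intro order_tendstoD) auto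
  \<comment> \<open>The exponent \<open>c / 4\<close> comes from \<open>n \<le> k\<^sup>2\<close>:
    it makes \<open>k powr (c / 2)\<close> at least \<open>n powr (c / 4)\<close>.\<close>
  have "filterlim (\<lambda>n. real n powr (c / 4)) at_top sequentially"
    using c by real_asymp
  then have big: "\<forall>\<^sub>F n in sequentially. real n powr (c / 4) \<ge> 3"
    by (simp add: filterlim_at_top)
  have "\<forall>\<^sub>F n in sequentially. False"
    using reg low up fc big eventually_ge_at_top[of "30 :: nat"]
  proof eventually_elim
    case (elim n)
    define a where "a = real (k n) powr (c / 2)"
    have d: "real (d n) \<ge> 30" "real n \<le> real (d n)" using elim by auto
    have k: "real (k n) \<ge> 1" using elim by (cases "k n") auto
    have "real n \<le> (real (k n))\<^sup>2" using elim(1) by (metis of_nat_le_iff of_nat_power)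
    then have "real n powr (c / 4) \<le> ((real (k n))\<^sup>2) powr (c / 4)" using c by (intro powr_mono2) auto
    also have "(real (k n))\<^sup>2 = real (k n) powr 2" using k by simp
    also have "\<dots> powr (c / 4) = a" unfolding powr_powr a_def by simp
    finally have a: "a \<ge> 3" using elim by simp
    have kc: "real (k n) powr c = a * a" by (simp add: a_def powr_add[symmetric])
    have "real (k n) powr f n \<le> a" unfolding a_def using k elim by (intro powr_mono) auto
    then have "real (d n) powr (real (k n) powr f n) \<le> real (d n) powr a" using d by (intro powr_mono) auto
    then have 1: "T n \<le> real (d n) powr a" using elim by linarith
    have "real (n * (d n * 7 + 14) + 9) = real n * (real (d n) * 7 + 14) + 9" by simp
    also have "\<dots> \<le> real (d n) * (real (d n) * 7 + 14) + 9"
      using d by (intro add_right_mono mult_right_mono) auto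
    also have "\<dots> \<le> real (d n) * (real (d n) * 7 + 14) + real (d n) * 9"
      using d by auto
    also have "\<dots> = real (d n) * (real (d n) * 7 + 23)" by (simp add: algebra_simps)
    \<comment> \<open>Origin of the bound 30:
      \<open>7 * d + 23 \<le> 30 * d \<le> d * d\<close>.\<close>
    also have "\<dots> \<le> real (d n) * (real (d n) * real (d n))"
    proof (rule mult_left_mono)
      have "30 * real (d n) \<le> real (d n) * real (d n)" using d by (intro mult_right_mono) auto
      then show "real (d n) * 7 + 23 \<le> real (d n) * real (d n)" using d by linarith
    qed simp
    also have "\<dots> = real (d n) powr 3" using d by (simp add: powr_numeral power3_eq_cube)
    also have "\<dots> \<le> real (d n) powr a" using d a by (intro powr_mono) auto
    finally have 2: "real (n * (d n * 7 + 14) + 9) \<le> real (d n) powr a" .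
    have "real (d n) powr (a * a) \<le> 2 * real (d n) powr a"
      using 1 2 elim(2) unfolding kc by linarith
    also have "\<dots> < real (d n) * real (d n) powr a"
      using d by (intro mult_strict_right_mono) auto
    also have "\<dots> = real (d n) powr (a + 1)" using d by (simp add: powr_add)
    also have "\<dots> \<le> real (d n) powr (a * a)"
    proof (rule powr_mono)
      have "a * a \<ge> 3 * a" using a by (intro mult_right_mono) auto
      then show "a + 1 \<le> a * a" using a by linarith
    qed (use d in simp)
    finally show False by simp
  qed
  then show False by simp
qed

theorem theorem1p5:
  fixes \<delta> :: real and d k :: "nat \<Rightarrow> nat"
  assumes "0 < \<delta>" and "\<delta> \<le> 1 / 10"
    and "sample_regime \<delta> d k"
    and "\<exists>L T. slr_learner_whp L d k 1 (1 / 100) \<and> slr_runs_in_time L d k 1 T \<and> time_d_k_o1 d k T"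
  shows "\<not> hardness_assumption"
proof
  assume hard: "hardness_assumption"
  obtain L T where learner: "slr_learner_whp L d k 1 (1 / 100)" and time: "slr_runs_in_time L d k 1 T"
    and T: "time_d_k_o1 d k T" using assms(4) by blast
  have kd: "k n \<le> d n" for n using assms(3) by (simp add: sample_regime_def)
  obtain N where N: "4 \<le> N" "com_below N L"
    using eventually_conj[OF eventually_com_below[of L] eventually_ge_at_top[of 4]]
    by (auto simp: eventually_sequentially)
  let ?B = "distinguisher N L" and ?\<theta> = "\<lambda>n. spike_strength n (k n)"
  obtain \<epsilon> where \<epsilon>: "\<epsilon> \<longlonglongrightarrow> 0" and success: "\<And>n \<Sigma> x. psd (d n) \<Sigma> \<Longrightarrow> sparse (d n) (k n) x \<Longrightarrow>
      slr_success_prob L n (d n) (k n) 1 (1 / 100) \<Sigma> x \<ge> 1 - \<epsilon> n"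
    using learner unfolding slr_learner_whp_def smallo_one_iff by blast
  have halts: "\<forall>\<^sub>F n in sequentially. \<forall>A y \<omega>. \<exists>t s'. exec \<omega> L (slr_input n (d n) (k n) 1 A y) t s' \<and> real t \<le> T n"
    using time by (simp add: slr_runs_in_time_def)
  \<comment> \<open>The sum of the learner's failure, the Markov term and the null error. The
    absolute value guards against negative \<open>\<epsilon> n\<close>, which the definition of a
    learner admits.\<close>
  define \<epsilon>' where "\<epsilon>' n = \<bar>\<epsilon> n\<bar> + 6000 * (1 - (noise_factor n)\<^sup>2) + (9 / 10) ^ n" for n
  have nn: "0 \<le> 6000 * (1 - (noise_factor n)\<^sup>2)" for n using noise_factor_square_less[of n] by simp
  have "\<forall>\<^sub>F n in sequentially. solves_negspca ?B n (d n) (k n) (?\<theta> n) (1 - \<epsilon>' n)"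
    using halts order_tendstoD(2)[OF \<epsilon> zero_less_one] eventually_ge_at_top[of 8]
  proof eventually_elim
    case (elim n)
    have "planted_success_prob ?B n (d n) (k n) (?\<theta> n) \<ge> 1 - \<epsilon> n - 6000 * (1 - (noise_factor n)\<^sup>2)"
      by (rule planted_success[OF kd planted_answer]) (use elim N success in auto)
    moreover have "null_success_prob ?B n (d n) (k n) (?\<theta> n) \<ge> 1 - (9 / 10) ^ n"
      by (rule null_success) (use elim N in blast)+
    moreover have "(0 :: real) \<le> (9 / 10) ^ n" by simp
    moreover have "\<epsilon> n \<le> \<bar>\<epsilon> n\<bar>" "0 \<le> \<bar>\<epsilon> n\<bar>" by simp_all
    ultimately show ?case
      unfolding solves_negspca_def \<epsilon>'_def using nn[of n] by linarith
  qed
  then obtain n0 where n0: "\<And>n. n \<ge> n0 \<Longrightarrow> solves_negspca ?B n (d n) (k n) (?\<theta> n) (1 - \<epsilon>' n)"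
    by (auto simp: eventually_sequentially)
  \<comment> \<open>Solving is demanded for every \<open>n\<close>, but halting is known only
    eventually; error 1 makes the finitely many remaining cases trivial.\<close>
  define \<epsilon>'' where "\<epsilon>'' n = (if n \<ge> n0 then \<epsilon>' n else 1)" for n
  have "(\<lambda>n. \<bar>\<epsilon> n\<bar> + 6000 * (1 - (noise_factor n)\<^sup>2) + (9 / 10) ^ n) \<longlonglongrightarrow> \<bar>0\<bar> + 0 + 0"
    by (intro tendsto_add tendsto_rabs \<epsilon> noise_factor_tendsto LIMSEQ_realpow_zero) auto
  then have "\<epsilon>' \<longlonglongrightarrow> 0" by (simp add: \<epsilon>'_def[abs_def])
  moreover have "\<forall>\<^sub>F n in sequentially. \<epsilon>' n = \<epsilon>'' n"
    unfolding \<epsilon>''_def by (rule eventually_mono[OF eventually_ge_at_top[of n0]]) simp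
  ultimately have "\<epsilon>'' \<longlonglongrightarrow> 0" by (rule Lim_transform_eventually)
  moreover have "solves_negspca ?B n (d n) (k n) (?\<theta> n) (1 - \<epsilon>'' n)" for n
  proof (cases "n \<ge> n0")
    case True
    then show ?thesis using n0 by (simp add: \<epsilon>''_def)
  next
    case False
    then show ?thesis
      by (auto simp: \<epsilon>''_def solves_negspca_def planted_success_prob_def null_success_prob_def answer_prob_def)
  qed
  ultimately have solves: "solves_negspca_whp ?B d k ?\<theta>"
    unfolding solves_negspca_whp_def smallo_one_iff by blast
  let ?T = "\<lambda>n. T n + real (n * (d n * 7 + 14) + 9)"
  have runs: "negspca_runs_in_time ?B d k ?\<theta> ?T"
    unfolding negspca_runs_in_time_def
    using halts eventually_ge_at_top[of 1]
  proof eventually_elim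
    case (elim n)
    show ?case
    proof (intro allI)
      fix Z :: "nat \<Rightarrow> nat \<Rightarrow> real" and \<omega> :: "nat \<Rightarrow> real"
      \<comment> \<open>The learner's time bound ranges over all inputs and tapes, hence also covers
        the noisy responses and the shifted tape.\<close>
      obtain t s' where e: "exec (\<lambda>i. \<omega> (i + n)) L (slr_input n (d n) (k n) 1 (\<lambda>i j. Z i (Suc j)) (noisy_response n Z \<omega>)) t s'"
        and t: "real t \<le> T n" using elim by blast
      obtain t1 s1 where "exec \<omega> ?B (negspca_input n (d n) (k n) (?\<theta> n) Z) t1 s1" "t1 \<le> t + (n * (d n * 7 + 14) + 9)"
        using exec_distinguisher[OF elim(2) N e, of "?\<theta> n"] unfolding runs_to_def by blast
      moreover from this(2) have "real t1 \<le> real (t + (n * (d n * 7 + 14) + 9))" by (simp only: of_nat_le_iff)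
      then have "real t1 \<le> ?T n" using t by simp
      ultimately show "\<exists>t s'. exec \<omega> ?B (negspca_input n (d n) (k n) (?\<theta> n) Z) t s' \<and> real t \<le> ?T n" by blast
    qed
  qed
  have "0 < ?\<theta> n \<and> ?\<theta> n < 1" for n using spike_strength_bounds by blast
  with hard[unfolded hardness_assumption_def, rule_format, OF assms(1-3) _ solves runs]
  have "time_d_k_Omega1 d k ?T" by simp
  then show False
    using not_superpolynomial[OF sample_regime_eventually[OF assms(3,1)] T] by simp
qed

end
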